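(* Every point of $\mathcal{S}_{n,k}$ is semistable for the action of $SL(V)$ (with respect to the natural polarization of $\mathcal{S}_{n,k}$ as a GIT quotient).
   Context: $V$, $W$, $I$ are complex vector spaces of dimensions $n+1$, $n+k$, $k$, and $\mathbf{P}^n=\mathbf{P}(V)$ with $H^0(\mathcal{O}(1))=V$. A Steiner bundle over $\mathbf{P}^n$ is a vector bundle $S$ whose dual appears in an exact sequence $0\to S^*\to W\otimes\mathcal{O}\to I\otimes\mathcal{O}(1)\to 0$; $\mathcal{S}_{n,k}$ is the moduli space of such bundles. Let $\mathcal{S}\subset\mathbf{P}(\mathrm{Hom}(W,V\otimes I))$ be the open subset of those $\phi\colon W\to V\otimes I$ such that for every nonzero $v^*\in V^*$ the composite $v^*\circ\phi\colon W\to I$ has maximal rank; equivalently $\phi$ induces a surjection $W\otimes\mathcal{O}\to I\otimes\mathcal{O}(1)$ on $\mathbf{P}(V)$. Every point of $\mathcal{S}$ is stable for $SL(W)\times SL(I)$, and $\mathcal{S}_{n,k}=\mathcal{S}/SL(W)\times SL(I)$ is an open subset of the GIT quotient $\mathbf{P}(\mathrm{Hom}(W,V\otimes I))/SL(W)\times SL(I)$, which carries a natural polarization and a natural $SL(V)$-action. Semistability is in the sense of Mumford's Geometric Invariant Theory. *)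

theory Defs
  imports "HOL-Analysis.Analysis"
begin

section \<open>GIT quotients of projective spaces of matrices\<close>

text \<open>
  The ambient vector space \<open>E\<close> is a space of complex matrices \<open>complex^'b^'a\<close>, and points of
  \<open>P(E)\<close> (lines in \<open>E\<close>) are given by nonzero representatives. A group acting linearly on \<open>E\<close> enters
  through the set \<open>G\<close> of linear automorphisms of \<open>E\<close> by which it acts.
\<close>

definition monomial :: "('a::finite \<times> 'b::finite \<Rightarrow> nat) \<Rightarrow> complex^'b^'a \<Rightarrow> complex" where
  "monomial \<alpha> X = (\<Prod>e\<in>UNIV. (X $ fst e $ snd e) ^ \<alpha> e)"

text \<open>Forms of degree \<open>d\<close> on \<open>E\<close>, i.e. the space \<open>H\<^sup>0(P(E), O(d))\<close>.\<close>

definition forms :: "nat \<Rightarrow> (complex^'b::finite^'a::finite \<Rightarrow> complex) set" where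
  "forms d = {f. \<exists>c. \<forall>X. f X = (\<Sum>\<alpha> | sum \<alpha> UNIV = d. c \<alpha> * monomial \<alpha> X)}"

definition invariant_forms ::
  "(complex^'b::finite^'a::finite \<Rightarrow> complex^'b^'a) set \<Rightarrow> nat \<Rightarrow> (complex^'b^'a \<Rightarrow> complex) set" where
  "invariant_forms G d = {f \<in> forms d. \<forall>g\<in>G. \<forall>X. f (g X) = f X}"

text \<open>Nonzero vectors over the semistable locus of \<open>P(E)\<close>, linearized by \<open>O(1)\<close>.\<close>

definition semistable_locus ::
  "(complex^'b::finite^'a::finite \<Rightarrow> complex^'b^'a) set \<Rightarrow> (complex^'b^'a) set" where
  "semistable_locus G = {X. \<exists>d>0. \<exists>f\<in>invariant_forms G d. f X \<noteq> 0}"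

text \<open>
  For reductive \<open>G\<close> the quotient \<open>Y = P(E)/G\<close> is \<open>Proj R\<close>, where \<open>R\<close> is the graded ring of invariant
  forms. A closed point of \<open>Proj R\<close> is a graded evaluation \<open>R \<rightarrow> \<complex>[t]\<close>, not zero on \<open>R\<^sub>+\<close>, up to
  rescaling \<open>t\<close>; it is represented here by the set of all semistable vectors lying over it.
\<close>

definition git_rel ::
  "(complex^'b::finite^'a::finite \<Rightarrow> complex^'b^'a) set \<Rightarrow> ((complex^'b^'a) \<times> (complex^'b^'a)) set" where
  "git_rel G = {(X, Z). X \<in> semistable_locus G \<and> Z \<in> semistable_locus G \<and>
     (\<exists>c. c \<noteq> 0 \<and> (\<forall>d. \<forall>f\<in>invariant_forms G d. f Z = c ^ d * f X))}"

definition git_quotient ::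
  "(complex^'b::finite^'a::finite \<Rightarrow> complex^'b^'a) set \<Rightarrow> (complex^'b^'a) set set" where
  "git_quotient G = semistable_locus G // git_rel G"

text \<open>
  Global sections of \<open>O(d)\<close> on \<open>Y = Proj R\<close>: functions on the cone over \<open>Y\<close> that are locally in the
  Zariski topology quotients \<open>a / b\<close> of homogeneous elements of \<open>R\<close> of degree difference \<open>d\<close>.
  They are written as functions on the semistable vectors of \<open>E\<close>; values elsewhere are irrelevant.
\<close>

definition git_sections ::
  "(complex^'b::finite^'a::finite \<Rightarrow> complex^'b^'a) set \<Rightarrow> nat \<Rightarrow> (complex^'b^'a \<Rightarrow> complex) set" where
  "git_sections G d = {s. \<forall>X\<in>semistable_locus G. \<exists>e. \<exists>a\<in>invariant_forms G (d + e).
     \<exists>b\<in>invariant_forms G e. b X \<noteq> 0 \<and> (\<forall>Z\<in>semistable_locus G. b Z \<noteq> 0 \<longrightarrow> s Z = a Z / b Z)}"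

text \<open>
  Mumford semistability of a point \<open>p\<close> of \<open>Y\<close>, polarized by \<open>L = O(r)\<close>, under a second group \<open>H\<close>
  acting on \<open>E\<close> and commuting with \<open>G\<close>; the action on \<open>Y\<close> and its linearization are the induced ones.
  Mumford also asks that the nonvanishing locus of the section be affine, which is automatic for an
  ample line bundle on a projective variety.
\<close>

definition git_semistable ::
  "(complex^'b::finite^'a::finite \<Rightarrow> complex^'b^'a) set \<Rightarrow> nat \<Rightarrow>
   (complex^'b^'a \<Rightarrow> complex^'b^'a) set \<Rightarrow> (complex^'b^'a) set \<Rightarrow> bool" where
  "git_semistable G r H p \<longleftrightarrow> p \<in> git_quotient G \<and>
     (\<exists>m>0. \<exists>s\<in>git_sections G (r * m).
        (\<forall>h\<in>H. \<forall>X\<in>semistable_locus G. s (h X) = s X) \<and> (\<forall>X\<in>p. s X \<noteq> 0))"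

lemma equiv_git_rel: "equiv (semistable_locus G) (git_rel G)"
proof (rule equivI)
  show "git_rel G \<subseteq> semistable_locus G \<times> semistable_locus G"
    by (auto simp: git_rel_def)
  show "refl_on (semistable_locus G) (git_rel G)"
    by (auto simp: refl_on_def git_rel_def intro!: exI[of _ "1::complex"])
  show "sym (git_rel G)"
  proof (rule symI)
    fix X Z assume "(X, Z) \<in> git_rel G"
    then obtain c where c: "X \<in> semistable_locus G" "Z \<in> semistable_locus G" "c \<noteq> 0"
      "\<And>d f. f \<in> invariant_forms G d \<Longrightarrow> f Z = c ^ d * f X"
      by (auto simp: git_rel_def)
    have "f X = inverse c ^ d * f Z" if "f \<in> invariant_forms G d" for d f
      using c(3) c(4)[OF that] by (simp add: field_simps)
    then show "(Z, X) \<in> git_rel G"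
      using c(1-3) by (auto simp: git_rel_def intro!: exI[of _ "inverse c"])
  qed
  show "trans (git_rel G)"
  proof (rule transI)
    fix X Y Z assume "(X, Y) \<in> git_rel G" "(Y, Z) \<in> git_rel G"
    then obtain b c where bc: "X \<in> semistable_locus G" "Z \<in> semistable_locus G" "b \<noteq> 0" "c \<noteq> 0"
      "\<And>d f. f \<in> invariant_forms G d \<Longrightarrow> f Y = b ^ d * f X"
      "\<And>d f. f \<in> invariant_forms G d \<Longrightarrow> f Z = c ^ d * f Y"
      unfolding git_rel_def by blast
    have "f Z = (c * b) ^ d * f X" if "f \<in> invariant_forms G d" for d f
      using bc(5,6)[OF that] by (simp add: power_mult_distrib)
    then show "(X, Z) \<in> git_rel G"
      using bc(1-4) by (auto simp: git_rel_def intro!: exI[of _ "c * b"])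
  qed
qed

text \<open>Whether a section vanishes at a point of \<open>Y\<close> does not depend on the representative.\<close>

lemma git_sections_nonzero_cong:
  assumes "s \<in> git_sections G d" "(X, Z) \<in> git_rel G"
  shows "s X \<noteq> 0 \<longleftrightarrow> s Z \<noteq> 0"
proof -
  from assms(2) obtain c where c: "X \<in> semistable_locus G" "Z \<in> semistable_locus G" "c \<noteq> 0"
    "\<And>d f. f \<in> invariant_forms G d \<Longrightarrow> f Z = c ^ d * f X"
    by (auto simp: git_rel_def)
  from assms(1) c(1) obtain e a b where ab: "a \<in> invariant_forms G (d + e)"
    "b \<in> invariant_forms G e" "b X \<noteq> 0"
    "\<And>Z. Z \<in> semistable_locus G \<Longrightarrow> b Z \<noteq> 0 \<Longrightarrow> s Z = a Z / b Z"
    unfolding git_sections_def by blast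
  have "b Z \<noteq> 0"
    using c(3) c(4)[OF ab(2)] ab(3) by simp
  then show ?thesis
    using ab(4)[OF c(1) ab(3)] ab(4)[OF c(2)] c(3) c(4)[OF ab(1)] ab(3) by simp
qed


section \<open>Steiner bundles\<close>

text \<open>
  Here \<open>V = complex^'v\<close>, \<open>W = complex^'w\<close>, \<open>I = complex^'i\<close>, and \<open>V \<otimes> I = complex^('v \<times> 'i)\<close> with
  basis \<open>e\<^sub>x \<otimes> e\<^sub>i\<close>. An element of \<open>Hom(W, V \<otimes> I)\<close> is its matrix \<open>complex^'w^('v \<times> 'i)\<close>.
\<close>

definition kron ::
  "complex^'v::finite^'v \<Rightarrow> complex^'i::finite^'i \<Rightarrow> complex^('v \<times> 'i)^('v \<times> 'i)" where
  "kron A B = (\<chi> x. \<chi> y. A $ fst x $ fst y * B $ snd x $ snd y)"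

definition SL :: "(complex^'n::finite^'n) set" where
  "SL = {A. det A = 1}"

definition SL_W_I_action :: "(complex^'w::finite^('v::finite \<times> 'i::finite) \<Rightarrow> complex^'w^('v \<times> 'i)) set" where
  "SL_W_I_action = {\<lambda>\<phi>. kron (mat 1) B ** \<phi> ** matrix_inv A | A B. A \<in> SL \<and> B \<in> SL}"

definition SL_V_action :: "(complex^'w::finite^('v::finite \<times> 'i::finite) \<Rightarrow> complex^'w^('v \<times> 'i)) set" where
  "SL_V_action = {\<lambda>\<phi>. kron A (mat 1) ** \<phi> | A. A \<in> SL}"

text \<open>The composite \<open>v\<^sup>* \<circ> \<phi> : W \<rightarrow> I\<close> for \<open>v\<^sup>* \<in> V\<^sup>*\<close>, in dual coordinates.\<close>

definition contract ::
  "complex^'v::finite \<Rightarrow> complex^'w::finite^('v \<times> 'i::finite) \<Rightarrow> complex^'w^'i" where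
  "contract v \<phi> = (\<chi> i. \<chi> w. \<Sum>x\<in>UNIV. v $ x * \<phi> $ (x, i) $ w)"

definition steiner_maps :: "(complex^'w::finite^('v::finite \<times> 'i::finite)) set" where
  "steiner_maps = {\<phi>. \<phi> \<noteq> 0 \<and> (\<forall>v. v \<noteq> 0 \<longrightarrow> rank (contract v \<phi>) = min CARD('w) CARD('i))}"

text \<open>
  The moduli space \<open>S\<^sub>n\<^sub>,\<^sub>k\<close> as the image of the above maps in the quotient. As all of these are stable,
  a point of it is the set of representatives of a single orbit in \<open>P(Hom(W, V \<otimes> I))\<close>.
\<close>

definition steiner_moduli :: "(complex^'w::finite^('v::finite \<times> 'i::finite)) set set" where
  "steiner_moduli = (\<lambda>\<phi>. git_rel SL_W_I_action `` {\<phi>}) ` steiner_maps"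

end

theory Submission
  imports Defs "HOL-Library.Poly_Mapping" "HOL-Computational_Algebra.Fundamental_Theorem_Algebra"
begin

text \<open>
  A Steiner map \<open>\<phi>\<close> is semistable because the hyperdeterminant of boundary format is an invariant that
  does not vanish there. Multiplication by \<open>\<phi>\<close> is a linear map
  \<open>W \<otimes> S\<^bsup>k-1\<^esup>V \<rightarrow> I \<otimes> S\<^bsup>k\<^esup>V\<close> between spaces of the same dimension, as
  \<open>(n + k) * (n + k - 1 choose k - 1) = k * (n + k choose k)\<close>. Its determinant is a form in \<open>\<phi>\<close>. Each of
  the three groups acts on it through determinants of linear representations, and these are trivial on
  \<open>SL\<close> (\<open>det_representation_SL\<close>). So the determinant is invariant, and its \<open>r\<close>-th power is the section
  of the polarization that is asked for.

  It remains to see that the determinant is nonzero when \<open>\<phi>\<close> has maximal rank at every nonzero point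
  of \<open>V\<^sup>*\<close>. Equivalently, the cokernel of \<open>W \<otimes> R(-1) \<rightarrow> I \<otimes> R\<close>, with \<open>R\<close> the polynomial ring, is zero
  in degree \<open>k\<close> (\<open>cokernel_dual_eq_zero\<close>). The proof is by induction on the number of variables, and
  it works with linear functionals on \<open>I \<otimes> R\<close> that kill the columns of \<open>\<phi>\<close>.

  Fix a variable \<open>x\<^sub>0\<close>. On the hyperplane \<open>x\<^sub>0 = 0\<close> there is one column too many. For dimension
  reasons a generic subspace \<open>W'\<close> of codimension one in \<open>W\<close> still has maximal rank there
  (\<open>generic_projection\<close>), and the induction hypothesis applies to it. It makes the system of
  equations on the hyperplane a square invertible one. By Cramer's rule, the maximal minors of \<open>W'\<close>
  are then linearly independent on the hyperplane (\<open>minors_independent\<close>), hence form a basis of the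
  polynomials of degree \<open>k\<close> (\<open>minors_span\<close>). The relations between the columns that Cramer's rule
  provides are independent as well, and a dimension count shows that they are the only obstructions
  to extending a functional from degree \<open>k\<close> to degree \<open>k + 1\<close> (\<open>extend_functional\<close>).

  Let now \<open>L\<close> be a functional of degree \<open>k\<close> that kills all of \<open>W\<close>. Its extension \<open>L'\<close> with
  \<open>L' (x\<^sub>0 f) = L f\<close> also kills all of \<open>W\<close>, because the minors span. Hence \<open>L \<mapsto> L' (x\<^sub>i \<cdot>)\<close>, which is
  ``multiplication by \<open>x\<^sub>i / x\<^sub>0\<close>'', defines commuting operators on a finite-dimensional space. If the
  space is nonzero, then there is a common eigenvector. It has the form \<open>x\<^sup>\<alpha> \<otimes> e \<mapsto> \<xi>\<^sup>\<alpha> \<eta>(e)\<close> up to a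
  scalar, and since it kills the columns, the nonzero covector \<open>\<eta>\<close> kills the image of \<open>\<phi>\<close> at the point
  \<open>\<xi>\<close>. This contradicts maximal rank (\<open>geometric_functional_zero\<close>).
\<close>

section \<open>Counting unknowns and equations\<close>

lemma more_unknowns_than_equations:
  fixes E :: "'a \<Rightarrow> 'b \<Rightarrow> complex"
  assumes "finite B" "finite A" "card A < card B"
  shows "\<exists>v. (\<exists>b\<in>B. v b \<noteq> 0) \<and> (\<forall>a\<in>A. (\<Sum>b\<in>B. E a b * v b) = 0)"
  using assms(2,1,3)
proof (induction A arbitrary: B E rule: finite_induct)
  case empty
  then obtain b where "b \<in> B" by fastforce
  then show ?case by (intro exI[of _ "\<lambda>_. 1"]) auto
next
  case (insert a A)
  show ?case
  proof (cases "\<forall>b\<in>B. E a b = 0")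
    case True
    obtain v where "\<exists>b\<in>B. v b \<noteq> 0" "\<forall>a\<in>A. (\<Sum>b\<in>B. E a b * v b) = 0"
      using insert.IH[of B E] insert.prems insert.hyps by auto
    then show ?thesis using True by (intro exI[of _ v]) auto
  next
    case False
    then obtain c where c: "c \<in> B" "E a c \<noteq> 0" by blast
    let ?B = "B - {c}"
    obtain v where v: "\<exists>b\<in>?B. v b \<noteq> 0"
      "\<forall>x\<in>A. (\<Sum>b\<in>?B. (E x b - E x c * E a b / E a c) * v b) = 0"
      using insert.IH[of ?B "\<lambda>x b. E x b - E x c * E a b / E a c"] insert.prems insert.hyps c
      by (fastforce simp: card_Diff_singleton)
    \<comment> \<open>back substitution: the pivot unknown is chosen so that the eliminated equation holds\<close>
    define u where "u = v(c := - (\<Sum>b\<in>?B. E a b * v b) / E a c)"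
    have split: "(\<Sum>b\<in>B. E x b * u b) = E x c * u c + (\<Sum>b\<in>?B. E x b * v b)" for x
      using insert.prems(1) c by (subst sum.remove[OF _ c(1)]) (auto simp: u_def intro!: sum.cong)
    have "(\<Sum>b\<in>B. E x b * u b) = 0" if "x \<in> insert a A" for x
    proof (cases "x = a")
      case True then show ?thesis using split[of x] c by (simp add: u_def)
    next
      case False
      then have "(\<Sum>b\<in>?B. (E x b - E x c * E a b / E a c) * v b) = 0" using v(2) that by auto
      moreover have "(\<Sum>b\<in>?B. (E x b - E x c * E a b / E a c) * v b) =
          (\<Sum>b\<in>?B. E x b * v b) - E x c / E a c * (\<Sum>b\<in>?B. E a b * v b)"
        by (simp add: algebra_simps sum_subtractf sum_distrib_left)
      ultimately show ?thesis using split[of x] c by (simp add: u_def)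
    qed
    moreover have "\<exists>b\<in>B. u b \<noteq> 0" using v(1) by (auto simp: u_def)
    ultimately show ?thesis by blast
  qed
qed

text \<open>
  If \<open>u\<close> were nonzero at \<open>c\<close>, then column \<open>c\<close> would be a combination of the other columns. A row
  combination that kills these exists, as they are too few, and it would kill column \<open>c\<close> too.
\<close>

lemma square_system_transpose:
  fixes E :: "'a \<Rightarrow> 'b \<Rightarrow> complex"
  assumes fin: "finite A" "finite B" and card: "card B \<le> card A"
    and inj: "\<And>g. \<forall>b\<in>B. (\<Sum>a\<in>A. g a * E a b) = 0 \<Longrightarrow> \<forall>a\<in>A. g a = 0"
    and u: "\<forall>a\<in>A. (\<Sum>b\<in>B. E a b * u b) = 0"
  shows "\<forall>b\<in>B. u b = 0"
proof (rule ccontr)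
  assume "\<not> ?thesis"
  then obtain c where c: "c \<in> B" "u c \<noteq> 0" by blast
  have "card (B - {c}) < card A" using fin card c
    by (metis card_Diff1_less leD linorder_not_le order_less_le_trans)
  then obtain g where g: "\<exists>a\<in>A. g a \<noteq> 0" "\<forall>b\<in>B-{c}. (\<Sum>a\<in>A. E a b * g a) = 0"
    using more_unknowns_than_equations[of A "B - {c}" "\<lambda>b a. E a b"] fin by auto
  have "0 = (\<Sum>a\<in>A. g a * (\<Sum>b\<in>B. E a b * u b))" using u by simp
  also have "\<dots> = (\<Sum>b\<in>B. u b * (\<Sum>a\<in>A. g a * E a b))"
    unfolding sum_distrib_left by (subst sum.swap) (simp add: algebra_simps)
  also have "\<dots> = u c * (\<Sum>a\<in>A. g a * E a c)"
    using g(2) fin c by (subst sum.remove[OF _ c(1)]) (auto simp: mult.commute intro!: sum.neutral)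
  finally have "(\<Sum>a\<in>A. g a * E a c) = 0" using c by simp
  then have "\<forall>b\<in>B. (\<Sum>a\<in>A. g a * E a b) = 0" using g(2) by (auto simp: mult.commute)
  then show False using inj g(1) by blast
qed

text \<open>
  The image of \<open>E\<close> is orthogonal to the relations \<open>r\<close>, and the two dimensions add up to that of the
  whole space. So the image is all of the annihilator of the relations.
\<close>

lemma solvable_if_orthogonal_to_relations:
  fixes E :: "'a \<Rightarrow> 'p \<Rightarrow> complex" and r :: "'q \<Rightarrow> 'a \<Rightarrow> complex"
  assumes fin: "finite A" "finite P" "finite Q" and card: "card A \<le> card P + card Q"
    and inj: "\<And>g. \<forall>a\<in>A. (\<Sum>p\<in>P. E a p * g p) = 0 \<Longrightarrow> \<forall>p\<in>P. g p = 0"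
    and indep: "\<And>d. \<forall>a\<in>A. (\<Sum>q\<in>Q. d q * r q a) = 0 \<Longrightarrow> \<forall>q\<in>Q. d q = 0"
    and rel: "\<And>q p. q \<in> Q \<Longrightarrow> p \<in> P \<Longrightarrow> (\<Sum>a\<in>A. r q a * E a p) = 0"
    and h: "\<And>q. q \<in> Q \<Longrightarrow> (\<Sum>a\<in>A. r q a * h a) = 0"
  shows "\<exists>g. \<forall>a\<in>A. (\<Sum>p\<in>P. E a p * g p) = h a"
proof -
  let ?B = "insert None (Some ` (Inl ` P \<union> Inr ` Q))"
  let ?F = "\<lambda>a s. case s of None \<Rightarrow> h a | Some (Inl p) \<Rightarrow> E a p | Some (Inr q) \<Rightarrow> cnj (r q a)"
  have cB: "card ?B = Suc (card P + card Q)"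
    using fin by (subst card_insert_disjoint) (auto simp: card_image Plus_def[symmetric] card_Plus)
  have sumB: "(\<Sum>s\<in>?B. ?F a s * v s) = h a * v None + (\<Sum>p\<in>P. E a p * v (Some (Inl p)))
      + (\<Sum>q\<in>Q. v (Some (Inr q)) * cnj (r q a))" for a v
  proof -
    have "(\<Sum>s\<in>?B. ?F a s * v s) = h a * v None + (\<Sum>x\<in>Inl ` P \<union> Inr ` Q. ?F a (Some x) * v (Some x))"
      using fin by (subst sum.insert) (auto simp: sum.reindex)
    also have "(\<Sum>x\<in>Inl ` P \<union> Inr ` Q. ?F a (Some x) * v (Some x)) =
      (\<Sum>x\<in>Inl ` P. ?F a (Some x) * v (Some x)) + (\<Sum>x\<in>Inr ` Q. ?F a (Some x) * v (Some x))"
      using fin by (intro sum.union_disjoint) auto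
    finally show ?thesis by (simp add: sum.reindex mult.commute add.assoc)
  qed
  obtain v where v: "\<exists>s\<in>?B. v s \<noteq> 0" "\<forall>a\<in>A. (\<Sum>s\<in>?B. ?F a s * v s) = 0"
    using more_unknowns_than_equations[of ?B A ?F] fin card cB by auto
  define c g d where "c = v None" "g = (\<lambda>p. v (Some (Inl p)))" "d = (\<lambda>q. v (Some (Inr q)))"
  have eq: "h a * c + (\<Sum>p\<in>P. E a p * g p) + (\<Sum>q\<in>Q. d q * cnj (r q a)) = 0" if "a \<in> A" for a
    using v(2) that unfolding sumB c_g_d_def by auto
  define y where "y a = (\<Sum>q\<in>Q. d q * cnj (r q a))" for a
  \<comment> \<open>the conjugates of the relations are Hermitian-orthogonal to the image of E, hence drop out\<close>
  have ry: "(\<Sum>a\<in>A. r q a * y a) = 0" if q: "q \<in> Q" for q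
  proof -
    have "0 = (\<Sum>a\<in>A. r q a * (h a * c + (\<Sum>p\<in>P. E a p * g p) + y a))"
      using eq by (simp add: y_def)
    also have "\<dots> = c * (\<Sum>a\<in>A. r q a * h a) + (\<Sum>p\<in>P. g p * (\<Sum>a\<in>A. r q a * E a p)) + (\<Sum>a\<in>A. r q a * y a)"
      by (simp add: sum.distrib sum_distrib_left algebra_simps sum.swap[of _ A P])
    finally show ?thesis using h[OF q] rel[OF q] by simp
  qed
  have "(\<Sum>a\<in>A. cnj (y a) * y a) = (\<Sum>q\<in>Q. cnj (d q) * (\<Sum>a\<in>A. r q a * y a))"
  proof -
    have "cnj (y a) = (\<Sum>q\<in>Q. cnj (d q) * r q a)" for a by (simp add: y_def)
    then have "(\<Sum>a\<in>A. cnj (y a) * y a) = (\<Sum>a\<in>A. \<Sum>q\<in>Q. cnj (d q) * (r q a * y a))"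
      by (simp add: sum_distrib_right mult.assoc)
    then show ?thesis by (subst (asm) sum.swap) (simp add: sum_distrib_left)
  qed
  also have "\<dots> = 0" using ry by simp
  finally have "(\<Sum>a\<in>A. complex_of_real ((cmod (y a))\<^sup>2)) = 0"
    by (simp only: complex_norm_square mult.commute[of "y _"])
  then have "complex_of_real (\<Sum>a\<in>A. (cmod (y a))\<^sup>2) = 0" by (simp only: of_real_sum)
  then have "(\<Sum>a\<in>A. (cmod (y a))\<^sup>2) = 0" by (simp only: of_real_eq_0_iff)
  then have y0: "\<forall>a\<in>A. y a = 0" using fin by (simp add: sum_nonneg_eq_0_iff)
  then have "\<forall>a\<in>A. cnj (\<Sum>q\<in>Q. cnj (d q) * r q a) = 0" by (simp add: y_def)
  then have "\<forall>a\<in>A. (\<Sum>q\<in>Q. cnj (d q) * r q a) = 0" by (simp only: complex_cnj_zero_iff)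
  then have d0: "\<forall>q\<in>Q. d q = 0" using indep[of "\<lambda>q. cnj (d q)"] by simp
  have eq': "h a * c + (\<Sum>p\<in>P. E a p * g p) = 0" if "a \<in> A" for a
    using eq[OF that] y0 that by (simp add: y_def)
  have "c \<noteq> 0"
  proof
    assume "c = 0"
    then have "\<forall>p\<in>P. g p = 0" using eq' inj by simp
    then show False using v(1) \<open>c = 0\<close> d0 by (auto simp: c_g_d_def)
  qed
  have "(\<Sum>p\<in>P. E a p * (- g p / c)) = h a" if "a \<in> A" for a
  proof -
    have "(\<Sum>p\<in>P. E a p * g p) = - (h a * c)" using eq'[OF that] by (simp add: add_eq_0_iff)
    then show ?thesis using \<open>c \<noteq> 0\<close> by (simp add: sum_divide_distrib[symmetric] sum_negf)
  qed
  then show ?thesis by (intro exI[of _ "\<lambda>p. - g p / c"]) simp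
qed

section \<open>Determinants over commutative rings\<close>

definition replace_col :: "'a^'n^'n \<Rightarrow> 'n \<Rightarrow> 'a^'n \<Rightarrow> 'a^'n^'n" where
  "replace_col A l e = (\<chi> i j. if j = l then e $ i else A $ i $ j)"

lemma det_replace_col_transpose:
  fixes A :: "'a::comm_ring_1^'n^'n"
  shows "det (replace_col A l e) = det (\<chi> j. if j = l then e else column j A)"
  by (subst det_transpose[symmetric]) (auto simp: replace_col_def transpose_def column_def vec_eq_iff intro!: arg_cong[of _ _ det])

lemma det_replace_col_sum:
  fixes A :: "'a::comm_ring_1^'n^'n"
  assumes "finite S"
  shows "det (replace_col A l (\<Sum>s\<in>S. c s *s e s)) = (\<Sum>s\<in>S. c s * det (replace_col A l (e s)))"
  unfolding det_replace_col_transpose det_linear_row_sum[OF assms, of l "\<lambda>_ s. c s *s e s"] det_row_mul ..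

text \<open>
  Both sides are the cofactor at \<open>(i, l)\<close>.
\<close>

lemma det_replace_col_axis:
  fixes A :: "'a::comm_ring_1^'n^'n"
  shows "det (replace_col A l (axis i 1)) = det (\<chi> i'. if i' = i then axis l 1 else A $ i')"
  unfolding det_def
proof (rule sum.cong[OF refl], goal_cases)
  case (1 p)
  then have p: "p permutes UNIV" by simp
  then have bij: "p j = l \<and> j \<noteq> i \<Longrightarrow> p i \<noteq> l" for j by (metis permutes_def)
  show ?case
  proof (cases "p i = l")
    case True
    then have iff: "p j = l \<longleftrightarrow> j = i" for j using bij[of j] by metis
    have "replace_col A l (axis i 1) $ j $ p j = (\<chi> i'. if i' = i then axis l 1 else A $ i') $ j $ p j" for j
      using True iff[of j] by (simp add: replace_col_def axis_def)
    then show ?thesis by simp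
  next
    case False
    obtain j where j: "p j = l" using p by (metis permutes_def)
    then have "(\<Prod>i'\<in>UNIV. replace_col A l (axis i 1) $ i' $ p i') = 0"
      using False by (intro prod_zero) (auto simp: replace_col_def axis_def intro!: exI[of _ j])
    moreover have "(\<Prod>i'\<in>UNIV. (\<chi> i'. if i' = i then axis l 1 else A $ i') $ i' $ p i') = 0"
      using False by (intro prod_zero) (auto simp: axis_def intro!: exI[of _ i])
    ultimately show ?thesis by simp
  qed
qed

lemma vec_eq_sum_axis: "(e :: 'a::comm_ring_1^'n) = (\<Sum>i\<in>UNIV. e $ i *s axis i 1)"
  by (simp add: vec_eq_iff axis_def if_distrib cong: if_cong)

text \<open>
  Cramer's rule without division, so that it applies to matrices of polynomials.
\<close>

lemma cramer_identity:
  fixes A :: "'a::comm_ring_1^'n^'n"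
  shows "det A *s e = (\<Sum>l\<in>UNIV. det (replace_col A l e) *s column l A)"
proof -
  have row: "(\<Sum>l\<in>UNIV. A $ m $ l * det (replace_col A l (axis i 1))) = (if m = i then det A else 0)" for m i
  proof -
    have "(\<Sum>l\<in>UNIV. A $ m $ l * det (replace_col A l (axis i 1))) = det (\<chi> i'. if i' = i then A $ m else A $ i')"
      unfolding det_replace_col_axis det_row_mul[symmetric]
      by (subst det_linear_row_sum[symmetric], simp, subst vec_eq_sum_axis[of "A $ m", symmetric], rule refl)
    also have "\<dots> = (if m = i then det A else 0)"
    proof (cases "m = i")
      case True then show ?thesis by (auto simp: vec_eq_iff intro!: arg_cong[of _ _ det])
    next
      case False then show ?thesis
        by (simp, intro det_identical_rows[of m i]) (auto simp: row_def vec_eq_iff)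
    qed
    finally show ?thesis .
  qed
  have "(\<Sum>l\<in>UNIV. det (replace_col A l e) * A $ m $ l) = det A * e $ m" for m
  proof -
    have "det (replace_col A l e) = (\<Sum>i\<in>UNIV. e $ i * det (replace_col A l (axis i 1)))" for l
      using det_replace_col_sum[of UNIV A l "\<lambda>i. e $ i" "\<lambda>i. axis i 1"] vec_eq_sum_axis[of e] by simp
    then have "(\<Sum>l\<in>UNIV. det (replace_col A l e) * A $ m $ l)
        = (\<Sum>i\<in>UNIV. e $ i * (\<Sum>l\<in>UNIV. A $ m $ l * det (replace_col A l (axis i 1))))"
      unfolding sum_distrib_left by (subst sum.swap) (simp add: sum_distrib_left algebra_simps)
    also have "\<dots> = det A * e $ m" unfolding row by (simp add: mult.commute if_distrib cong: if_cong)
    finally show ?thesis .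
  qed
  then show ?thesis by (simp add: vec_eq_iff column_def)
qed

section \<open>Homogeneous polynomials\<close>

type_synonym 'v mpoly = "('v \<Rightarrow>\<^sub>0 nat) \<Rightarrow>\<^sub>0 complex"

definition total_degree :: "('v::finite \<Rightarrow>\<^sub>0 nat) \<Rightarrow> nat" where
  "total_degree \<alpha> = (\<Sum>x\<in>UNIV. Poly_Mapping.lookup \<alpha> x)"

definition exponents :: "'v::finite set \<Rightarrow> nat \<Rightarrow> ('v \<Rightarrow>\<^sub>0 nat) set" where
  "exponents U d = {\<alpha>. Poly_Mapping.keys \<alpha> \<subseteq> U \<and> total_degree \<alpha> = d}"

definition homogeneous :: "nat \<Rightarrow> 'v::finite mpoly \<Rightarrow> bool" where
  "homogeneous d p \<longleftrightarrow> Poly_Mapping.keys p \<subseteq> exponents UNIV d"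

abbreviation const :: "complex \<Rightarrow> 'v mpoly" where "const c \<equiv> Poly_Mapping.single 0 c"
abbreviation mon :: "('v \<Rightarrow>\<^sub>0 nat) \<Rightarrow> 'v mpoly" where "mon \<alpha> \<equiv> Poly_Mapping.single \<alpha> 1"
abbreviation unit_exp :: "'v \<Rightarrow> 'v \<Rightarrow>\<^sub>0 nat" where "unit_exp x \<equiv> Poly_Mapping.single x (Suc 0)"
abbreviation var :: "'v \<Rightarrow> 'v mpoly" where "var x \<equiv> mon (unit_exp x)"

text \<open>The image of \<open>p\<close> in degree \<open>d\<close> of the polynomial ring in the variables \<open>U\<close> is zero.\<close>

definition vanishes :: "'v::finite set \<Rightarrow> nat \<Rightarrow> 'v mpoly \<Rightarrow> bool" where
  "vanishes U d p \<longleftrightarrow> (\<forall>\<alpha>\<in>exponents U d. Poly_Mapping.lookup p \<alpha> = 0)"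

lemma total_degree_add [simp]: "total_degree (\<alpha> + \<beta>) = total_degree \<alpha> + total_degree \<beta>"
  by (simp add: total_degree_def lookup_add sum.distrib)

lemma total_degree_single [simp]: "total_degree (Poly_Mapping.single x n) = n"
  by (simp add: total_degree_def lookup_single when_def)

lemma total_degree_0 [simp]: "total_degree 0 = 0"
  by (simp add: total_degree_def)

lemma keys_add_nat: "Poly_Mapping.keys (\<alpha> + \<beta>) = Poly_Mapping.keys \<alpha> \<union> Poly_Mapping.keys (\<beta> :: 'v \<Rightarrow>\<^sub>0 nat)"
  by (auto simp: in_keys_iff lookup_add)

lemma exponents_zero [simp]: "exponents U 0 = {0}"
proof -
  have "\<alpha> = 0" if "total_degree \<alpha> = 0" for \<alpha> :: "'a \<Rightarrow>\<^sub>0 nat"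
    using that by (intro poly_mapping_eqI) (simp add: total_degree_def)
  then show ?thesis by (auto simp: exponents_def)
qed

lemma unit_exp_add_factor:
  assumes "Poly_Mapping.lookup \<alpha> x > 0"
  shows "\<alpha> = (\<alpha> - unit_exp x) + unit_exp (x::'v)"
  by (rule poly_mapping_eqI) (use assms in \<open>auto simp: lookup_add lookup_minus lookup_single when_def\<close>)

lemma exponents_Suc_obtain:
  assumes "\<alpha> \<in> exponents U (Suc d)"
  obtains x \<beta> where "x \<in> U" "\<beta> \<in> exponents U d" "\<alpha> = \<beta> + unit_exp x"
proof -
  have "\<alpha> \<noteq> 0" using assms by (auto simp: exponents_def)
  then obtain x where x: "x \<in> Poly_Mapping.keys \<alpha>" by (metis keys_eq_empty all_not_in_conv)
  then have pos: "Poly_Mapping.lookup \<alpha> x > 0" by (simp add: in_keys_iff)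
  note eq = unit_exp_add_factor[OF pos]
  have "\<alpha> - unit_exp x \<in> exponents U d" "x \<in> U"
    using assms x unfolding exponents_def
    by (subst (asm) eq, auto simp: keys_add_nat)+
  then show ?thesis using that eq by blast
qed

lemma homogeneous_mult: "homogeneous c p \<Longrightarrow> homogeneous d q \<Longrightarrow> homogeneous (c + d) (p * q)"
  unfolding homogeneous_def using keys_mult[of p q] by (fastforce simp: exponents_def)

lemma homogeneous_sum: "(\<And>s. s \<in> S \<Longrightarrow> homogeneous d (p s)) \<Longrightarrow> homogeneous d (\<Sum>s\<in>S. p s)"
  unfolding homogeneous_def using keys_sum[of p S] by blast

lemma homogeneous_1: "homogeneous 0 1" and homogeneous_0 [simp]: "homogeneous d 0"
  by (auto simp: homogeneous_def exponents_def)

lemma homogeneous_single: "homogeneous d (Poly_Mapping.single \<alpha> c) \<longleftrightarrow> c = 0 \<or> total_degree \<alpha> = d"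
  by (auto simp: homogeneous_def exponents_def)

lemma homogeneous_prod:
  "finite S \<Longrightarrow> (\<And>s. s \<in> S \<Longrightarrow> homogeneous (d s) (p s)) \<Longrightarrow> homogeneous (\<Sum>s\<in>S. d s) (\<Prod>s\<in>S. p s)"
  by (induction S rule: finite_induct) (auto simp: homogeneous_1 intro!: homogeneous_mult)

lemma mpoly_expand: "(p :: 'v mpoly) = (\<Sum>\<alpha>\<in>Poly_Mapping.keys p. Poly_Mapping.single \<alpha> (Poly_Mapping.lookup p \<alpha>))"
proof (rule poly_mapping_eqI)
  fix \<beta>
  show "Poly_Mapping.lookup p \<beta> =
      Poly_Mapping.lookup (\<Sum>\<alpha>\<in>Poly_Mapping.keys p. Poly_Mapping.single \<alpha> (Poly_Mapping.lookup p \<alpha>)) \<beta>"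
    by (cases "\<beta> \<in> Poly_Mapping.keys p")
       (auto simp: lookup_sum lookup_single when_def not_in_keys_iff_lookup_eq_zero sum.delta)
qed

lemma lookup_mult_keys:
  "Poly_Mapping.lookup (p * q :: 'v mpoly) \<alpha> = (\<Sum>\<gamma>\<in>Poly_Mapping.keys p. \<Sum>\<delta>\<in>Poly_Mapping.keys q.
     (Poly_Mapping.lookup p \<gamma> * Poly_Mapping.lookup q \<delta> when \<gamma> + \<delta> = \<alpha>))"
  by (subst mpoly_expand[of p], subst mpoly_expand[of q])
     (simp add: sum_product mult_single lookup_sum lookup_single)

lemma lookup_mon_times: "Poly_Mapping.lookup (mon \<gamma> * p) (\<gamma> + \<beta>) = Poly_Mapping.lookup p (\<beta>::'v \<Rightarrow>\<^sub>0 nat)"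
  by (cases "\<beta> \<in> Poly_Mapping.keys p")
     (auto simp: lookup_mult_keys when_def sum.delta not_in_keys_iff_lookup_eq_zero)

lemma vanishes_mult:
  assumes "vanishes U d p" "homogeneous e q"
  shows "vanishes U (d + e) (p * q)"
  unfolding vanishes_def lookup_mult_keys
proof (intro ballI sum.neutral)
  fix \<alpha> \<gamma> \<delta> assume "\<alpha> \<in> exponents U (d + e)" "\<delta> \<in> Poly_Mapping.keys q"
  then have "Poly_Mapping.lookup p \<gamma> = 0" if "\<gamma> + \<delta> = \<alpha>"
    using assms that unfolding vanishes_def homogeneous_def
    by (auto simp: exponents_def keys_add_nat)
  then show "(Poly_Mapping.lookup p \<gamma> * Poly_Mapping.lookup q \<delta> when \<gamma> + \<delta> = \<alpha>) = 0"
    by (auto simp: when_def)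
qed

lemma vanishes_sum: "(\<And>s. s \<in> S \<Longrightarrow> vanishes U d (p s)) \<Longrightarrow> vanishes U d (\<Sum>s\<in>S. p s)"
  by (simp add: vanishes_def lookup_sum)

lemma vanishes_0 [simp]: "vanishes U d 0"
  by (simp add: vanishes_def)

lemma vanishes_diff: "vanishes U d p \<Longrightarrow> vanishes U d q \<Longrightarrow> vanishes U d (p - q)"
  by (simp add: vanishes_def lookup_minus)

lemma lookup_const_mult: "Poly_Mapping.lookup (const c * p) \<alpha> = c * Poly_Mapping.lookup p (\<alpha>::'v \<Rightarrow>\<^sub>0 nat)"
  by (cases "\<alpha> \<in> Poly_Mapping.keys p")
     (auto simp: lookup_mult_keys when_def sum.delta not_in_keys_iff_lookup_eq_zero)

lemma vanishes_mon_times: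
  assumes "vanishes U (total_degree \<gamma> + d) (mon \<gamma> * p)" "Poly_Mapping.keys \<gamma> \<subseteq> U"
  shows "vanishes U d p"
  using assms by (auto simp: vanishes_def exponents_def keys_add_nat lookup_mon_times[symmetric, of p _ \<gamma>])

lemma finite_exponents [simp]: "finite (exponents U d)"
proof (induction d)
  case (Suc d)
  have "exponents U (Suc d) \<subseteq> (\<lambda>(\<beta>, x). \<beta> + unit_exp x) ` (exponents U d \<times> UNIV)"
    by (force elim!: exponents_Suc_obtain)
  then show ?case using Suc by (meson finite finite_SigmaI finite_imageI finite_subset)
qed simp

lemma card_exponents: "card (exponents (U :: 'v::finite set) d) = (card U + d - 1) choose d"
proof -
  have "finite U" by simp
  then show ?thesis
  proof (induction U arbitrary: d rule: finite_induct)
    case empty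
    have "exponents {} (Suc d) = ({} :: ('v \<Rightarrow>\<^sub>0 nat) set)" for d by (auto elim: exponents_Suc_obtain)
    then show ?case by (cases d) auto
  next
    case (insert x U)
    show ?case
    proof (induction d)
      case (Suc d)
      have "exponents (insert x U) (Suc d) = exponents U (Suc d) \<union> (\<lambda>\<beta>. \<beta> + unit_exp x) ` exponents (insert x U) d"
        (is "?L = ?R")
      proof
        show "?R \<subseteq> ?L" by (auto simp: exponents_def keys_add_nat)
        show "?L \<subseteq> ?R"
        proof
          fix \<alpha> assume \<alpha>: "\<alpha> \<in> ?L"
          show "\<alpha> \<in> ?R"
          proof (cases "x \<in> Poly_Mapping.keys \<alpha>")
            case True
            then obtain \<beta> where \<beta>: "\<alpha> = \<beta> + unit_exp x"
              using unit_exp_add_factor[of \<alpha> x] by (auto simp: in_keys_iff)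
            then have "\<beta> \<in> exponents (insert x U) d" using \<alpha> by (auto simp: exponents_def keys_add_nat)
            then show ?thesis using \<beta> by blast
          qed (use \<alpha> in \<open>auto simp: exponents_def\<close>)
        qed
      qed
      moreover have "exponents U (Suc d) \<inter> (\<lambda>\<beta>. \<beta> + unit_exp x) ` exponents (insert x U) d = {}"
        using insert.hyps by (auto simp: exponents_def keys_add_nat)
      ultimately have "card (exponents (insert x U) (Suc d)) = card (exponents U (Suc d)) + card (exponents (insert x U) d)"
        by (simp add: card_Un_disjoint card_image inj_on_def)
      then show ?case using insert.hyps Suc insert.IH[of "Suc d"] by (cases "card U") auto
    qed simp
  qed
qed

section \<open>Linear functionals on vectors of polynomials\<close>

definition functional :: "('v mpoly^'i \<Rightarrow> complex) \<Rightarrow> bool" where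
  "functional L \<longleftrightarrow> (\<forall>f g. L (f + g) = L f + L g) \<and> (\<forall>c f. L (const c *s f) = c * L f)"

abbreviation monvec :: "('v \<Rightarrow>\<^sub>0 nat) \<Rightarrow> 'i \<Rightarrow> 'v mpoly^'i" where
  "monvec \<alpha> i \<equiv> mon \<alpha> *s axis i 1"

lemma functional_add: "functional L \<Longrightarrow> L (f + g) = L f + L g"
  and functional_smult: "functional L \<Longrightarrow> L (const c *s f) = c * L f"
  by (auto simp: functional_def)

lemma functional_smult_mult: "functional L \<Longrightarrow> L (const c * q *s f) = c * L (q *s f)"
  by (metis functional_smult vector_smult_assoc)

lemma functional_0: "functional L \<Longrightarrow> L 0 = 0"
  using functional_smult[of L 0 0] by simp

lemma functional_sum: "functional L \<Longrightarrow> L (\<Sum>s\<in>S. f s) = (\<Sum>s\<in>S. L (f s))"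
  by (induction S rule: infinite_finite_induct) (auto simp: functional_0 functional_add)

lemma functional_minus: "functional L \<Longrightarrow> L (f - g) = L f - L g"
  using functional_add[of L "f - g" g] by simp

lemma const_mult_mon: "const c * mon \<alpha> = Poly_Mapping.single (\<alpha>::'v \<Rightarrow>\<^sub>0 nat) c"
  by (simp add: mult_single)

lemma functional_smult_mpoly:
  assumes "functional L"
  shows "L (p *s f) = (\<Sum>\<alpha>\<in>Poly_Mapping.keys p. Poly_Mapping.lookup p \<alpha> * L (mon \<alpha> *s f))"
proof -
  have "p *s f = (\<Sum>\<alpha>\<in>Poly_Mapping.keys p. const (Poly_Mapping.lookup p \<alpha>) *s (mon \<alpha> *s f))"
    by (subst mpoly_expand[of p]) (simp add: vec_eq_iff sum_distrib_right const_mult_mon mult.assoc[symmetric])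
  then show ?thesis using assms by (simp add: functional_sum functional_smult_mult)
qed

lemma functional_expand:
  fixes L :: "'v mpoly^'i::finite \<Rightarrow> complex"
  assumes "functional L"
  shows "L f = (\<Sum>i\<in>UNIV. \<Sum>\<alpha>\<in>Poly_Mapping.keys (f $ i). Poly_Mapping.lookup (f $ i) \<alpha> * L (monvec \<alpha> i))"
proof -
  have "f = (\<Sum>i\<in>UNIV. f $ i *s axis i 1)"
    by (simp add: vec_eq_iff axis_def if_distrib cong: if_cong)
  then have "L f = (\<Sum>i\<in>UNIV. L (f $ i *s axis i 1))" using assms by (metis functional_sum)
  then show ?thesis by (simp only: functional_smult_mpoly[OF assms, of "_ $ _"])
qed

lemma functional_eqI:
  fixes L :: "'v mpoly^'i::finite \<Rightarrow> complex"
  assumes "functional L" "functional L'" "\<And>\<alpha> i. L (monvec \<alpha> i) = L' (monvec \<alpha> i)"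
  shows "L = L'"
  using assms by (intro ext) (subst (1 2) functional_expand, auto)

definition from_coeffs :: "(('v \<Rightarrow>\<^sub>0 nat) \<Rightarrow> 'i \<Rightarrow> complex) \<Rightarrow> 'v mpoly^'i::finite \<Rightarrow> complex" where
  "from_coeffs g f = (\<Sum>i\<in>UNIV. \<Sum>\<alpha>\<in>Poly_Mapping.keys (f $ i). Poly_Mapping.lookup (f $ i) \<alpha> * g \<alpha> i)"

lemma functional_from_coeffs: "functional (from_coeffs g)"
proof -
  have sup: "(\<Sum>\<alpha>\<in>Poly_Mapping.keys p. Poly_Mapping.lookup p \<alpha> * h \<alpha>) = (\<Sum>\<alpha>\<in>S. Poly_Mapping.lookup p \<alpha> * h \<alpha>)"
    if "finite S" "Poly_Mapping.keys p \<subseteq> S" for p :: "'v mpoly" and h and S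
    using that by (intro sum.mono_neutral_left) (auto simp: in_keys_iff)
  have add: "(\<Sum>\<alpha>\<in>Poly_Mapping.keys (p + q). Poly_Mapping.lookup (p + q) \<alpha> * h \<alpha>) =
    (\<Sum>\<alpha>\<in>Poly_Mapping.keys p. Poly_Mapping.lookup p \<alpha> * h \<alpha>) + (\<Sum>\<alpha>\<in>Poly_Mapping.keys q. Poly_Mapping.lookup q \<alpha> * h \<alpha>)"
    for p q :: "'v mpoly" and h
    using keys_add[of p q]
    by (subst (1 2 3) sup[of "Poly_Mapping.keys p \<union> Poly_Mapping.keys q"])
       (auto simp: lookup_add distrib_right sum.distrib)
  have smult: "(\<Sum>\<alpha>\<in>Poly_Mapping.keys (const c * p). Poly_Mapping.lookup (const c * p) \<alpha> * h \<alpha>) =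
    c * (\<Sum>\<alpha>\<in>Poly_Mapping.keys p. Poly_Mapping.lookup p \<alpha> * h \<alpha>)" for p :: "'v mpoly" and h c
  proof -
    have "Poly_Mapping.keys (const c * p) \<subseteq> Poly_Mapping.keys p" by (auto simp: in_keys_iff lookup_const_mult)
    then show ?thesis using sup[of "Poly_Mapping.keys p" "const c * p"]
      by (simp add: lookup_const_mult sum_distrib_left mult.assoc)
  qed
  show ?thesis unfolding functional_def from_coeffs_def
    by (simp add: add smult sum.distrib sum_distrib_left)
qed

lemma from_coeffs_monvec [simp]: "from_coeffs g (monvec \<alpha> i) = g \<alpha> i"
proof -
  have "Poly_Mapping.lookup (monvec \<alpha> i $ j) \<beta> = (if j = i \<and> \<beta> = \<alpha> then 1 else 0)" for j \<beta>
    by (auto simp: axis_def lookup_single when_def)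
  then have "from_coeffs g (monvec \<alpha> i) = (\<Sum>j\<in>UNIV. if j = i then g \<alpha> i else 0)"
    unfolding from_coeffs_def
    by (intro sum.cong refl) (auto simp: axis_def intro!: sum.neutral)
  then show ?thesis by simp
qed

definition shift :: "'v mpoly \<Rightarrow> ('v mpoly^'i \<Rightarrow> complex) \<Rightarrow> 'v mpoly^'i \<Rightarrow> complex" where
  "shift q L f = L (q *s f)"

lemma functional_shift: "functional L \<Longrightarrow> functional (shift q L)"
  by (auto simp: functional_def shift_def vector_add_ldistrib mult.commute[of q "const _"] functional_smult_mult)

lemma var_smult_monvec: "var x *s monvec \<alpha> i = monvec (\<alpha> + unit_exp x) i"
  by (simp add: vector_smult_assoc mult_single add.commute)

text \<open>The column of linear forms \<open>x \<mapsto> b(x)\<close> attached to a linear map \<open>b\<close> with values in \<open>I\<close>.\<close>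

definition lin_col :: "('v::finite \<Rightarrow> complex^'i) \<Rightarrow> 'v mpoly^'i" where
  "lin_col b = (\<chi> i. \<Sum>x\<in>UNIV. const (b x $ i) * var x)"

lemma homogeneous_lin_col: "homogeneous 1 (lin_col b $ i)"
  unfolding lin_col_def by (simp, intro homogeneous_sum) (simp add: mult_single homogeneous_single)

lemma mon_smult_lin_col:
  "mon \<beta> *s lin_col b = (\<Sum>x\<in>UNIV. \<Sum>i\<in>UNIV. const (b x $ i) *s monvec (\<beta> + unit_exp x) i)"
proof -
  have "(\<Sum>i\<in>UNIV. const (b x $ i) * mon (\<beta> + unit_exp x) * axis i 1 $ j) =
      mon \<beta> * (const (b x $ j) * var x)" for x j
  proof -
    have "(\<Sum>i\<in>UNIV. const (b x $ i) * mon (\<beta> + unit_exp x) * axis i 1 $ j) =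
      (\<Sum>i\<in>UNIV. if i = j then const (b x $ j) * mon (\<beta> + unit_exp x) else 0)"
      by (intro sum.cong) (auto simp: axis_def)
    then show ?thesis by (simp add: mult_single add.commute)
  qed
  then show ?thesis by (simp add: vec_eq_iff lin_col_def sum_distrib_left)
qed

lemma functional_lin_col:
  "functional L \<Longrightarrow> L (mon \<beta> *s lin_col b) = (\<Sum>x\<in>UNIV. \<Sum>i\<in>UNIV. b x $ i * L (monvec (\<beta> + unit_exp x) i))"
  by (simp add: mon_smult_lin_col functional_sum functional_smult_mult del: vector_smult_assoc) (simp only: functional_smult)

text \<open>
  The dual of the degree \<open>d\<close> part of the cokernel of the columns \<open>lin_col (b j)\<close>, over the polynomial ring in the
  variables \<open>U\<close>.
\<close>

definition cokernel_dual :: "'v::finite set \<Rightarrow> nat \<Rightarrow> (nat \<Rightarrow> 'v \<Rightarrow> complex^'i) \<Rightarrow> nat \<Rightarrow> ('v mpoly^'i::finite \<Rightarrow> complex) set" where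
  "cokernel_dual U d b w = {L. functional L \<and> (\<forall>\<alpha> i. \<alpha> \<notin> exponents U d \<longrightarrow> L (monvec \<alpha> i) = 0) \<and>
     (\<forall>j<w. \<forall>p. L (p *s lin_col (b j)) = 0)}"

text \<open>
  The columns are linear, so for functionals of degree \<open>d + 1\<close> only their multiples by monomials of
  degree \<open>d\<close> impose a condition.
\<close>

lemma cokernel_dualI:
  assumes "functional L" "\<And>\<alpha> i. \<alpha> \<notin> exponents U (Suc d) \<Longrightarrow> L (monvec \<alpha> i) = 0"
    and "\<And>j \<beta>. j < w \<Longrightarrow> \<beta> \<in> exponents U d \<Longrightarrow> L (mon \<beta> *s lin_col (b j)) = 0"
  shows "L \<in> cokernel_dual U (Suc d) b w"
proof -
  have "L (mon \<beta> *s lin_col (b j)) = 0" if "j < w" for j \<beta>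
  proof (cases "\<beta> \<in> exponents U d")
    case False
    then have "\<beta> + unit_exp x \<notin> exponents U (Suc d)" for x by (auto simp: exponents_def keys_add_nat)
    then show ?thesis using assms(1,2) by (simp add: functional_lin_col)
  qed (use assms that in auto)
  then have "L (p *s lin_col (b j)) = 0" if "j < w" for j p
    using that by (subst functional_smult_mpoly[OF assms(1)]) simp
  then show ?thesis using assms by (auto simp: cokernel_dual_def)
qed

lemma shift_var_cokernel_dual:
  assumes L: "L \<in> cokernel_dual U (Suc d) b w"
  shows "shift (var x) L \<in> cokernel_dual U d b w"
proof -
  have "\<alpha> + unit_exp x \<notin> exponents U (Suc d)" if "\<alpha> \<notin> exponents U d" for \<alpha>
    using that by (auto simp: exponents_def keys_add_nat)
  then have "L (var x *s monvec \<alpha> i) = 0" if "\<alpha> \<notin> exponents U d" for \<alpha> i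
    using L that unfolding var_smult_monvec by (auto simp: cokernel_dual_def)
  then show ?thesis using L
    by (auto simp: cokernel_dual_def functional_shift shift_def vector_smult_assoc)
qed

text \<open>
  The cokernel is generated in degree zero, so it remains zero once it is zero.
\<close>

lemma cokernel_dual_zero_above:
  fixes b :: "nat \<Rightarrow> 'v::finite \<Rightarrow> complex^'i::finite"
  assumes "cokernel_dual U d b w \<subseteq> {\<lambda>_. 0}"
  shows "cokernel_dual U (d + e) b w \<subseteq> {\<lambda>_. 0}"
proof (induction e)
  case (Suc e)
  show ?case
  proof safe
    fix L assume L: "L \<in> cokernel_dual U (d + Suc e) b w"
    have "L (monvec \<alpha> i) = 0" for \<alpha> i
    proof (cases "\<alpha> \<in> exponents U (Suc (d + e))")
      case True
      then obtain x \<beta> where x: "x \<in> U" "\<alpha> = \<beta> + unit_exp x" by (rule exponents_Suc_obtain)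
      have "shift (var x) L = (\<lambda>_. 0)" using shift_var_cokernel_dual[of L U "d + e" b w x] L Suc by auto
      then show ?thesis using x by (metis shift_def var_smult_monvec)
    qed (use L in \<open>auto simp: cokernel_dual_def\<close>)
    moreover have "functional L" using L by (simp add: cokernel_dual_def)
    moreover have "functional (\<lambda>_. 0 :: complex)" by (simp add: functional_def)
    ultimately show "L = (\<lambda>_. 0)" by (intro functional_eqI) auto
  qed
qed (use assms in simp)

lemma lookup_mult_expand:
  "Poly_Mapping.lookup (p * q :: 'v mpoly) \<alpha> =
    (\<Sum>\<beta>\<in>Poly_Mapping.keys p. Poly_Mapping.lookup p \<beta> * Poly_Mapping.lookup (mon \<beta> * q) \<alpha>)"
  by (simp add: lookup_mult_keys[of p] lookup_mult_keys[of "mon _"] sum_distrib_left when_def if_distrib cong: if_cong)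

text \<open>
  A monomial in the variables \<open>U\<close> receives contributions only from the terms of \<open>p\<close> in these variables.
\<close>

lemma lookup_mult_restrict:
  assumes q: "homogeneous e q" and \<alpha>: "\<alpha> \<in> exponents U (d + e)"
  shows "Poly_Mapping.lookup (p * q :: 'v::finite mpoly) \<alpha> =
    (\<Sum>\<beta>\<in>exponents U d. Poly_Mapping.lookup p \<beta> * Poly_Mapping.lookup (mon \<beta> * q) \<alpha>)"
proof -
  have 0: "Poly_Mapping.lookup (mon \<beta> * q) \<alpha> = 0" if "\<beta> \<notin> exponents U d" for \<beta>
  proof -
    have "vanishes U (d + e) (mon \<beta> * q)"
      using that q by (intro vanishes_mult) (auto simp: vanishes_def lookup_single when_def)
    then show ?thesis using \<alpha> by (simp add: vanishes_def)
  qed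
  have "Poly_Mapping.lookup (p * q) \<alpha> = (\<Sum>\<beta>\<in>Poly_Mapping.keys p \<inter> exponents U d.
      Poly_Mapping.lookup p \<beta> * Poly_Mapping.lookup (mon \<beta> * q) \<alpha>)"
    by (subst lookup_mult_expand, rule sum.mono_neutral_right) (use 0 in auto)
  also have "\<dots> = (\<Sum>\<beta>\<in>exponents U d. Poly_Mapping.lookup p \<beta> * Poly_Mapping.lookup (mon \<beta> * q) \<alpha>)"
    by (rule sum.mono_neutral_left) (auto simp: in_keys_iff)
  finally show ?thesis .
qed

lemma functional_supported:
  fixes L :: "'v::finite mpoly^'i::finite \<Rightarrow> complex"
  assumes "functional L" and "\<And>\<alpha> i. \<alpha> \<notin> exponents U d \<Longrightarrow> L (monvec \<alpha> i) = 0"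
  shows "L f = (\<Sum>i\<in>UNIV. \<Sum>\<alpha>\<in>exponents U d. Poly_Mapping.lookup (f $ i) \<alpha> * L (monvec \<alpha> i))"
proof -
  have "(\<Sum>\<alpha>\<in>Poly_Mapping.keys (f $ i). Poly_Mapping.lookup (f $ i) \<alpha> * L (monvec \<alpha> i)) =
    (\<Sum>\<alpha>\<in>exponents U d. Poly_Mapping.lookup (f $ i) \<alpha> * L (monvec \<alpha> i))" for i
  proof -
    have "(\<Sum>\<alpha>\<in>Poly_Mapping.keys (f $ i). Poly_Mapping.lookup (f $ i) \<alpha> * L (monvec \<alpha> i)) =
      (\<Sum>\<alpha>\<in>Poly_Mapping.keys (f $ i) \<inter> exponents U d. Poly_Mapping.lookup (f $ i) \<alpha> * L (monvec \<alpha> i))"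
      by (rule sum.mono_neutral_right) (use assms(2) in auto)
    also have "\<dots> = (\<Sum>\<alpha>\<in>exponents U d. Poly_Mapping.lookup (f $ i) \<alpha> * L (monvec \<alpha> i))"
      by (rule sum.mono_neutral_left) (auto simp: in_keys_iff)
    finally show ?thesis .
  qed
  then show ?thesis by (subst functional_expand[OF assms(1)]) simp
qed

definition col_matrix :: "(nat \<Rightarrow> 'v::finite \<Rightarrow> complex^'i) \<Rightarrow> ('i \<Rightarrow> nat) \<Rightarrow> 'v mpoly^'i^'i" where
  "col_matrix b t = (\<chi> i l. lin_col (b (t l)) $ i)"

lemma column_col_matrix: "column l (col_matrix b t) = lin_col (b (t l))"
  by (simp add: column_def col_matrix_def vec_eq_iff)

lemma replace_col_col_matrix: "replace_col (col_matrix b t) l (lin_col (b j)) = col_matrix b (t(l := j))"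
  by (simp add: replace_col_def col_matrix_def vec_eq_iff)

section \<open>Minors and syzygies of a square column system\<close>

text \<open>
  The number of columns is such that \<open>W \<otimes> S\<^bsup>k-1\<^esup> \<rightarrow> I \<otimes> S\<^bsup>k\<^esup>\<close> is a square system, and its cokernel
  is assumed to vanish.
\<close>

locale acyclic_columns =
  fixes U :: "'v::finite set" and w :: nat and b :: "nat \<Rightarrow> 'v \<Rightarrow> complex^'i::finite"
  assumes nonempty: "U \<noteq> {}" and w: "w = card U + CARD('i) - 1"
    and dual: "cokernel_dual U CARD('i) b w \<subseteq> {\<lambda>_. 0}"
begin

lemma card_U: "card U > 0" using nonempty by (simp add: card_gt_0_iff)

text \<open>
  The vanishing of the cokernel as injectivity of the transposed linear system of coefficients.
\<close>

lemma functional_coeffs_in_dual: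
  assumes "\<And>j \<beta>. j < w \<Longrightarrow> \<beta> \<in> exponents U d \<Longrightarrow>
    (\<Sum>i\<in>UNIV. \<Sum>\<alpha>\<in>exponents U (Suc d). Poly_Mapping.lookup (mon \<beta> * lin_col (b j) $ i) \<alpha> * g \<alpha> i) = 0"
    and d: "CARD('i) \<le> Suc d" and \<alpha>: "\<alpha> \<in> exponents U (Suc d)"
  shows "g \<alpha> i = 0"
proof -
  let ?L = "from_coeffs (\<lambda>\<alpha> i. if \<alpha> \<in> exponents U (Suc d) then g \<alpha> i else 0)"
  have "?L \<in> cokernel_dual U (Suc d) b w"
    using assms(1) by (intro cokernel_dualI functional_from_coeffs)
      (auto simp: functional_supported[OF functional_from_coeffs, of U "Suc d"])
  moreover have "cokernel_dual U (Suc d) b w \<subseteq> {\<lambda>_. 0}"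
    using cokernel_dual_zero_above[OF dual, of "Suc d - CARD('i)"] d by simp
  ultimately have "?L = (\<lambda>_. 0)" by blast
  then have "?L (monvec \<alpha> i) = 0" by metis
  then show ?thesis using \<alpha> by simp
qed

text \<open>
  The square system is surjective, hence injective.
\<close>

lemma syzygy_vanishes_top:
  assumes u: "\<And>i. vanishes U CARD('i) (\<Sum>j<w. u j * lin_col (b j) $ i)" and j: "j < w"
  shows "vanishes U (CARD('i) - 1) (u j)"
proof -
  obtain d where d: "CARD('i) = Suc d" using not0_implies_Suc[of "CARD('i)"] by auto
  let ?A = "exponents U (Suc d) \<times> (UNIV::'i set)" and ?B = "exponents U d \<times> {..<w}"
  let ?E = "\<lambda>(\<alpha>,i) (\<beta>,j). Poly_Mapping.lookup (mon \<beta> * lin_col (b j) $ i) \<alpha>"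
  have "\<forall>x\<in>?B. (\<lambda>(\<beta>,j). Poly_Mapping.lookup (u j) \<beta>) x = 0"
  proof (rule square_system_transpose[of ?A ?B ?E])
    have "CARD('i) * (w choose CARD('i)) = w * (w - 1 choose (CARD('i) - 1))"
      by (rule times_binomial_minus1_eq) (simp add: d)
    moreover have "w = card U + d" "w - 1 = card U + d - 1" using w d card_U by auto
    ultimately show "card ?B \<le> card ?A" using d
      by (simp add: card_cartesian_product card_exponents mult.commute)
  next
    fix g assume g: "\<forall>x\<in>?B. (\<Sum>a\<in>?A. g a * ?E a x) = 0"
    have "g (\<alpha>, i) = 0" if "\<alpha> \<in> exponents U (Suc d)" for \<alpha> i
    proof (rule functional_coeffs_in_dual[OF _ _ that, of "\<lambda>\<alpha> i. g (\<alpha>, i)"])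
      fix j \<beta> assume "j < w" "\<beta> \<in> exponents U d"
      then have "(\<Sum>\<alpha>\<in>exponents U (Suc d). \<Sum>i\<in>UNIV. g (\<alpha>, i) * Poly_Mapping.lookup (mon \<beta> * lin_col (b j) $ i) \<alpha>) = 0"
        using g by (auto simp: sum.cartesian_product split_def)
      then show "(\<Sum>i\<in>UNIV. \<Sum>\<alpha>\<in>exponents U (Suc d). Poly_Mapping.lookup (mon \<beta> * lin_col (b j) $ i) \<alpha> * g (\<alpha>, i)) = 0"
        by (subst sum.swap) (simp add: mult.commute)
    qed (simp add: d)
    then show "\<forall>a\<in>?A. g a = 0" by auto
  next
    show "\<forall>a\<in>?A. (\<Sum>x\<in>?B. ?E a x * (\<lambda>(\<beta>,j). Poly_Mapping.lookup (u j) \<beta>) x) = 0"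
    proof
      fix a assume "a \<in> ?A"
      then obtain \<alpha> i where a: "a = (\<alpha>, i)" and \<alpha>: "\<alpha> \<in> exponents U (Suc d)" by auto
      have "0 = Poly_Mapping.lookup (\<Sum>j<w. u j * lin_col (b j) $ i) \<alpha>"
        using u[of i] \<alpha> by (simp add: vanishes_def d)
      also have "\<dots> = (\<Sum>j<w. \<Sum>\<beta>\<in>exponents U d. Poly_Mapping.lookup (u j) \<beta> * Poly_Mapping.lookup (mon \<beta> * lin_col (b j) $ i) \<alpha>)"
        unfolding lookup_sum using \<alpha> by (intro sum.cong refl lookup_mult_restrict[where e = 1] homogeneous_lin_col) simp
      also have "\<dots> = (\<Sum>x\<in>?B. ?E (\<alpha>, i) x * (\<lambda>(\<beta>,j). Poly_Mapping.lookup (u j) \<beta>) x)"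
        by (subst sum.swap) (simp add: sum.cartesian_product split_def mult.commute)
      finally show "(\<Sum>x\<in>?B. ?E a x * (\<lambda>(\<beta>,j). Poly_Mapping.lookup (u j) \<beta>) x) = 0" by (simp add: a)
    qed
  qed auto
  then show ?thesis using j d by (auto simp: vanishes_def)
qed

text \<open>
  Multiplication by a power of a variable of \<open>U\<close> reduces this to degree \<open>k - 1\<close>.
\<close>

lemma syzygy_vanishes:
  assumes u: "\<And>i. vanishes U (Suc d) (\<Sum>j<w. u j * lin_col (b j) $ i)" and j: "j < w" and d: "d < CARD('i)"
  shows "vanishes U d (u j)"
proof -
  obtain x where x: "x \<in> U" using nonempty by blast
  let ?\<gamma> = "Poly_Mapping.single x (CARD('i) - Suc d)"
  have "vanishes U (CARD('i) - 1) (mon ?\<gamma> * u j)"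
  proof (rule syzygy_vanishes_top[of "\<lambda>j. mon ?\<gamma> * u j", OF _ j])
    fix i
    have "vanishes U (Suc d + (CARD('i) - Suc d)) ((\<Sum>j<w. u j * lin_col (b j) $ i) * mon ?\<gamma>)"
      by (intro vanishes_mult u) (simp add: homogeneous_single)
    moreover have "Suc d + (CARD('i) - Suc d) = CARD('i)" using d by simp
    ultimately show "vanishes U CARD('i) (\<Sum>j<w. mon ?\<gamma> * u j * lin_col (b j) $ i)"
      by (simp only: sum_distrib_left sum_distrib_right mult_ac)
  qed
  moreover have "total_degree ?\<gamma> + d = CARD('i) - 1" using d by simp
  ultimately have "vanishes U (total_degree ?\<gamma> + d) (mon ?\<gamma> * u j)" by simp
  moreover have "Poly_Mapping.keys ?\<gamma> \<subseteq> U" using x by simp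
  ultimately show ?thesis by (rule vanishes_mon_times)
qed

text \<open>
  Suppose that a maximal minor vanishes. Cramer's rule with a constant right-hand side is a relation
  between the columns of the minor with coefficients of degree \<open>k - 1\<close>, and these must vanish. They
  are minors in which one column is replaced by a constant one. Repeating the argument, all columns
  are replaced by constants, and the identity matrix would have determinant zero.
\<close>

lemma minor_nonvanishing:
  assumes t: "inj t" "range t \<subseteq> {..<w}"
  shows "\<not> vanishes U CARD('i) (det (col_matrix b t))"
proof
  assume van: "vanishes U CARD('i) (det (col_matrix b t))"
  \<comment> \<open>the minor with the columns in \<open>Q\<close> replaced by the constant columns \<open>e\<close>\<close>
  define A :: "'i set \<Rightarrow> ('i \<Rightarrow> complex^'i) \<Rightarrow> 'v mpoly^'i^'i" where
    "A Q e = (\<chi> i l. if l \<in> Q then const (e l $ i) else lin_col (b (t l)) $ i)" for Q e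
  have "vanishes U (CARD('i) - card Q) (det (A Q e))" for Q e
  proof -
    have "finite Q" by simp
    then show ?thesis
    proof (induction Q arbitrary: e rule: finite_induct)
      case empty
      have "A {} e = col_matrix b t" by (simp add: A_def col_matrix_def)
      then show ?case using van by simp
    next
      case (insert m Q)
      define e' :: "'v mpoly^'i" where "e' = (\<chi> i. const (e m $ i))"
      define D where "D l = det (replace_col (A Q e) l e')" for l
      have lt: "card Q < CARD('i)" using insert.hyps by (metis UNIV_I finite psubset_card_mono psubsetI subset_UNIV)
      have D_in: "vanishes U (CARD('i) - card Q) (D l)" if "l \<in> Q" for l
      proof -
        have "replace_col (A Q e) l e' = A Q (e(l := e m))"
          using that by (auto simp: replace_col_def A_def e'_def vec_eq_iff)
        then show ?thesis using insert.IH by (simp add: D_def)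
      qed
      define u where "u j = (if j \<in> t ` (-Q) then D (inv t j) else 0)" for j
      have "vanishes U (Suc (CARD('i) - Suc (card Q))) (\<Sum>j<w. u j * lin_col (b j) $ i)" for i
      proof -
        have "(\<Sum>j<w. u j * lin_col (b j) $ i) = (\<Sum>j\<in>t ` (-Q). u j * lin_col (b j) $ i)"
          by (rule sum.mono_neutral_right) (use t in \<open>auto simp: u_def\<close>)
        also have "\<dots> = (\<Sum>l\<in>-Q. D l * lin_col (b (t l)) $ i)"
          using t by (subst sum.reindex) (auto simp: u_def inj_on_def)
        also have "\<dots> = (\<Sum>l\<in>-Q. D l * column l (A Q e) $ i)"
          by (intro sum.cong) (auto simp: column_def A_def)
        also have "\<dots> = (\<Sum>l\<in>UNIV. D l * column l (A Q e) $ i) - (\<Sum>l\<in>Q. D l * column l (A Q e) $ i)"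
          by (subst Compl_eq_Diff_UNIV, subst sum_diff) auto
        also have "(\<Sum>l\<in>UNIV. D l * column l (A Q e) $ i) = (det (A Q e) *s e') $ i"
          by (subst cramer_identity) (simp add: D_def)
        also have "(\<Sum>l\<in>Q. D l * column l (A Q e) $ i) = (\<Sum>l\<in>Q. D l * const (e l $ i))"
          by (intro sum.cong) (auto simp: column_def A_def)
        finally have eq: "(\<Sum>j<w. u j * lin_col (b j) $ i) = det (A Q e) * const (e m $ i) - (\<Sum>l\<in>Q. D l * const (e l $ i))"
          by (simp add: e'_def)
        have "vanishes U (CARD('i) - card Q + 0) (\<Sum>j<w. u j * lin_col (b j) $ i)"
          unfolding eq by (intro vanishes_diff vanishes_sum vanishes_mult D_in insert.IH)
            (auto simp: homogeneous_single)
        then show ?thesis using lt by (simp add: Suc_diff_Suc)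
      qed
      from this have "vanishes U (CARD('i) - Suc (card Q)) (u (t m))"
        by (rule syzygy_vanishes) (use t lt in auto)
      moreover have "u (t m) = D m" using insert.hyps t by (simp add: u_def)
      moreover have "replace_col (A Q e) m e' = A (insert m Q) e"
        by (auto simp: replace_col_def A_def e'_def vec_eq_iff)
      ultimately show ?case using insert.hyps by (simp add: D_def)
    qed
  qed
  from this[of UNIV "\<lambda>l. axis l 1"] have "vanishes U 0 (det (A UNIV (\<lambda>l. axis l 1)))" by simp
  moreover have "A UNIV (\<lambda>l. axis l 1) = mat 1" by (simp add: A_def mat_def axis_def vec_eq_iff)
  ultimately show False by (simp add: vanishes_def)
qed

text \<open>
  Suppose that a linear combination of minors vanishes. Apply Cramer's rule to each of them with the same
  constant right-hand side \<open>e\<close>. The result is a relation between the columns with coefficients of degree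
  \<open>k - 1\<close>, so the coefficient of column \<open>j\<close> vanishes: it is the combination of the minors through \<open>j\<close>
  with column \<open>j\<close> replaced by \<open>e\<close>. By linearity \<open>e\<close> may be replaced by column \<open>j\<close> itself, and then the
  part of the combination with the minors through \<open>j\<close> vanishes on its own. Doing this for all columns
  of one minor isolates that minor.
\<close>

lemma minors_independent:
  assumes fin: "finite S" and t: "\<And>s. s \<in> S \<Longrightarrow> inj (t s) \<and> range (t s) \<subseteq> {..<w}"
    and dist: "inj_on (\<lambda>s. range (t s)) S"
    and van: "vanishes U CARD('i) (\<Sum>s\<in>S. const (a s) * det (col_matrix b (t s)))" and s0: "s0 \<in> S"
  shows "a s0 = 0"
proof -
  have "vanishes U CARD('i) (\<Sum>s\<in>{s\<in>S. J \<subseteq> range (t s)}. const (a s) * det (col_matrix b (t s)))"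
    if "finite J" "J \<subseteq> {..<w}" for J
    using that
  proof (induction J rule: finite_induct)
    case empty then show ?case using van by simp
  next
    case (insert j J)
    let ?S = "{s\<in>S. J \<subseteq> range (t s)}" and ?S' = "{s\<in>S. insert j J \<subseteq> range (t s)}"
    \<comment> \<open>the coefficient of column \<open>j\<close> when Cramer's rule is applied to the minor \<open>s\<close>\<close>
    define D where "D s j e = (if j \<in> range (t s) then det (replace_col (col_matrix b (t s)) (inv (t s) j) e) else 0)" for s j e
    have exp: "det (col_matrix b (t s)) *s e = (\<Sum>j<w. D s j e *s lin_col (b j))" if "s \<in> S" for s e
    proof -
      have "(\<Sum>j<w. D s j e *s lin_col (b j)) = (\<Sum>j\<in>range (t s). D s j e *s lin_col (b j))"
        by (rule sum.mono_neutral_right) (use t[OF that] in \<open>auto simp: D_def\<close>)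
      also have "\<dots> = (\<Sum>l\<in>UNIV. det (replace_col (col_matrix b (t s)) l e) *s lin_col (b (t s l)))"
        using t[OF that] by (subst sum.reindex) (auto simp: D_def)
      finally show ?thesis by (subst cramer_identity) (simp add: column_col_matrix)
    qed
    have const_cols: "vanishes U (CARD('i) - 1) (\<Sum>s\<in>?S. const (a s) * D s j (axis i 1))" for i
    proof (rule syzygy_vanishes_top[of "\<lambda>j. \<Sum>s\<in>?S. const (a s) * D s j (axis i 1)"])
      fix i'
      have "(\<Sum>j<w. (\<Sum>s\<in>?S. const (a s) * D s j (axis i 1)) * lin_col (b j) $ i') =
         (\<Sum>s\<in>?S. const (a s) * (\<Sum>j<w. D s j (axis i 1) *s lin_col (b j)) $ i')"
        unfolding sum_distrib_right by (subst sum.swap) (simp add: sum_distrib_left mult.assoc)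
      also have "\<dots> = (\<Sum>s\<in>?S. const (a s) * det (col_matrix b (t s))) * axis i 1 $ i'"
        unfolding sum_distrib_right by (intro sum.cong refl) (simp add: exp[symmetric] mult.assoc)
      finally show "vanishes U CARD('i) (\<Sum>j<w. (\<Sum>s\<in>?S. const (a s) * D s j (axis i 1)) * lin_col (b j) $ i')"
        using insert by (simp add: axis_def)
    qed (use insert in auto)
    have "vanishes U (CARD('i) - 1 + 1) (\<Sum>i\<in>UNIV. (\<Sum>s\<in>?S. const (a s) * D s j (axis i 1)) * lin_col (b j) $ i)"
      by (rule vanishes_sum, rule vanishes_mult[OF const_cols homogeneous_lin_col])
    also have "(\<Sum>i\<in>UNIV. (\<Sum>s\<in>?S. const (a s) * D s j (axis i 1)) * lin_col (b j) $ i) =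
      (\<Sum>s\<in>?S. const (a s) * (\<Sum>i\<in>UNIV. lin_col (b j) $ i * D s j (axis i 1)))"
      unfolding sum_distrib_right by (subst sum.swap) (simp add: sum_distrib_left mult_ac)
    also have "\<dots> = (\<Sum>s\<in>?S. const (a s) * D s j (lin_col (b j)))"
    proof -
      have "(\<Sum>i\<in>UNIV. lin_col (b j) $ i * D s j (axis i 1)) = D s j (lin_col (b j))" for s
        unfolding D_def
        by (simp add: det_replace_col_sum[symmetric] vec_eq_sum_axis[symmetric] if_distrib cong: if_cong)
      then show ?thesis by simp
    qed
    also have "\<dots> = (\<Sum>s\<in>?S'. const (a s) * det (col_matrix b (t s)))"
    proof (rule sum.mono_neutral_cong_right)
      fix s assume "s \<in> ?S'"
      then have "j \<in> range (t s)" by auto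
      then have "t s (inv (t s) j) = j" by (rule f_inv_into_f)
      then have "(t s)(inv (t s) j := j) = t s" by (metis fun_upd_triv)
      then show "const (a s) * D s j (lin_col (b j)) = const (a s) * det (col_matrix b (t s))"
        using \<open>j \<in> range (t s)\<close> by (simp add: D_def replace_col_col_matrix)
    qed (use fin in \<open>auto simp: D_def\<close>)
    finally show ?case by simp
  qed
  from this[of "range (t s0)"] t[OF s0]
  have "vanishes U CARD('i) (\<Sum>s\<in>{s\<in>S. range (t s0) \<subseteq> range (t s)}. const (a s) * det (col_matrix b (t s)))"
    by simp
  also have "{s\<in>S. range (t s0) \<subseteq> range (t s)} = {s0}"
  proof -
    have "range (t s0) = range (t s)" if "s \<in> S" "range (t s0) \<subseteq> range (t s)" for s
      using that t[OF s0] t[OF that(1)] by (intro card_subset_eq) (auto simp: card_image)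
    then show ?thesis using s0 inj_onD[OF dist _ _ s0] by force
  qed
  finally have "vanishes U CARD('i) (const (a s0) * det (col_matrix b (t s0)))" by simp
  then show ?thesis using minor_nonvanishing[of "t s0"] t[OF s0]
    by (auto simp: vanishes_def lookup_const_mult)
qed

text \<open>
  There are as many minors as monomials of degree \<open>k\<close>.
\<close>

lemma minors_span:
  fixes L :: "('v \<Rightarrow>\<^sub>0 nat) \<Rightarrow> complex"
  assumes L: "\<And>t. inj t \<Longrightarrow> range t \<subseteq> {..<w} \<Longrightarrow>
      (\<Sum>\<alpha>\<in>exponents U CARD('i). Poly_Mapping.lookup (det (col_matrix b t)) \<alpha> * L \<alpha>) = 0"
    and \<alpha>: "\<alpha> \<in> exponents U CARD('i)"
  shows "L \<alpha> = 0"
proof -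
  define S where "S = {J. J \<subseteq> {..<w} \<and> card J = CARD('i)}"
  have "\<exists>t :: 'i \<Rightarrow> nat. bij_betw t UNIV J" if "J \<in> S" for J
    using that by (intro finite_same_card_bij) (auto simp: S_def intro: finite_subset)
  then obtain t :: "nat set \<Rightarrow> 'i \<Rightarrow> nat" where t: "\<And>J. J \<in> S \<Longrightarrow> bij_betw (t J) UNIV J" by metis
  then have t': "inj (t J)" "range (t J) = J" if "J \<in> S" for J
    using that by (auto simp: bij_betw_def)
  have finS: "finite S" by (simp add: S_def)
  have "\<forall>\<alpha>\<in>exponents U CARD('i). L \<alpha> = 0"
  proof (rule square_system_transpose[of S _ "\<lambda>J \<alpha>. Poly_Mapping.lookup (det (col_matrix b (t J))) \<alpha>"])
    show "card (exponents U CARD('i)) \<le> card S"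
      using n_subsets[of "{..<w}" "CARD('i)"] by (simp add: S_def card_exponents w)
  next
    fix a assume a: "\<forall>\<alpha>\<in>exponents U CARD('i). (\<Sum>J\<in>S. a J * Poly_Mapping.lookup (det (col_matrix b (t J))) \<alpha>) = 0"
    show "\<forall>J\<in>S. a J = 0"
    proof
      fix J assume "J \<in> S"
      then show "a J = 0"
      proof (rule minors_independent[OF finS, of t a J, rotated 3])
        show "inj_on (\<lambda>J. range (t J)) S" by (rule inj_onI) (simp add: t')
      qed (use a t' in \<open>auto simp: vanishes_def lookup_sum lookup_const_mult S_def\<close>)
    qed
  qed (use finS L t' in \<open>auto simp: S_def\<close>)
  then show ?thesis using \<alpha> by blast
qed

text \<open>
  The values of the extension on multiples of \<open>x\<^sub>0\<close> are prescribed, and the others have to solve the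
  linear system of the columns restricted to \<open>U\<close>. That system is injective in degree \<open>k + 1\<close>. For each
  set of \<open>k + 1\<close> columns, Cramer's rule expresses the multiple of one of them by the minor of the others
  through these others. These relations are orthogonal to the system and to its right-hand side, they are
  independent because the minors are, and there are enough of them to make the system solvable.
\<close>

lemma extend_functional:
  assumes x0: "x0 \<notin> U" and L: "L \<in> cokernel_dual (insert x0 U) CARD('i) b w"
  shows "\<exists>L'\<in>cokernel_dual (insert x0 U) (Suc CARD('i)) b w. shift (var x0) L' = L"
proof -
  let ?k = "CARD('i)" and ?V = "insert x0 U"
  have funL: "functional L" and suppL: "\<And>\<alpha> i. \<alpha> \<notin> exponents ?V ?k \<Longrightarrow> L (monvec \<alpha> i) = 0"
    and killL: "\<And>j p. j < w \<Longrightarrow> L (p *s lin_col (b j)) = 0"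
    using L by (auto simp: cokernel_dual_def)
  \<comment> \<open>the extension of \<open>L\<close> that is zero on the monomials without \<open>x\<^sub>0\<close>; it is corrected by \<open>G\<close> below\<close>
  define F where "F = from_coeffs (\<lambda>\<alpha> i. if \<alpha> \<in> exponents ?V (Suc ?k) \<and> Poly_Mapping.lookup \<alpha> x0 > 0
      then L (monvec (\<alpha> - unit_exp x0) i) else 0)"
  have funF: "functional F" by (simp add: F_def functional_from_coeffs)
  have F_x0: "F (monvec (\<alpha> + unit_exp x0) i) = L (monvec \<alpha> i)" for \<alpha> i
  proof (cases "\<alpha> \<in> exponents ?V ?k")
    case True
    then show ?thesis by (auto simp: F_def exponents_def keys_add_nat lookup_add)
  next
    case False
    then have "\<alpha> + unit_exp x0 \<notin> exponents ?V (Suc ?k)" by (auto simp: exponents_def keys_add_nat)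
    then show ?thesis using suppL[OF False] by (simp add: F_def)
  qed
  have F_supp: "F (monvec \<alpha> i) = 0" if "\<alpha> \<notin> exponents ?V (Suc ?k) - exponents U (Suc ?k)" for \<alpha> i
  proof -
    have "Poly_Mapping.lookup \<alpha> x0 = 0" if "Poly_Mapping.keys \<alpha> \<subseteq> U" using that x0 by (meson in_keys_iff subsetD)
    then show ?thesis using that by (auto simp: F_def exponents_def)
  qed
  have F_col: "F (mon \<beta> *s lin_col (b j)) = 0" if "j < w" "\<beta> \<notin> exponents U ?k" for j \<beta>
  proof (cases "Poly_Mapping.lookup \<beta> x0 > 0")
    case True
    then obtain \<gamma> where \<gamma>: "\<beta> = \<gamma> + unit_exp x0" using unit_exp_add_factor[of \<beta> x0] by blast
    have "F (mon \<beta> *s lin_col (b j)) = (\<Sum>x\<in>UNIV. \<Sum>i\<in>UNIV. b j x $ i * F (monvec ((\<gamma> + unit_exp x) + unit_exp x0) i))"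
      by (simp add: functional_lin_col[OF funF] \<gamma> add_ac)
    also have "\<dots> = L (mon \<gamma> *s lin_col (b j))"
      by (simp only: F_x0 functional_lin_col[OF funL])
    finally show ?thesis using killL that by simp
  next
    case False
    have "F (monvec (\<beta> + unit_exp x) i) = 0" for x i
    proof (rule F_supp)
      show "\<beta> + unit_exp x \<notin> exponents ?V (Suc ?k) - exponents U (Suc ?k)"
        using that False by (auto simp: exponents_def keys_add_nat in_keys_iff split: if_splits)
    qed
    then show ?thesis by (simp add: functional_lin_col[OF funF])
  qed
  have F_smult: "F (p *s lin_col (b j)) = (\<Sum>\<beta>\<in>exponents U ?k. Poly_Mapping.lookup p \<beta> * F (mon \<beta> *s lin_col (b j)))"
    if "j < w" for p j
  proof -
    have "F (p *s lin_col (b j)) = (\<Sum>\<beta>\<in>Poly_Mapping.keys p \<inter> exponents U ?k. Poly_Mapping.lookup p \<beta> * F (mon \<beta> *s lin_col (b j)))"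
      by (subst functional_smult_mpoly[OF funF], rule sum.mono_neutral_right) (use F_col that in auto)
    also have "\<dots> = (\<Sum>\<beta>\<in>exponents U ?k. Poly_Mapping.lookup p \<beta> * F (mon \<beta> *s lin_col (b j)))"
      by (rule sum.mono_neutral_left) (auto simp: in_keys_iff)
    finally show ?thesis .
  qed
  define S where "S = {J. J \<subseteq> {..<w} \<and> card J = Suc ?k}"
  have finS: "finite S" by (simp add: S_def)
  have "\<exists>j t. j \<in> J \<and> bij_betw (t :: 'i \<Rightarrow> nat) UNIV (J - {j})" if J: "J \<in> S" for J
  proof -
    have "J \<noteq> {}" using J by (auto simp: S_def)
    then obtain j where j: "j \<in> J" by blast
    have "finite J" using J by (auto simp: S_def intro: finite_subset)
    then have "\<exists>t :: 'i \<Rightarrow> nat. bij_betw t UNIV (J - {j})"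
      using J j by (intro finite_same_card_bij) (auto simp: S_def)
    then show ?thesis using j by blast
  qed
  then obtain c and t :: "nat set \<Rightarrow> 'i \<Rightarrow> nat"
    where c: "\<And>J. J \<in> S \<Longrightarrow> c J \<in> J" and t: "\<And>J. J \<in> S \<Longrightarrow> bij_betw (t J) UNIV (J - {c J})" by metis
  have injt: "inj (t J)" and ranget: "range (t J) = J - {c J}" if "J \<in> S" for J
    using t[OF that] by (auto simp: bij_betw_def)
  \<comment> \<open>the coefficients of the Cramer relation between the columns in \<open>J\<close>\<close>
  define r where "r J j = (if j = c J then det (col_matrix b (t J))
     else if j \<in> range (t J) then - det (col_matrix b ((t J)(inv (t J) j := c J))) else 0)" for J j
  have syz: "(\<Sum>j<w. r J j *s lin_col (b j)) = 0" if J: "J \<in> S" for J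
  proof -
    have "(\<Sum>j<w. r J j *s lin_col (b j)) = (\<Sum>j\<in>insert (c J) (range (t J)). r J j *s lin_col (b j))"
      using c[OF J] ranget[OF J] J by (intro sum.mono_neutral_right) (auto simp: r_def S_def)
    also have "\<dots> = det (col_matrix b (t J)) *s lin_col (b (c J)) + (\<Sum>j\<in>range (t J). r J j *s lin_col (b j))"
    proof -
      have "c J \<notin> range (t J)" using ranget[OF J] by auto
      then show ?thesis by (simp add: r_def)
    qed
    also have "(\<Sum>j\<in>range (t J). r J j *s lin_col (b j)) = (\<Sum>l\<in>UNIV. r J (t J l) *s lin_col (b (t J l)))"
      using injt[OF J] by (subst sum.reindex) auto
    also have "\<dots> = - (\<Sum>l\<in>UNIV. det (col_matrix b ((t J)(l := c J))) *s lin_col (b (t J l)))"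
    proof -
      have "r J (t J l) = - det (col_matrix b ((t J)(l := c J)))" for l
        using injt[OF J] ranget[OF J] by (auto simp: r_def)
      then show ?thesis by (simp add: vec_eq_iff sum_negf)
    qed
    also have "\<dots> = - (det (col_matrix b (t J)) *s lin_col (b (c J)))"
      by (subst cramer_identity) (simp add: replace_col_col_matrix column_col_matrix)
    finally show ?thesis by simp
  qed
  let ?A = "exponents U ?k \<times> {..<w}" and ?P = "exponents U (Suc ?k) \<times> (UNIV::'i set)"
  let ?E = "\<lambda>(\<beta>,j) (\<alpha>,i). Poly_Mapping.lookup (mon \<beta> * lin_col (b j) $ i) \<alpha>"
  have "\<exists>g. \<forall>a\<in>?A. (\<Sum>p\<in>?P. ?E a p * g p) = (\<lambda>(\<beta>,j). - F (mon \<beta> *s lin_col (b j))) a"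
  proof (rule solvable_if_orthogonal_to_relations[where Q = S and r = "\<lambda>J (\<beta>,j). Poly_Mapping.lookup (r J j) \<beta>"])
    show "card ?A \<le> card ?P + card S"
    proof -
      obtain m where m: "card U = Suc m" using card_U by (cases "card U") auto
      have w': "w = m + ?k" using w m by simp
      have cS: "card S = w choose Suc ?k" using n_subsets[of "{..<w}" "Suc ?k"] by (simp add: S_def)
      have "Suc ?k * (w choose Suc ?k) = m * (w choose ?k)"
        using binomial_absorb_comp[of w ?k] binomial_absorption[of ?k w] w' by (simp del: mult_Suc)
      then have "w * (w choose ?k) = ?k * (Suc w choose Suc ?k) + (w choose Suc ?k)"
        by (simp add: w' algebra_simps)
      then show ?thesis by (simp add: card_cartesian_product card_exponents cS m w' mult.commute)
    qed
  next
    fix g assume g: "\<forall>a\<in>?A. (\<Sum>p\<in>?P. ?E a p * g p) = 0"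
    have "g (\<alpha>, i) = 0" if "\<alpha> \<in> exponents U (Suc ?k)" for \<alpha> i
    proof (rule functional_coeffs_in_dual[OF _ _ that, of "\<lambda>\<alpha> i. g (\<alpha>, i)"])
      fix j \<beta> assume "j < w" "\<beta> \<in> exponents U ?k"
      then have "(\<Sum>\<alpha>\<in>exponents U (Suc ?k). \<Sum>i\<in>UNIV. Poly_Mapping.lookup (mon \<beta> * lin_col (b j) $ i) \<alpha> * g (\<alpha>, i)) = 0"
        using g by (auto simp: sum.cartesian_product split_def)
      then show "(\<Sum>i\<in>UNIV. \<Sum>\<alpha>\<in>exponents U (Suc ?k). Poly_Mapping.lookup (mon \<beta> * lin_col (b j) $ i) \<alpha> * g (\<alpha>, i)) = 0"
        by (subst sum.swap)
    qed simp
    then show "\<forall>p\<in>?P. g p = 0" by auto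
  next
    fix d assume d: "\<forall>a\<in>?A. (\<Sum>J\<in>S. d J * (\<lambda>(\<beta>,j). Poly_Mapping.lookup (r J j) \<beta>) a) = 0"
    show "\<forall>J\<in>S. d J = 0"
    proof
      fix J0 assume J0: "J0 \<in> S"
      \<comment> \<open>the component of the relations at column \<open>c J0\<close> consists of the minors of \<open>J - {c J0}\<close>, up to sign\<close>
      let ?c = "c J0"
      define S' where "S' = {J\<in>S. ?c \<in> J}"
      define \<tau> where "\<tau> J = (if ?c = c J then t J else (t J)(inv (t J) ?c := c J))" for J
      define \<epsilon> where "\<epsilon> J = (if ?c = c J then 1 else -1 :: complex)" for J
      have range\<tau>: "inj (\<tau> J)" "range (\<tau> J) = J - {?c}" if "J \<in> S'" for J
      proof -
        have J: "J \<in> S" "?c \<in> J" using that by (auto simp: S'_def)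
        show "inj (\<tau> J)"
          using injt[OF J(1)] ranget[OF J(1)] by (simp add: \<tau>_def inj_on_fun_updI)
        show "range (\<tau> J) = J - {?c}"
        proof (cases "?c = c J")
          case False
          then have mem: "?c \<in> range (t J)" using ranget[OF J(1)] J by auto
          then have *: "t J (inv (t J) ?c) = ?c" by (rule f_inv_into_f)
          have "t J ` (UNIV - {inv (t J) ?c}) = J - {c J} - {?c}"
            using injt[OF J(1)] ranget[OF J(1)] by (subst image_set_diff) (auto simp: *)
          moreover have "range (\<tau> J) = insert (c J) (t J ` (UNIV - {inv (t J) ?c}))"
            using False by (auto simp: \<tau>_def)
          ultimately show ?thesis using c[OF J(1)] False by auto
        qed (use ranget[OF J(1)] in \<open>simp add: \<tau>_def\<close>)
      qed
      have rr: "r J ?c = const (\<epsilon> J) * det (col_matrix b (\<tau> J))" if "J \<in> S'" for J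
      proof -
        have "const (- 1) = (- 1 :: 'v mpoly)" by (simp add: single_uminus)
        then show ?thesis using that ranget[of J] by (auto simp: r_def \<epsilon>_def \<tau>_def S'_def)
      qed
      have r0: "r J ?c = 0" if "J \<in> S" "J \<notin> S'" for J
        using that c[of J] ranget[of J] by (auto simp: r_def S'_def)
      have cw: "?c < w" using c[OF J0] J0 by (auto simp: S_def)
      have "d J0 * \<epsilon> J0 = 0"
      proof (rule minors_independent[of S' \<tau>])
        show "finite S'" using finS by (simp add: S'_def)
        show "inj_on (\<lambda>J. range (\<tau> J)) S'"
          using range\<tau>(2) by (auto simp: inj_on_def S'_def)
        show "vanishes U CARD('i) (\<Sum>J\<in>S'. const (d J * \<epsilon> J) * det (col_matrix b (\<tau> J)))"
          unfolding vanishes_def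
        proof
          fix \<beta> assume "\<beta> \<in> exponents U ?k"
          then have "(\<Sum>J\<in>S. d J * Poly_Mapping.lookup (r J ?c) \<beta>) = 0" using d cw by auto
          also have "(\<Sum>J\<in>S. d J * Poly_Mapping.lookup (r J ?c) \<beta>) = (\<Sum>J\<in>S'. d J * Poly_Mapping.lookup (r J ?c) \<beta>)"
            by (rule sum.mono_neutral_right) (use finS r0 in \<open>auto simp: S'_def\<close>)
          finally show "Poly_Mapping.lookup (\<Sum>J\<in>S'. const (d J * \<epsilon> J) * det (col_matrix b (\<tau> J))) \<beta> = 0"
            by (simp add: lookup_sum lookup_const_mult rr mult.assoc)
        qed
        show "J0 \<in> S'" using J0 c by (simp add: S'_def)
        show "inj (\<tau> J) \<and> range (\<tau> J) \<subseteq> {..<w}" if "J \<in> S'" for J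
          using range\<tau>[OF that] that by (auto simp: S'_def S_def)
      qed
      then show "d J0 = 0" by (simp add: \<epsilon>_def)
    qed
  next
    fix J p assume J: "J \<in> S" and "p \<in> ?P"
    then obtain \<alpha> i where p: "p = (\<alpha>, i)" and \<alpha>: "\<alpha> \<in> exponents U (Suc ?k)" by auto
    have "0 = Poly_Mapping.lookup ((\<Sum>j<w. r J j *s lin_col (b j)) $ i) \<alpha>" using syz[OF J] by simp
    also have "\<dots> = (\<Sum>j<w. Poly_Mapping.lookup (r J j * lin_col (b j) $ i) \<alpha>)" by (simp add: lookup_sum)
    also have "\<dots> = (\<Sum>j<w. \<Sum>\<beta>\<in>exponents U ?k. Poly_Mapping.lookup (r J j) \<beta> * Poly_Mapping.lookup (mon \<beta> * lin_col (b j) $ i) \<alpha>)"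
      using \<alpha> by (intro sum.cong refl lookup_mult_restrict[where e = 1] homogeneous_lin_col) simp
    also have "\<dots> = (\<Sum>a\<in>?A. (\<lambda>(\<beta>,j). Poly_Mapping.lookup (r J j) \<beta>) a * ?E a p)"
      by (subst sum.swap) (simp add: sum.cartesian_product split_def p)
    finally show "(\<Sum>a\<in>?A. (\<lambda>(\<beta>,j). Poly_Mapping.lookup (r J j) \<beta>) a * ?E a p) = 0" by simp
  next
    fix J assume J: "J \<in> S"
    have "0 = F (\<Sum>j<w. r J j *s lin_col (b j))" using syz[OF J] functional_0[OF funF] by simp
    also have "\<dots> = (\<Sum>j<w. \<Sum>\<beta>\<in>exponents U ?k. Poly_Mapping.lookup (r J j) \<beta> * F (mon \<beta> *s lin_col (b j)))"
      unfolding functional_sum[OF funF] by (intro sum.cong refl F_smult) simp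
    also have "\<dots> = (\<Sum>a\<in>?A. (\<lambda>(\<beta>,j). Poly_Mapping.lookup (r J j) \<beta>) a * (\<lambda>(\<beta>,j). F (mon \<beta> *s lin_col (b j))) a)"
      by (subst sum.swap) (simp add: sum.cartesian_product split_def)
    finally show "(\<Sum>a\<in>?A. (\<lambda>(\<beta>,j). Poly_Mapping.lookup (r J j) \<beta>) a * (\<lambda>(\<beta>,j). - F (mon \<beta> *s lin_col (b j))) a) = 0"
      by (simp add: split_def sum_negf)
  qed (use finS in auto)
  then obtain g where g: "\<forall>a\<in>?A. (\<Sum>p\<in>?P. ?E a p * g p) = (\<lambda>(\<beta>,j). - F (mon \<beta> *s lin_col (b j))) a" by blast
  define G where "G = from_coeffs (\<lambda>\<alpha> i. if \<alpha> \<in> exponents U (Suc ?k) then g (\<alpha>, i) else 0)"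
  have funG: "functional G" by (simp add: G_def functional_from_coeffs)
  have G_supp: "G (monvec \<alpha> i) = 0" if "\<alpha> \<notin> exponents U (Suc ?k)" for \<alpha> i
    using that by (simp add: G_def)
  have G_col: "G (mon \<beta> *s lin_col (b j)) = - F (mon \<beta> *s lin_col (b j))" if "\<beta> \<in> exponents U ?k" "j < w" for \<beta> j
  proof -
    have "G (mon \<beta> *s lin_col (b j)) = (\<Sum>i\<in>UNIV. \<Sum>\<alpha>\<in>exponents U (Suc ?k).
        Poly_Mapping.lookup ((mon \<beta> *s lin_col (b j)) $ i) \<alpha> * G (monvec \<alpha> i))"
      by (rule functional_supported[OF funG]) (rule G_supp)
    also have "\<dots> = (\<Sum>\<alpha>\<in>exponents U (Suc ?k). \<Sum>i\<in>UNIV. Poly_Mapping.lookup (mon \<beta> * lin_col (b j) $ i) \<alpha> * g (\<alpha>, i))"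
      by (subst sum.swap) (simp add: G_def)
    also have "\<dots> = (\<Sum>p\<in>?P. ?E (\<beta>, j) p * g p)" by (simp add: sum.cartesian_product split_def)
    finally show ?thesis using g that by auto
  qed
  let ?L' = "\<lambda>f. F f + G f"
  have funL': "functional ?L'" using funF funG by (simp add: functional_def algebra_simps)
  have "?L' \<in> cokernel_dual ?V (Suc ?k) b w"
  proof (rule cokernel_dualI[OF funL'])
    fix \<alpha> i assume "\<alpha> \<notin> exponents ?V (Suc ?k)"
    moreover from this have "\<alpha> \<notin> exponents U (Suc ?k)" by (auto simp: exponents_def)
    ultimately show "F (monvec \<alpha> i) + G (monvec \<alpha> i) = 0" using F_supp G_supp by simp
  next
    fix j \<beta> assume "j < w" "\<beta> \<in> exponents ?V ?k"
    show "F (mon \<beta> *s lin_col (b j)) + G (mon \<beta> *s lin_col (b j)) = 0"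
    proof (cases "\<beta> \<in> exponents U ?k")
      case False
      then have "\<beta> + unit_exp x \<notin> exponents U (Suc ?k)" for x by (auto simp: exponents_def keys_add_nat)
      then have "G (mon \<beta> *s lin_col (b j)) = 0" by (simp add: functional_lin_col[OF funG] G_supp)
      then show ?thesis using F_col[OF \<open>j < w\<close> False] by simp
    qed (simp add: G_col \<open>j < w\<close>)
  qed
  moreover have "shift (var x0) ?L' = L"
  proof (rule functional_eqI[OF functional_shift[OF funL'] funL])
    fix \<alpha> i
    have "\<alpha> + unit_exp x0 \<notin> exponents U (Suc ?k)" using x0 by (auto simp: exponents_def keys_add_nat)
    then show "shift (var x0) ?L' (monvec \<alpha> i) = L (monvec \<alpha> i)"
      unfolding shift_def var_smult_monvec by (simp add: F_x0 G_supp)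
  qed
  ultimately show ?thesis by blast
qed

end

section \<open>Common eigenvectors of commuting operators\<close>

lemma linear_on_sum:
  fixes T :: "('a \<Rightarrow> complex) \<Rightarrow> ('a \<Rightarrow> complex)"
  assumes sub: "\<And>f g c. f \<in> E \<Longrightarrow> g \<in> E \<Longrightarrow> (\<lambda>a. f a + c * g a) \<in> E" and zero: "(\<lambda>_. 0) \<in> E"
    and lin: "\<And>f g c. f \<in> E \<Longrightarrow> g \<in> E \<Longrightarrow> T (\<lambda>a. f a + c * g a) = (\<lambda>a. T f a + c * T g a)"
    and fin: "finite S" and f: "\<And>s. s \<in> S \<Longrightarrow> f s \<in> E"
  shows "(\<lambda>a. \<Sum>s\<in>S. c s * f s a) \<in> E \<and> T (\<lambda>a. \<Sum>s\<in>S. c s * f s a) = (\<lambda>a. \<Sum>s\<in>S. c s * T (f s) a)"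
  using fin f
proof (induction S rule: finite_induct)
  case empty
  have "T (\<lambda>a. 0) = (\<lambda>a. T (\<lambda>_. 0) a + (-1) * T (\<lambda>_. 0) a)"
    using lin[OF zero zero, of "-1"] by simp
  then show ?case using zero by (auto simp: fun_eq_iff)
next
  case (insert s S)
  have IH: "(\<lambda>a. \<Sum>s\<in>S. c s * f s a) \<in> E" "T (\<lambda>a. \<Sum>s\<in>S. c s * f s a) = (\<lambda>a. \<Sum>s\<in>S. c s * T (f s) a)"
    using insert by auto
  show ?case
    using sub[OF IH(1), of "f s" "c s"] lin[OF IH(1), of "f s" "c s"] insert IH(2) by (simp add: add.commute)
qed

text \<open>
  A polynomial of minimal degree that annihilates some nonzero vector under \<open>T\<close> has a root \<open>\<xi>\<close>; divided
  by the linear factor of \<open>\<xi>\<close>, it maps the vector to an eigenvector.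
\<close>

lemma eigenvector_exists:
  fixes T :: "('a \<Rightarrow> complex) \<Rightarrow> ('a \<Rightarrow> complex)"
  assumes sub: "\<And>f g c. f \<in> E \<Longrightarrow> g \<in> E \<Longrightarrow> (\<lambda>a. f a + c * g a) \<in> E"
    and fin: "finite A" and sep: "\<And>f. f \<in> E \<Longrightarrow> \<forall>a\<in>A. f a = 0 \<Longrightarrow> f = (\<lambda>_. 0)"
    and T: "\<And>f. f \<in> E \<Longrightarrow> T f \<in> E"
    and lin: "\<And>f g c. f \<in> E \<Longrightarrow> g \<in> E \<Longrightarrow> T (\<lambda>a. f a + c * g a) = (\<lambda>a. T f a + c * T g a)"
    and nz: "f0 \<in> E" "f0 \<noteq> (\<lambda>_. 0)"
  shows "\<exists>f\<in>E. f \<noteq> (\<lambda>_. 0) \<and> (\<exists>\<xi>. T f = (\<lambda>a. \<xi> * f a))"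
proof -
  have zero: "(\<lambda>_. 0) \<in> E" using sub[OF nz(1) nz(1), of "-1"] by simp
  have pow: "(T ^^ m) f \<in> E" if "f \<in> E" for f m by (induction m) (auto simp: that T)
  define P where "P d \<longleftrightarrow> (\<exists>p f. p \<noteq> 0 \<and> degree p = d \<and> f \<in> E \<and> f \<noteq> (\<lambda>_. 0) \<and>
    (\<forall>a. (\<Sum>m\<le>degree p. coeff p m * (T ^^ m) f a) = 0))" for d
  have "\<exists>d. P d"
  proof -
    obtain v where v: "\<exists>m\<in>{..card A}. v m \<noteq> 0" "\<forall>a\<in>A. (\<Sum>m\<le>card A. (T ^^ m) f0 a * v m) = 0"
      using more_unknowns_than_equations[of "{..card A}" A "\<lambda>a m. (T ^^ m) f0 a"] fin by auto
    define p where "p = (\<Sum>m\<le>card A. monom (v m) m)"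
    have cp: "coeff p m = (if m \<le> card A then v m else 0)" for m by (simp add: p_def coeff_sum)
    have "p \<noteq> 0" using v(1) cp by (metis atMost_iff coeff_0)
    have "degree p \<le> card A" by (rule degree_le) (simp add: cp)
    then have eq: "(\<Sum>m\<le>degree p. coeff p m * (T ^^ m) f0 a) = (\<Sum>m\<le>card A. v m * (T ^^ m) f0 a)" for a
    proof (intro sum.mono_neutral_cong_left ballI)
      fix m assume "m \<in> {..card A} - {..degree p}"
      then have "m \<le> card A" "degree p < m" by auto
      then show "v m * (T ^^ m) f0 a = 0" using coeff_eq_0[of p m] cp[of m] by simp
    next
      fix m assume "m \<in> {..degree p}"
      then show "coeff p m * (T ^^ m) f0 a = v m * (T ^^ m) f0 a"
        using \<open>degree p \<le> card A\<close> cp[of m] by simp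
    qed (use \<open>degree p \<le> card A\<close> in auto)
    have "(\<lambda>a. \<Sum>m\<le>card A. v m * (T ^^ m) f0 a) = (\<lambda>_. 0)"
    proof (rule sep)
      show "(\<lambda>a. \<Sum>m\<le>card A. v m * (T ^^ m) f0 a) \<in> E"
        by (rule linear_on_sum[OF sub zero lin, THEN conjunct1]) (simp_all add: pow[OF nz(1)])
      show "\<forall>a\<in>A. (\<Sum>m\<le>card A. v m * (T ^^ m) f0 a) = 0" using v(2) by (simp add: mult.commute)
    qed
    then have "\<forall>a. (\<Sum>m\<le>degree p. coeff p m * (T ^^ m) f0 a) = 0" unfolding eq by (simp add: fun_eq_iff)
    then have "P (degree p)" unfolding P_def using \<open>p \<noteq> 0\<close> nz by blast
    then show ?thesis ..
  qed
  then have "P (LEAST d. P d)" by (metis LeastI)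
  then obtain p f where p: "p \<noteq> 0" "degree p = (LEAST d. P d)" and f: "f \<in> E" "f \<noteq> (\<lambda>_. 0)"
    and pf: "\<And>a. (\<Sum>m\<le>degree p. coeff p m * (T ^^ m) f a) = 0" unfolding P_def by blast
  have "degree p \<noteq> 0"
  proof
    assume d: "degree p = 0"
    then have "coeff p 0 \<noteq> 0" using p(1) by (metis leading_coeff_0_iff)
    then have "f a = 0" for a using pf[of a] d by simp
    then show False using f by auto
  qed
  then obtain \<xi> where "poly p \<xi> = 0"
    using fundamental_theorem_of_algebra constant_degree by metis
  then obtain q where q: "p = [:-\<xi>, 1:] * q" by (metis poly_eq_0_iff_dvd dvd_def)
  have q0: "q \<noteq> 0" using p q by auto
  have "degree ([:-\<xi>, 1:] * q) = degree [:-\<xi>, 1:] + degree q" by (rule degree_mult_eq) (use q0 in auto)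
  then have dp: "degree p = Suc (degree q)" unfolding q[symmetric] by simp
  define g where "g a = (\<Sum>m\<le>degree q. coeff q m * (T ^^ m) f a)" for a
  have gE: "g \<in> E" and Tg: "T g = (\<lambda>a. \<Sum>m\<le>degree q. coeff q m * (T ^^ Suc m) f a)"
  proof -
    have "g \<in> E \<and> T g = (\<lambda>a. \<Sum>m\<le>degree q. coeff q m * T ((T ^^ m) f) a)"
      unfolding g_def by (rule linear_on_sum[OF sub zero lin]) (simp_all add: pow[OF f(1)])
    then show "g \<in> E" "T g = (\<lambda>a. \<Sum>m\<le>degree q. coeff q m * (T ^^ Suc m) f a)" by simp_all
  qed
  have "g \<noteq> (\<lambda>_. 0)"
  proof
    assume "g = (\<lambda>_. 0)"
    then have "P (degree q)" unfolding P_def g_def fun_eq_iff using q0 f by blast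
    then have "(LEAST d. P d) \<le> degree q" by (rule Least_le)
    then show False using p dp by simp
  qed
  moreover have "T g a = \<xi> * g a" for a
  proof -
    have cf: "coeff p m = (case m of 0 \<Rightarrow> 0 | Suc m \<Rightarrow> coeff q m) - \<xi> * coeff q m" for m
      by (simp add: q coeff_pCons)
    have "0 = (\<Sum>m\<le>Suc (degree q). coeff p m * (T ^^ m) f a)" using pf[of a] dp by simp
    also have "\<dots> = (\<Sum>m\<le>Suc (degree q). (case m of 0 \<Rightarrow> 0 | Suc m \<Rightarrow> coeff q m) * (T ^^ m) f a)
        - \<xi> * (\<Sum>m\<le>Suc (degree q). coeff q m * (T ^^ m) f a)"
      by (simp only: cf left_diff_distrib sum_subtractf sum_distrib_left mult.assoc)
    also have "(\<Sum>m\<le>Suc (degree q). (case m of 0 \<Rightarrow> 0 | Suc m \<Rightarrow> coeff q m) * (T ^^ m) f a) = T g a"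
      unfolding Tg by (subst sum.atMost_Suc_shift) simp
    also have "(\<Sum>m\<le>Suc (degree q). coeff q m * (T ^^ m) f a) = g a" by (simp add: g_def coeff_eq_0)
    finally show ?thesis by simp
  qed
  ultimately show ?thesis using gE by blast
qed

text \<open>
  The eigenspace of one operator is invariant under the others.
\<close>

lemma common_eigenvector:
  fixes T :: "'v \<Rightarrow> ('a \<Rightarrow> complex) \<Rightarrow> ('a \<Rightarrow> complex)"
  assumes "finite X" and sub: "\<And>f g c. f \<in> E \<Longrightarrow> g \<in> E \<Longrightarrow> (\<lambda>a. f a + c * g a) \<in> E"
    and fin: "finite A" and sep: "\<And>f. f \<in> E \<Longrightarrow> \<forall>a\<in>A. f a = 0 \<Longrightarrow> f = (\<lambda>_. 0)"
    and T: "\<And>x f. f \<in> E \<Longrightarrow> T x f \<in> E"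
    and lin: "\<And>x f g c. f \<in> E \<Longrightarrow> g \<in> E \<Longrightarrow> T x (\<lambda>a. f a + c * g a) = (\<lambda>a. T x f a + c * T x g a)"
    and comm: "\<And>x y f. f \<in> E \<Longrightarrow> T x (T y f) = T y (T x f)"
    and nz: "f0 \<in> E" "f0 \<noteq> (\<lambda>_. 0)"
  shows "\<exists>f\<in>E. f \<noteq> (\<lambda>_. 0) \<and> (\<forall>x\<in>X. \<exists>\<xi>. T x f = (\<lambda>a. \<xi> * f a))"
  using assms
proof (induction X arbitrary: E f0 rule: finite_induct)
  case empty then show ?case by blast
next
  case (insert x X)
  note sub = insert.prems(1) and sep = insert.prems(3) and T = insert.prems(4) and lin = insert.prems(5)
    and comm = insert.prems(6) and nz = insert.prems(7,8)
  obtain f \<xi> where f: "f \<in> E" "f \<noteq> (\<lambda>_. 0)" "T x f = (\<lambda>a. \<xi> * f a)"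
    using eigenvector_exists[of E A "T x" f0, OF sub fin sep T lin nz] by blast
  have zero: "(\<lambda>_. 0) \<in> E" using sub[OF f(1) f(1), of "-1"] by simp
  have T_scale: "T y (\<lambda>a. c * g a) = (\<lambda>a. c * T y g a)" if "g \<in> E" for y c g
  proof -
    have "T y (\<lambda>a. \<Sum>s\<in>{()}. c * g a) = (\<lambda>a. \<Sum>s\<in>{()}. c * T y g a)"
      by (rule linear_on_sum[OF sub zero lin, THEN conjunct2]) (simp_all add: that)
    then show ?thesis by simp
  qed
  define E' where "E' = {g \<in> E. T x g = (\<lambda>a. \<xi> * g a)}"
  have "\<exists>f\<in>E'. f \<noteq> (\<lambda>_. 0) \<and> (\<forall>y\<in>X. \<exists>\<xi>. T y f = (\<lambda>a. \<xi> * f a))"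
  proof (rule insert.IH[OF _ fin])
    show "(\<lambda>a. f a + c * g a) \<in> E'" if "f \<in> E'" "g \<in> E'" for f g c
      using that sub lin by (auto simp: E'_def algebra_simps)
    show "T y f \<in> E'" if "f \<in> E'" for y f
      using that T comm[of f x y] T_scale[of f y \<xi>] by (auto simp: E'_def)
  qed (use sep lin comm f in \<open>auto simp: E'_def\<close>)
  then show ?case by (auto simp: E'_def)
qed

section \<open>Generic hyperplane sections\<close>

text \<open>
  The matrix with columns \<open>b\<^sub>j(x)\<close>, for \<open>j < w\<close>, has independent rows at every nonzero point \<open>x\<close> of the
  coordinate space of \<open>U\<close>.
\<close>

definition nondegenerate :: "'v set \<Rightarrow> nat \<Rightarrow> (nat \<Rightarrow> 'v \<Rightarrow> complex^'i::finite) \<Rightarrow> bool" where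
  "nondegenerate U w b \<longleftrightarrow> (\<forall>x \<eta>. (\<exists>v\<in>U. x v \<noteq> 0) \<longrightarrow>
     (\<forall>j<w. (\<Sum>v\<in>U. \<Sum>i\<in>UNIV. x v * \<eta> $ i * b j v $ i) = 0) \<longrightarrow> \<eta> = 0)"

lemma nondegenerate_subset:
  assumes "nondegenerate V w b" "finite V" "U \<subseteq> V"
  shows "nondegenerate U w b"
  unfolding nondegenerate_def
proof (intro allI impI)
  fix x :: "'a \<Rightarrow> complex" and \<eta>
  assume x: "\<exists>v\<in>U. x v \<noteq> 0" and 0: "\<forall>j<w. (\<Sum>v\<in>U. \<Sum>i\<in>UNIV. x v * \<eta> $ i * b j v $ i) = 0"
  let ?x = "\<lambda>v. if v \<in> U then x v else 0"
  have "(\<Sum>v\<in>V. \<Sum>i\<in>UNIV. ?x v * \<eta> $ i * b j v $ i) = (\<Sum>v\<in>U. \<Sum>i\<in>UNIV. x v * \<eta> $ i * b j v $ i)" for j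
    using assms by (intro sum.mono_neutral_cong_right) auto
  moreover have "\<exists>v\<in>V. ?x v \<noteq> 0" using x assms(3) by auto
  ultimately show "\<eta> = 0" using 0 assms(1)[unfolded nondegenerate_def, rule_format, of ?x \<eta>] by simp
qed

lemma negligible_component_eq: "negligible {z :: complex^'n::finite. z $ l = c}"
proof (rule negligible_subset)
  show "negligible {z :: complex^'n. axis l 1 \<bullet> z = Re c}"
    by (rule negligible_hyperplane) (simp add: axis_eq_0_iff)
  show "{z :: complex^'n. z $ l = c} \<subseteq> {z. axis l 1 \<bullet> z = Re c}"
    by (auto simp: inner_axis' inner_complex_def)
qed

text \<open>
  The projection along \<open>t\<close> is degenerate at \<open>x\<close> only if some \<open>\<eta>\<close> satisfies \<open>\<eta> b\<^sub>j(x) = t\<^sub>j \<eta> b\<^sub>w(x)\<close> for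
  all \<open>j\<close>, that is, if \<open>(t, 1)\<close> is proportional to a value of the bilinear map \<open>(x, \<eta>) \<mapsto> (\<eta> b\<^sub>j(x))\<^sub>j\<close>. The
  number \<open>w + 1\<close> of components of this map is that of the coordinates of \<open>(x, \<eta>)\<close>, and some nonzero
  coordinate of \<open>x\<close> can be scaled to one at the expense of \<open>\<eta>\<close>. So the values form a set of measure zero.
\<close>

lemma generic_projection:
  fixes b :: "nat \<Rightarrow> 'v::finite \<Rightarrow> complex^'i::finite"
  assumes nd: "nondegenerate U (Suc w) b" and w: "Suc w = card U + CARD('i)"
  shows "\<exists>t. nondegenerate U w (\<lambda>j v. b j v - t j *s b w v)"
proof -
  define B :: "('v + 'i) set" where "B = Inl ` U \<union> range Inr"
  have "card B = Suc w" unfolding B_def w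
    by (subst card_Un_disjoint) (auto simp: card_image)
  then obtain \<sigma> where \<sigma>: "bij_betw \<sigma> {..<Suc w} B"
    using finite_same_card_bij[of "{..<Suc w}" B] by auto
  define \<rho> where "\<rho> = inv_into {..<Suc w} \<sigma>"
  have \<rho>: "\<rho> (\<sigma> j) = j" "\<sigma> j \<in> B" if "j < Suc w" for j
    using that \<sigma> by (auto simp: \<rho>_def bij_betw_def)
  \<comment> \<open>the bilinear map, padded by the identity on the coordinates outside \<open>B\<close> to an endomorphism of a
    space that does not depend on \<open>U\<close>\<close>
  define F :: "complex^('v + 'i) \<Rightarrow> complex^('v + 'i)" where
    "F z = (\<chi> s. if s \<in> B then \<Sum>v\<in>U. \<Sum>i\<in>UNIV. z $ Inl v * z $ Inr i * b (\<rho> s) v $ i else z $ s)" for z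
  define N :: "(complex^('v + 'i)) set" where "N = (\<Union>v\<in>U. {z. z $ Inl v = 1})"
  have "negligible N" unfolding N_def by (intro negligible_Union finite_imageI) (auto simp: negligible_component_eq)
  moreover have "F differentiable_on N"
    unfolding differentiable_on_def
  proof
    fix z assume "z \<in> N"
    have nth: "(\<lambda>z :: complex^('v + 'i). z $ s) differentiable (at z within N)" for s
      by (rule bounded_linear_imp_differentiable) (rule bounded_linear_vec_nth)
    have "(\<lambda>z. F z $ s) differentiable (at z within N)" for s
      unfolding F_def by (cases "s \<in> B") (auto intro!: derivative_intros differentiable_sum nth)
    then have "(\<lambda>z. F z \<bullet> axis s u) differentiable (at z within N)" for s u
      by (simp add: inner_axis differentiable_inner)
    then show "F differentiable (at z within N)"
      by (subst differentiable_componentwise_within) (auto simp: Basis_vec_def)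
  qed
  ultimately have "negligible (F ` N)"
    by (intro negligible_differentiable_image_negligible) auto
  then have "negligible (F ` N \<union> {z. z $ \<sigma> w = 0})" by (intro negligible_Un negligible_component_eq)
  then have "F ` N \<union> {z. z $ \<sigma> w = 0} \<noteq> UNIV" by (metis non_negligible_UNIV)
  then obtain y where y: "y \<notin> F ` N" "y $ \<sigma> w \<noteq> 0" by blast
  define t where "t j = y $ \<sigma> j / y $ \<sigma> w" for j
  have "nondegenerate U w (\<lambda>j v. b j v - t j *s b w v)"
    unfolding nondegenerate_def
  proof (intro allI impI, rule ccontr)
    fix x :: "'v \<Rightarrow> complex" and \<eta> :: "complex^'i"
    assume x: "\<exists>v\<in>U. x v \<noteq> 0" and \<eta>: "\<eta> \<noteq> 0"
      and 0: "\<forall>j<w. (\<Sum>v\<in>U. \<Sum>i\<in>UNIV. x v * \<eta> $ i * (b j v - t j *s b w v) $ i) = 0"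
    define f where "f j = (\<Sum>v\<in>U. \<Sum>i\<in>UNIV. x v * \<eta> $ i * b j v $ i)" for j
    have "(\<Sum>v\<in>U. \<Sum>i\<in>UNIV. x v * \<eta> $ i * (b j v - t j *s b w v) $ i) = f j - t j * f w" for j
      by (simp add: f_def algebra_simps sum_subtractf sum_distrib_left)
    then have f: "f j = t j * f w" if "j < Suc w" for j
      using 0 that y(2) by (cases "j = w") (auto simp: t_def)
    have "f w \<noteq> 0"
    proof
      assume "f w = 0"
      then have "f j = 0" if "j < Suc w" for j using f[OF that] by simp
      then have "\<eta> = 0" using nd[unfolded nondegenerate_def, rule_format, OF x, of \<eta>] by (simp only: f_def)
      then show False using \<eta> by simp
    qed
    obtain u where u: "u \<in> U" "x u \<noteq> 0" using x by blast
    define c where "c = y $ \<sigma> w / f w"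
    define z where "z = (\<chi> s. if s \<in> B then (case s of Inl v \<Rightarrow> x v / x u | Inr i \<Rightarrow> \<eta> $ i * x u * c) else y $ s)"
    have "z \<in> N" using u by (auto simp: N_def z_def B_def)
    moreover have "F z = y"
    proof -
      have "(\<Sum>v\<in>U. \<Sum>i\<in>UNIV. z $ Inl v * z $ Inr i * b (\<rho> s) v $ i) = y $ s" if s: "s \<in> B" for s
      proof -
        obtain j where j: "j < Suc w" "s = \<sigma> j" using s \<sigma> by (auto simp: bij_betw_def)
        have "(\<Sum>v\<in>U. \<Sum>i\<in>UNIV. z $ Inl v * z $ Inr i * b (\<rho> s) v $ i) =
          (\<Sum>v\<in>U. \<Sum>i\<in>UNIV. c * (x v * \<eta> $ i * b j v $ i))"
          using j \<rho> u by (intro sum.cong refl) (simp add: z_def B_def)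
        also have "\<dots> = c * f j" by (simp add: f_def sum_distrib_left)
        also have "\<dots> = y $ s" using f[OF j(1)] \<open>f w \<noteq> 0\<close> y(2) j by (simp add: c_def t_def)
        finally show ?thesis .
      qed
      then show ?thesis by (auto simp: F_def vec_eq_iff) (auto simp: z_def)
    qed
    ultimately show False using y(1) by blast
  qed
  then show ?thesis by blast
qed

section \<open>Vanishing of the cokernel\<close>

lemma cokernel_dual_combine:
  assumes "f \<in> cokernel_dual U d b w" "g \<in> cokernel_dual U d b w"
  shows "(\<lambda>a. f a + c * g a) \<in> cokernel_dual U d b w"
  using assms by (auto simp: cokernel_dual_def functional_def algebra_simps)

lemma shift_commute: "shift p (shift q L) = shift q (shift p L)"
  by (simp add: shift_def fun_eq_iff mult.commute)

lemma functional_zero: "functional (\<lambda>_. 0)"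
  by (simp add: functional_def)

text \<open>
  Such a functional is \<open>x\<^sup>\<alpha> \<otimes> e \<mapsto> \<xi>\<^sup>\<alpha> \<eta>(e)\<close> up to a scalar, and \<open>\<eta>\<close> kills the columns at the point \<open>\<xi>\<close>.
\<close>

lemma geometric_functional_zero:
  fixes b :: "nat \<Rightarrow> 'v::finite \<Rightarrow> complex^'i::finite"
  assumes L: "L \<in> cokernel_dual U (Suc d) b w" and nd: "nondegenerate U w b" and x0: "x0 \<in> U"
    and \<xi>: "\<xi> x0 \<noteq> 0" "\<And>x \<alpha> i. x \<in> U \<Longrightarrow> L (monvec (\<alpha> + unit_exp x) i) = \<xi> x * L (monvec (\<alpha> + unit_exp x0) i)"
  shows "L = (\<lambda>_. 0)"
proof -
  have funL: "functional L" and supp: "\<And>\<alpha> i. \<alpha> \<notin> exponents U (Suc d) \<Longrightarrow> L (monvec \<alpha> i) = 0"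
    and kill: "\<And>j p. j < w \<Longrightarrow> L (p *s lin_col (b j)) = 0"
    using L by (auto simp: cokernel_dual_def)
  let ?s = "\<lambda>n. Poly_Mapping.single x0 n"
  have s: "?s n + unit_exp x0 = ?s (Suc n)" for n by (simp add: single_add[symmetric])
  define \<eta> where "\<eta> = (\<chi> i. L (monvec (?s (Suc d)) i))"
  have "\<eta> = 0"
  proof (rule nd[unfolded nondegenerate_def, rule_format])
    show "\<exists>v\<in>U. \<xi> v \<noteq> 0" using x0 \<xi>(1) by blast
    fix j assume "j < w"
    then have "0 = L (mon (?s d) *s lin_col (b j))" using kill by simp
    also have "\<dots> = (\<Sum>x\<in>UNIV. \<Sum>i\<in>UNIV. b j x $ i * L (monvec (?s d + unit_exp x) i))"
      by (rule functional_lin_col[OF funL])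
    also have "\<dots> = (\<Sum>x\<in>U. \<Sum>i\<in>UNIV. b j x $ i * L (monvec (?s d + unit_exp x) i))"
    proof (rule sum.mono_neutral_right)
      show "\<forall>x\<in>UNIV - U. (\<Sum>i\<in>UNIV. b j x $ i * L (monvec (?s d + unit_exp x) i)) = 0"
      proof
        fix x assume "x \<in> UNIV - U"
        then have "?s d + unit_exp x \<notin> exponents U (Suc d)" by (auto simp: exponents_def keys_add_nat)
        then show "(\<Sum>i\<in>UNIV. b j x $ i * L (monvec (?s d + unit_exp x) i)) = 0" by (simp add: supp)
      qed
    qed auto
    also have "\<dots> = (\<Sum>x\<in>U. \<Sum>i\<in>UNIV. \<xi> x * \<eta> $ i * b j x $ i)"
      by (intro sum.cong refl) (simp add: \<xi>(2) s \<eta>_def mult_ac)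
    finally show "(\<Sum>x\<in>U. \<Sum>i\<in>UNIV. \<xi> x * \<eta> $ i * b j x $ i) = 0" by simp
  qed
  then have base: "L (monvec (?s (Suc d)) i) = 0" for i by (simp add: \<eta>_def vec_eq_iff)
  have "L (monvec (\<alpha> + ?s (Suc d - e)) i) = 0" if "e \<le> Suc d" "\<alpha> \<in> exponents U e" for \<alpha> e i
    using that
  proof (induction e arbitrary: \<alpha>)
    case 0 then show ?case using base by simp
  next
    case (Suc e)
    from Suc.prems(2) obtain x \<beta> where x: "x \<in> U" "\<beta> \<in> exponents U e" "\<alpha> = \<beta> + unit_exp x"
      by (rule exponents_Suc_obtain)
    have "\<beta> + ?s (Suc d - Suc e) + unit_exp x0 = \<beta> + ?s (Suc d - e)"
      using Suc.prems(1) by (simp add: add.assoc s Suc_diff_le)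
    then have "L (monvec ((\<beta> + ?s (Suc d - Suc e)) + unit_exp x) i) = 0"
      using \<xi>(2)[OF x(1)] Suc.IH[OF _ x(2)] Suc.prems(1) by simp
    then show ?case by (simp add: x(3) add_ac)
  qed
  from this[of "Suc d"] have "L (monvec \<alpha> i) = 0" for \<alpha> i
    by (cases "\<alpha> \<in> exponents U (Suc d)") (auto simp: supp)
  then show ?thesis by (intro functional_eqI[OF funL functional_zero]) simp
qed

text \<open>
  A nondegenerate system of linear columns has no cokernel in degree \<open>k\<close>. This is the exactness that
  makes the determinant of \<open>W \<otimes> S\<^bsup>k-1\<^esup> \<rightarrow> I \<otimes> S\<^bsup>k\<^esup>\<close> a hyperdeterminant.
\<close>

theorem cokernel_dual_eq_zero:
  fixes b :: "nat \<Rightarrow> 'v::finite \<Rightarrow> complex^'i::finite"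
  assumes "U \<noteq> {}" "nondegenerate U w b" "w = card U + CARD('i) - 1"
  shows "cokernel_dual U CARD('i) b w \<subseteq> {\<lambda>_. 0}"
proof -
  have "finite U" by simp
  then show ?thesis using assms
  proof (induction U arbitrary: w b rule: finite_ne_induct)
    case (singleton x0)
    obtain d where d: "CARD('i) = Suc d" using not0_implies_Suc[of "CARD('i)"] by auto
    show ?case
      using geometric_functional_zero[of _ "{x0}" d b w x0 "\<lambda>_. 1"] singleton by (auto simp: d)
  next
    case (insert x0 U)
    note nd = \<open>nondegenerate (insert x0 U) w b\<close>
    let ?V = "insert x0 U" and ?k = "CARD('i)"
    have x0: "x0 \<notin> U" using insert.hyps by simp
    obtain d where d: "?k = Suc d" using not0_implies_Suc[of ?k] by auto
    obtain w' where w': "w = Suc w'" "w' = card U + ?k - 1" "Suc w' = card U + ?k"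
      using insert by (auto simp: d)
    obtain t where t: "nondegenerate U w' (\<lambda>j v. b j v - t j *s b w' v)"
      using generic_projection[of U w' b] nondegenerate_subset[OF nd, of U] w' by auto
    \<comment> \<open>the columns of the generic subspace of codimension one; the remaining column is \<open>b w'\<close>\<close>
    define b' where "b' j v = b j v - t j *s b w' v" for j v
    interpret acyclic_columns U w' b'
    proof
      show "cokernel_dual U ?k b' w' \<subseteq> {\<lambda>_. 0}" 
      proof (rule insert.IH)
        show "nondegenerate U w' b'" using t by (simp add: b'_def[abs_def])
      qed (use insert.hyps w' in auto)
    qed (use insert.hyps w' in auto)
    have lin_b': "lin_col (b' j) = lin_col (b j) - const (t j) *s lin_col (b w')" for j
      by (simp add: lin_col_def b'_def vec_eq_iff single_diff algebra_simps sum_subtractf sum_distrib_left mult_single)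
    have dual_iff: "L \<in> cokernel_dual ?V e b w \<longleftrightarrow>
        L \<in> cokernel_dual ?V e b' w' \<and> (\<forall>p. L (p *s lin_col (b w')) = 0)" for L e
    proof (cases "functional L")
      case True
      have "L (p *s lin_col (b' j)) = L (p *s lin_col (b j)) - t j * L (p *s lin_col (b w'))" for p j
      proof -
        have "p *s lin_col (b' j) = p *s lin_col (b j) - const (t j) *s (p *s lin_col (b w'))"
          by (simp add: lin_b' vec_eq_iff algebra_simps)
        then show ?thesis by (simp only: functional_minus[OF True] functional_smult[OF True])
      qed
      then show ?thesis by (auto simp: cokernel_dual_def w'(1) less_Suc_eq)
    qed (simp add: cokernel_dual_def)
    let ?E = "cokernel_dual ?V ?k b w"
    have inj: "L = (\<lambda>_. 0)" if L: "L \<in> cokernel_dual ?V (Suc e) b w" and e: "?k \<le> Suc e"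
      and 0: "shift (var x0) L = (\<lambda>_. 0)" for L e
    proof -
      have "L (monvec \<alpha> i) = 0" if \<alpha>: "\<alpha> \<notin> exponents U (Suc e)" for \<alpha> i
      proof (cases "\<alpha> \<in> exponents ?V (Suc e)")
        case True
        then have "x0 \<in> Poly_Mapping.keys \<alpha>" using \<alpha> by (auto simp: exponents_def)
        then have "\<alpha> = (\<alpha> - unit_exp x0) + unit_exp x0" by (intro unit_exp_add_factor) (simp add: in_keys_iff)
        then show ?thesis using 0 by (metis shift_def var_smult_monvec)
      qed (use L in \<open>auto simp: cokernel_dual_def\<close>)
      then have "L \<in> cokernel_dual U (Suc e) b' w'"
        using L unfolding dual_iff by (auto simp: cokernel_dual_def)
      then show ?thesis using cokernel_dual_zero_above[OF dual, of "Suc e - ?k"] e by auto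
    qed
    have "\<exists>L'\<in>cokernel_dual ?V (Suc ?k) b w. shift (var x0) L' = L" if L: "L \<in> ?E" for L
    proof -
      obtain L' where L': "L' \<in> cokernel_dual ?V (Suc ?k) b' w'" "shift (var x0) L' = L"
        using extend_functional[OF x0, of L] L dual_iff by blast
      have funL': "functional L'" and kill: "\<And>j p. j < w' \<Longrightarrow> L' (p *s lin_col (b' j)) = 0"
        and supp: "\<And>\<alpha> i. \<alpha> \<notin> exponents ?V (Suc ?k) \<Longrightarrow> L' (monvec \<alpha> i) = 0"
        using L'(1) by (auto simp: cokernel_dual_def)
      have outside: "L' (mon \<alpha> *s lin_col (b w')) = 0" if "\<alpha> \<notin> exponents U ?k" for \<alpha>
      proof (cases "\<alpha> \<in> exponents ?V ?k")
        case True
        then have "x0 \<in> Poly_Mapping.keys \<alpha>" using that by (auto simp: exponents_def)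
        then obtain \<gamma> where "\<alpha> = \<gamma> + unit_exp x0" using unit_exp_add_factor[of \<alpha> x0] by (auto simp: in_keys_iff)
        then have "mon \<alpha> *s lin_col (b w') = var x0 *s (mon \<gamma> *s lin_col (b w'))"
          by (simp add: mult_single add.commute)
        moreover have "L (mon \<gamma> *s lin_col (b w')) = 0" using L dual_iff by blast
        ultimately show ?thesis using L'(2) by (metis shift_def)
      next
        case False
        then have "\<alpha> + unit_exp x \<notin> exponents ?V (Suc ?k)" for x by (auto simp: exponents_def keys_add_nat)
        then show ?thesis by (simp add: functional_lin_col[OF funL'] supp)
      qed
      have "L' (mon \<alpha> *s lin_col (b w')) = 0" if \<alpha>: "\<alpha> \<in> exponents U ?k" for \<alpha>
      proof (rule minors_span[OF _ \<alpha>, of "\<lambda>\<alpha>. L' (mon \<alpha> *s lin_col (b w'))"])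
        fix s :: "'i \<Rightarrow> nat" assume s: "range s \<subseteq> {..<w'}"
        let ?D = "det (col_matrix b' s)"
        have "(\<Sum>\<alpha>\<in>exponents U ?k. Poly_Mapping.lookup ?D \<alpha> * L' (mon \<alpha> *s lin_col (b w')))
            = (\<Sum>\<alpha>\<in>Poly_Mapping.keys ?D \<inter> exponents U ?k. Poly_Mapping.lookup ?D \<alpha> * L' (mon \<alpha> *s lin_col (b w')))"
          by (rule sum.mono_neutral_right) (auto simp: in_keys_iff)
        also have "\<dots> = (\<Sum>\<alpha>\<in>Poly_Mapping.keys ?D. Poly_Mapping.lookup ?D \<alpha> * L' (mon \<alpha> *s lin_col (b w')))"
          by (rule sum.mono_neutral_left) (auto simp: outside)
        also have "\<dots> = L' (?D *s lin_col (b w'))" by (rule functional_smult_mpoly[OF funL', symmetric])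
        also have "\<dots> = 0"
          using s kill by (subst cramer_identity) (simp add: functional_sum[OF funL'] column_col_matrix image_subset_iff)
        finally show "(\<Sum>\<alpha>\<in>exponents U ?k. Poly_Mapping.lookup ?D \<alpha> * L' (mon \<alpha> *s lin_col (b w'))) = 0" .
      qed
      then have "L' (p *s lin_col (b w')) = 0" for p
        by (subst functional_smult_mpoly[OF funL'], intro sum.neutral ballI) (metis outside mult_zero_right)
      then show ?thesis using L' dual_iff by blast
    qed
    then obtain ext where ext: "\<And>L. L \<in> ?E \<Longrightarrow> ext L \<in> cokernel_dual ?V (Suc ?k) b w"
      "\<And>L. L \<in> ?E \<Longrightarrow> shift (var x0) (ext L) = L" by metis
    have ext_unique: "M = ext L" if M: "M \<in> cokernel_dual ?V (Suc ?k) b w" "shift (var x0) M = L" "L \<in> ?E" for M L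
    proof -
      have "(\<lambda>a. M a + (-1) * ext L a) = (\<lambda>_. 0)"
      proof (rule inj)
        show "(\<lambda>a. M a + (-1) * ext L a) \<in> cokernel_dual ?V (Suc ?k) b w"
          using M ext by (intro cokernel_dual_combine) auto
        show "shift (var x0) (\<lambda>a. M a + (-1) * ext L a) = (\<lambda>_. 0)"
          using M(2) ext(2)[OF M(3)] by (simp add: shift_def fun_eq_iff)
      qed simp
      then show ?thesis by (simp add: fun_eq_iff)
    qed
    \<comment> \<open>multiplication by \<open>x / x\<^sub>0\<close> on the dual of the cokernel\<close>
    define T where "T x L = shift (var x) (ext L)" for x L
    have T_E: "T x L \<in> ?E" if "L \<in> ?E" for x L
      using that ext shift_var_cokernel_dual unfolding T_def by blast
    show ?case
    proof (rule ccontr)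
      assume "\<not> ?E \<subseteq> {\<lambda>_. 0}"
      then obtain L0 where L0: "L0 \<in> ?E" "L0 \<noteq> (\<lambda>_. 0)" by blast
      have "\<exists>L\<in>?E. L \<noteq> (\<lambda>_. 0) \<and> (\<forall>x\<in>UNIV. \<exists>\<xi>. T x L = (\<lambda>a. \<xi> * L a))"
      proof (rule common_eigenvector[where A = "(\<lambda>(\<alpha>, i). monvec \<alpha> i) ` (exponents ?V ?k \<times> UNIV)"])
        show "finite ((\<lambda>(\<alpha>, i). monvec \<alpha> i :: 'v mpoly^'i) ` (exponents ?V ?k \<times> UNIV))" by simp
        show "f = (\<lambda>_. 0)" if "f \<in> ?E" "\<forall>a\<in>(\<lambda>(\<alpha>, i). monvec \<alpha> i) ` (exponents ?V ?k \<times> UNIV). f a = 0" for f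
        proof (rule functional_eqI[OF _ functional_zero])
          show "f (monvec \<alpha> i) = 0" for \<alpha> i
            using that by (cases "\<alpha> \<in> exponents ?V ?k") (force simp: cokernel_dual_def)+
        qed (use that in \<open>simp add: cokernel_dual_def\<close>)
        show "T x (\<lambda>a. f a + c * g a) = (\<lambda>a. T x f a + c * T x g a)" if "f \<in> ?E" "g \<in> ?E" for x f g c
        proof -
          have "(\<lambda>a. ext f a + c * ext g a) = ext (\<lambda>a. f a + c * g a)"
          proof (rule ext_unique)
            show "(\<lambda>a. ext f a + c * ext g a) \<in> cokernel_dual ?V (Suc ?k) b w"
              using that ext(1) by (intro cokernel_dual_combine)
            show "shift (var x0) (\<lambda>a. ext f a + c * ext g a) = (\<lambda>a. f a + c * g a)"
              using that[THEN ext(2), THEN fun_cong] by (simp add: shift_def fun_eq_iff)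
            show "(\<lambda>a. f a + c * g a) \<in> ?E" using that by (rule cokernel_dual_combine)
          qed
          then show ?thesis by (simp add: T_def shift_def fun_eq_iff)
        qed
        show "T x (T y f) = T y (T x f)" if f: "f \<in> ?E" for x y f
        proof -
          have "(\<lambda>a. T x (T y f) a + (-1) * T y (T x f) a) = (\<lambda>_. 0)"
          proof (rule inj)
            show "(\<lambda>a. T x (T y f) a + (-1) * T y (T x f) a) \<in> cokernel_dual ?V (Suc d) b w"
              using T_E f unfolding d[symmetric] by (intro cokernel_dual_combine) auto
            have "shift (var x0) (T x (T y f)) = shift (var x) (shift (var y) (ext f))" for x y
              unfolding T_def[of x] shift_commute[of "var x0"] ext(2)[OF T_E[OF f]] by (simp add: T_def)
            then have "shift (var x0) (T x (T y f)) = shift (var x0) (T y (T x f))"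
              by (simp add: shift_commute[of "var x"])
            then show "shift (var x0) (\<lambda>a. T x (T y f) a + (-1) * T y (T x f) a) = (\<lambda>_. 0)"
              by (simp add: shift_def fun_eq_iff)
          qed (simp add: d)
          then show ?thesis by (simp add: fun_eq_iff)
        qed
      qed (use L0 T_E cokernel_dual_combine in auto)
      then obtain L where L: "L \<in> ?E" "L \<noteq> (\<lambda>_. 0)" and eigen: "\<forall>x. \<exists>\<xi>. T x L = (\<lambda>a. \<xi> * L a)"
        by blast
      obtain \<xi> where \<xi>: "\<And>x. T x L = (\<lambda>a. \<xi> x * L a)" using choice[OF eigen] by blast
      have Tx0: "T x0 L = L" using ext(2)[OF L(1)] by (simp add: T_def)
      have "\<xi> x0 \<noteq> 0"
      proof
        assume "\<xi> x0 = 0"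
        then have "L = (\<lambda>_. 0)" using \<xi>[of x0] Tx0 by simp
        then show False using L by simp
      qed
      have "L = (\<lambda>_. 0)"
      proof (rule geometric_functional_zero[of L ?V d b w x0 \<xi>])
        show "L (monvec (\<alpha> + unit_exp x) i) = \<xi> x * L (monvec (\<alpha> + unit_exp x0) i)" for x \<alpha> i
        proof -
          have "L (monvec (\<alpha> + unit_exp x) i) = ext L (monvec (\<alpha> + unit_exp x + unit_exp x0) i)"
            using ext(2)[OF L(1)] by (metis shift_def var_smult_monvec)
          also have "\<dots> = ext L (monvec (\<alpha> + unit_exp x0 + unit_exp x) i)" by (simp add: add_ac)
          also have "\<dots> = T x L (monvec (\<alpha> + unit_exp x0) i)"
            by (simp only: T_def shift_def var_smult_monvec)
          finally show ?thesis by (simp add: \<xi>)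
        qed
      qed (use L nd \<open>\<xi> x0 \<noteq> 0\<close> in \<open>auto simp: d\<close>)
      then show False using L by simp
    qed
  qed
qed

section \<open>Multiplicative functions on the general linear group\<close>

definition multiplicative :: "(complex^'n^'n \<Rightarrow> complex) \<Rightarrow> bool" where
  "multiplicative h \<longleftrightarrow> (\<forall>A. det A \<noteq> 0 \<longrightarrow> h A \<noteq> 0) \<and>
     (\<forall>A B. det A \<noteq> 0 \<longrightarrow> det B \<noteq> 0 \<longrightarrow> h (A ** B) = h A * h B)"

definition shear :: "'n \<Rightarrow> complex^'n \<Rightarrow> complex^'n^'n" where
  "shear s u = (\<chi> i j. (if i = j then 1 else 0) + (if j = s then u $ i else 0))"

definition diag_mat :: "('n \<Rightarrow> complex) \<Rightarrow> complex^'n^'n" where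
  "diag_mat c = (\<chi> i j. if i = j then c i else 0)"

lemma mult_shear: "A ** shear s u = (\<chi> i j. A $ i $ j + (if j = s then (A *v u) $ i else 0))"
proof -
  have "(A ** shear s u) $ i $ j = A $ i $ j + (if j = s then (A *v u) $ i else 0)" for i j
    by (cases "j = s")
       (simp_all add: shear_def matrix_matrix_mult_def matrix_vector_mult_def distrib_left sum.distrib
         if_distrib[of "(*) _"] cong: if_cong)
  then show ?thesis by (simp add: vec_eq_iff)
qed

lemma shear_mult: "shear s u ** A = (\<chi> i j. A $ i $ j + u $ i * A $ s $ j)"
proof -
  have "(shear s u ** A) $ i $ j = (\<Sum>k\<in>UNIV. (if i = k then A $ k $ j else 0) + (if k = s then u $ i * A $ k $ j else 0))" for i j
    unfolding matrix_matrix_mult_def shear_def vec_lambda_beta by (intro sum.cong refl) (simp add: distrib_right)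
  then show ?thesis by (simp add: vec_eq_iff sum.distrib)
qed

lemma diag_mat_mult: "diag_mat c ** A = (\<chi> i j. c i * A $ i $ j)"
proof -
  have "(diag_mat c ** A) $ i $ j = (\<Sum>k\<in>UNIV. if i = k then c i * A $ k $ j else 0)" for i j
    unfolding matrix_matrix_mult_def diag_mat_def vec_lambda_beta by (intro sum.cong refl) simp
  then show ?thesis by (simp add: vec_eq_iff)
qed

lemma mult_diag_mat: "A ** diag_mat c = (\<chi> i j. A $ i $ j * c j)"
proof -
  have "(A ** diag_mat c) $ i $ j = (\<Sum>k\<in>UNIV. if k = j then A $ i $ k * c k else 0)" for i j
    unfolding matrix_matrix_mult_def diag_mat_def vec_lambda_beta by (intro sum.cong refl) simp
  then show ?thesis by (simp add: vec_eq_iff)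
qed

lemma det_diag_mat: "det (diag_mat c) = (\<Prod>i\<in>UNIV. c i)"
  by (subst det_diagonal) (auto simp: diag_mat_def)

lemma shear_add: "u $ s = 0 \<Longrightarrow> v $ s = 0 \<Longrightarrow> shear s u ** shear s v = shear s (u + v)"
  unfolding shear_mult by (auto simp: vec_eq_iff shear_def)

lemma det_shear_nonzero: assumes "u $ s = 0" shows "det (shear s u) \<noteq> 0"
proof -
  have "shear s u ** shear s (- u) = mat 1"
    using assms by (subst shear_add) (auto simp: shear_def mat_def vec_eq_iff)
  then have "det (shear s u) * det (shear s (- u)) = 1" by (metis det_I det_mul)
  then show ?thesis by auto
qed

text \<open>
  A shear is conjugate to its square by a diagonal matrix.
\<close>

lemma multiplicative_shear:
  fixes h :: "complex^'n^'n \<Rightarrow> complex"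
  assumes h: "multiplicative h" and u: "u $ s = 0"
  shows "h (shear s u) = 1"
proof -
  define D :: "complex^'n^'n" where "D = diag_mat (\<lambda>i. if i = s then 2 else 1)"
  have D: "det D \<noteq> 0" by (simp add: D_def det_diag_mat)
  have "D ** shear s (u + u) = shear s u ** D"
    unfolding D_def diag_mat_mult mult_diag_mat using u by (auto simp: vec_eq_iff shear_def)
  moreover have "(u + u) $ s = 0" using u by simp
  ultimately have "h D * h (shear s (u + u)) = h (shear s u) * h D"
    using h D u unfolding multiplicative_def by (metis det_shear_nonzero)
  moreover have "h (shear s (u + u)) = h (shear s u) * h (shear s u)"
    using h u unfolding multiplicative_def by (metis det_shear_nonzero shear_add)
  moreover have "h D \<noteq> 0" "h (shear s u) \<noteq> 0"
    using h D det_shear_nonzero[OF u] by (auto simp: multiplicative_def)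
  ultimately show ?thesis by simp
qed

lemma multiplicative_transpose:
  "multiplicative h \<Longrightarrow> multiplicative (\<lambda>A. h (transpose A))"
  by (simp add: multiplicative_def matrix_transpose_mul det_transpose mult.commute)

lemma multiplicative_det: "multiplicative det"
  by (simp add: multiplicative_def det_mul)

lemma multiplicative_mult_shear:
  fixes A :: "complex^'n^'n"
  assumes "multiplicative h" "det A \<noteq> 0" "u $ s = 0"
  shows "h (A ** shear s u) = h A" "h (shear s u ** A) = h A" "h (A ** transpose (shear s u)) = h A"
  using assms multiplicative_shear[OF assms(1,3)] multiplicative_shear[OF multiplicative_transpose[OF assms(1)] assms(3)]
  unfolding multiplicative_def by (simp_all add: det_shear_nonzero det_transpose)

lemma mult_transpose_shear: "A ** transpose (shear s v) = (\<chi> i j. A $ i $ j + A $ i $ s * v $ j)"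
proof -
  have "(A ** transpose (shear s v)) $ i $ j = (\<Sum>k\<in>UNIV. (if j = k then A $ i $ k else 0) + (if k = s then A $ i $ k * v $ j else 0))" for i j
    unfolding matrix_matrix_mult_def shear_def transpose_def vec_lambda_beta by (intro sum.cong refl) (simp add: distrib_left)
  then show ?thesis by (simp add: vec_eq_iff sum.distrib)
qed

text \<open>
  Gaussian elimination by row and column shears, which a multiplicative function does not see. The
  diagonal matrix is the same for all multiplicative functions, in particular for the determinant.
\<close>

lemma reduce_to_diagonal:
  fixes A :: "complex^'n^'n"
  assumes "det A \<noteq> 0"
  shows "\<exists>c. \<forall>h. multiplicative h \<longrightarrow> h A = h (diag_mat c)"
proof -
  have "\<exists>c. \<forall>h. multiplicative h \<longrightarrow> h A = h (diag_mat c)"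
    if "finite S" "det A \<noteq> 0" "\<And>i j. i \<noteq> j \<Longrightarrow> i \<notin> S \<or> j \<notin> S \<Longrightarrow> A $ i $ j = 0" for S and A :: "complex^'n^'n"
    using that
  proof (induction S arbitrary: A rule: finite_induct)
    case empty
    then have "A = diag_mat (\<lambda>i. A $ i $ i)" by (auto simp: diag_mat_def vec_eq_iff)
    then show ?case by metis
  next
    case (insert s S)
    note off = insert.prems(2)
    \<comment> \<open>a column operation makes the pivot nonzero\<close>
    obtain B :: "complex^'n^'n" where B: "det B \<noteq> 0" "B $ s $ s \<noteq> 0" "\<And>h. multiplicative h \<Longrightarrow> h B = h A"
      "\<And>i j. i \<noteq> j \<Longrightarrow> i \<notin> insert s S \<or> j \<notin> insert s S \<Longrightarrow> B $ i $ j = 0"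
    proof (cases "A $ s $ s = 0")
      case False
      then show ?thesis using that[of A] insert.prems by blast
    next
      case True
      obtain j where j: "A $ s $ j \<noteq> 0"
      proof (rule ccontr)
        assume "\<not> thesis"
        then have "row s A = 0" using that by (auto simp: row_def vec_eq_iff)
        then show False using insert.prems(1) det_zero_row(2) by blast
      qed
      then have js: "j \<noteq> s" using True by auto
      have jS: "j \<in> insert s S" using off[of s j] j js by auto
      let ?B = "A ** shear s (axis j 1)"
      have ent: "?B $ a $ b = A $ a $ b + (if b = s then A $ a $ j else 0)" for a b
        by (simp add: mult_shear matrix_vector_mult_def axis_def if_distrib cong: if_cong)
      have axis: "axis j 1 $ s = (0::complex)" using js by (simp add: axis_def)
      show ?thesis
      proof (rule that[of ?B])
        show "det ?B \<noteq> 0" using insert.prems(1) by (simp add: det_mul det_shear_nonzero axis)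
        show "?B $ s $ s \<noteq> 0" using j True by (simp add: ent)
        show "h ?B = h A" if "multiplicative h" for h
          using multiplicative_mult_shear(1)[OF that insert.prems(1) axis] .
        show "?B $ a $ b = 0" if "a \<noteq> b" "a \<notin> insert s S \<or> b \<notin> insert s S" for a b
          using that off[of a b] off[of a j] jS by (auto simp: ent)
      qed
    qed
    define a where "a = B $ s $ s"
    have a: "a \<noteq> 0" using B(2) by (simp add: a_def)
    define u where "u = (\<chi> i. if i = s then 0 else - B $ i $ s / a)"
    define v where "v = (\<chi> j. if j = s then 0 else - B $ s $ j / a)"
    let ?C = "(shear s u ** B) ** transpose (shear s v)"
    have us: "u $ s = 0" "v $ s = 0" by (simp_all add: u_def v_def)
    have ent: "?C $ i $ j = B $ i $ j + u $ i * B $ s $ j + (B $ i $ s + u $ i * a) * v $ j" for i j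
      by (simp add: mult_transpose_shear shear_mult a_def)
    have detL: "det (shear s u ** B) \<noteq> 0" using B(1) us by (simp add: det_mul det_shear_nonzero)
    have "\<exists>c. \<forall>h. multiplicative h \<longrightarrow> h ?C = h (diag_mat c)"
    proof (rule insert.IH)
      show "det ?C \<noteq> 0" using detL us by (simp add: det_mul det_shear_nonzero det_transpose)
      show "?C $ i $ j = 0" if "i \<noteq> j" "i \<notin> S \<or> j \<notin> S" for i j
      proof (cases "i = s \<or> j = s")
        case True
        then show ?thesis using that(1) a by (unfold ent, elim disjE) (simp_all add: u_def v_def a_def[symmetric])
      next
        case False
        then have "B $ i $ j = 0" "B $ i $ s = 0 \<or> B $ s $ j = 0"
          using that B(4)[of i j] B(4)[of i s] B(4)[of s j] by auto
        then show ?thesis using False a by (unfold ent, elim disjE) (simp_all add: u_def v_def)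
      qed
    qed
    then obtain c where c: "\<And>h. multiplicative h \<Longrightarrow> h ?C = h (diag_mat c)" by blast
    have "h A = h (diag_mat c)" if h: "multiplicative h" for h
    proof -
      have "h (diag_mat c) = h ?C" by (rule c[OF h, symmetric])
      also have "\<dots> = h (shear s u ** B)" by (rule multiplicative_mult_shear(3)[OF h detL us(2)])
      also have "\<dots> = h B" by (rule multiplicative_mult_shear(2)[OF h B(1) us(1)])
      also have "\<dots> = h A" by (rule B(3)[OF h])
      finally show ?thesis by (rule sym)
    qed
    then show ?case by blast
  qed
  then show ?thesis using assms by (metis UNIV_I finite)
qed

text \<open>
  By conjugation with permutation matrices, the value at a diagonal matrix depends only on the product
  of the diagonal entries.
\<close>

lemma multiplicative_eq_1:
  fixes h :: "complex^'n^'n \<Rightarrow> complex"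
  assumes h: "multiplicative h" and A: "det A = 1"
  shows "h A = 1"
proof -
  define D :: "'n \<Rightarrow> complex \<Rightarrow> complex^'n^'n" where "D i t = diag_mat (\<lambda>j. if j = i then t else 1)" for i t
  have detD: "det (D i t) = t" for i t by (simp add: D_def det_diag_mat)
  have mult: "h (A ** B) = h A * h B" if "det A \<noteq> 0" "det B \<noteq> 0" for A B
    using h that by (simp add: multiplicative_def)
  have one: "h (mat 1) = 1"
  proof -
    have "h (mat 1) = h (mat 1) * h (mat 1)" using mult[of "mat 1" "mat 1"] by (simp add: det_I)
    moreover have "h (mat 1) \<noteq> 0" using h by (simp add: multiplicative_def det_I)
    ultimately show ?thesis by simp
  qed
  \<comment> \<open>conjugation by the permutation matrix of a transposition\<close>
  have swap: "h (D i t) = h (D j t)" if t: "t \<noteq> 0" for i j t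
  proof -
    define P :: "complex^'n^'n" where "P = (\<chi> a b. if a = Transposition.transpose i j b then 1 else 0)"
    have "(P ** P) $ a $ b = mat 1 $ a $ b" for a b
    proof -
      have "(P ** P) $ a $ b = (\<Sum>e\<in>UNIV. if e = Transposition.transpose i j b then P $ a $ e else 0)"
        unfolding matrix_matrix_mult_def vec_lambda_beta by (intro sum.cong refl) (simp add: P_def)
      then show ?thesis by (simp add: P_def mat_def)
    qed
    then have "P ** P = mat 1" by (simp add: vec_eq_iff)
    then have "det P * det P = 1" by (metis det_I det_mul)
    then have P: "det P \<noteq> 0" by auto
    have "D j t ** P = P ** D i t"
      unfolding D_def diag_mat_mult mult_diag_mat
      by (auto simp: P_def vec_eq_iff Transposition.transpose_def)
    then have "h (D j t) * h P = h P * h (D i t)" using mult P t by (metis detD)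
    moreover have "h P \<noteq> 0" using h P by (simp add: multiplicative_def)
    ultimately show ?thesis by simp
  qed
  obtain c where c: "\<And>h. multiplicative h \<Longrightarrow> h A = h (diag_mat c)"
    using reduce_to_diagonal[of A] A by auto
  have prod1: "(\<Prod>i\<in>UNIV. c i) = 1" using c[OF multiplicative_det] A by (simp add: det_diag_mat)
  then have c0: "c i \<noteq> 0" for i by (metis UNIV_I finite prod_zero_iff zero_neq_one)
  fix i0 :: 'n
  have "h (diag_mat (\<lambda>i. if i \<in> S then c i else 1)) = h (D i0 (\<Prod>i\<in>S. c i))" if "finite S" for S
    using that
  proof (induction S rule: finite_induct)
    case empty
    show ?case by (simp add: D_def)
  next
    case (insert s S)
    have "diag_mat (\<lambda>i. if i \<in> insert s S then c i else 1) = D s (c s) ** diag_mat (\<lambda>i. if i \<in> S then c i else 1)"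
      unfolding D_def diag_mat_mult using insert.hyps by (auto simp: vec_eq_iff diag_mat_def)
    then have "h (diag_mat (\<lambda>i. if i \<in> insert s S then c i else 1)) = h (D s (c s)) * h (diag_mat (\<lambda>i. if i \<in> S then c i else 1))"
      using c0 by (simp add: mult detD det_diag_mat)
    also have "\<dots> = h (D i0 (c s)) * h (D i0 (\<Prod>i\<in>S. c i))" using swap[OF c0] insert.IH by simp
    also have "\<dots> = h (D i0 (c s) ** D i0 (\<Prod>i\<in>S. c i))" using c0 insert.hyps by (simp add: mult detD)
    also have "D i0 (c s) ** D i0 (\<Prod>i\<in>S. c i) = D i0 (c s * (\<Prod>i\<in>S. c i))"
      unfolding D_def diag_mat_mult by (auto simp: vec_eq_iff diag_mat_def)
    finally show ?case using insert.hyps by simp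
  qed
  from this[of UNIV] have "h (diag_mat c) = h (D i0 1)" by (simp add: prod1)
  also have "D i0 1 = mat 1" by (auto simp: D_def diag_mat_def mat_def vec_eq_iff)
  finally show ?thesis using c[OF h] one by simp
qed

lemma det_representation_SL:
  fixes K :: "complex^'n^'n \<Rightarrow> complex^'r^'r"
  assumes mult: "\<And>A B. K (A ** B) = K A ** K B" and one: "K (mat 1) = mat 1" and A: "det A = 1"
  shows "det (K A) = 1"
proof (rule multiplicative_eq_1[of "\<lambda>A. det (K A)", OF _ A])
  have "det (K A) \<noteq> 0" if "det A \<noteq> 0" for A
  proof -
    have "invertible A" using that by (simp add: invertible_det_nz)
    then obtain B where "A ** B = mat 1" unfolding invertible_def by blast
    then have "det (K A) * det (K B) = 1" by (metis mult one det_mul det_I)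
    then show ?thesis by auto
  qed
  then show "multiplicative (\<lambda>A. det (K A))" by (simp add: multiplicative_def mult det_mul)
qed

section \<open>Forms\<close>

lemma finite_degree_functions: "finite {\<alpha> :: 'a::finite \<Rightarrow> nat. sum \<alpha> UNIV = d}"
proof (rule finite_subset)
  show "{\<alpha> :: 'a \<Rightarrow> nat. sum \<alpha> UNIV = d} \<subseteq> UNIV \<rightarrow>\<^sub>E {..d}"
  proof
    fix \<alpha> :: "'a \<Rightarrow> nat" assume "\<alpha> \<in> {\<alpha>. sum \<alpha> UNIV = d}"
    then have "\<alpha> x \<le> d" for x using member_le_sum[of x UNIV \<alpha>] by simp
    then show "\<alpha> \<in> UNIV \<rightarrow>\<^sub>E {..d}" by (simp add: PiE_def Pi_def extensional_def)
  qed
qed (simp add: finite_PiE)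

lemma forms_coeffsI:
  assumes "\<And>X. f X = (\<Sum>\<alpha> | sum \<alpha> UNIV = d. c \<alpha> * monomial \<alpha> X)"
  shows "f \<in> forms d"
  unfolding forms_def mem_Collect_eq using assms by (intro exI[of _ c]) blast

text \<open>
  The exponents may repeat; the coefficients of equal ones are added.
\<close>

lemma formsI:
  fixes f :: "complex^'b::finite^'a::finite \<Rightarrow> complex"
  assumes "finite S" "\<And>s. s \<in> S \<Longrightarrow> sum (a s) UNIV = d" "\<And>X. f X = (\<Sum>s\<in>S. c s * monomial (a s) X)"
  shows "f \<in> forms d"
proof -
  let ?E = "{\<alpha> :: 'a \<times> 'b \<Rightarrow> nat. sum \<alpha> UNIV = d}"
  note fin = finite_degree_functions[of d]
  have "f X = (\<Sum>\<alpha>\<in>?E. (\<Sum>s\<in>{s\<in>S. a s = \<alpha>}. c s) * monomial \<alpha> X)" for X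
  proof -
    have "f X = (\<Sum>\<alpha>\<in>?E. \<Sum>s\<in>{s\<in>S. a s = \<alpha>}. c s * monomial (a s) X)"
      unfolding assms(3) by (rule sum.group[symmetric]) (use assms(1,2) fin in auto)
    also have "\<dots> = (\<Sum>\<alpha>\<in>?E. (\<Sum>s\<in>{s\<in>S. a s = \<alpha>}. c s) * monomial \<alpha> X)"
      by (intro sum.cong refl) (simp add: sum_distrib_right)
    finally show ?thesis .
  qed
  then show ?thesis by (rule forms_coeffsI)
qed

lemma forms_coord: "(\<lambda>X :: complex^'b::finite^'a::finite. X $ p $ q) \<in> forms 1"
proof (rule formsI[of "{()}" "\<lambda>_ e. if e = (p, q) then 1 else 0" _ _ "\<lambda>_. 1"])
  show "X $ p $ q = (\<Sum>s\<in>{()}. 1 * monomial (\<lambda>e. if e = (p, q) then 1 else 0) X)" for X :: "complex^'b^'a"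
  proof -
    have "monomial (\<lambda>e. if e = (p, q) then 1 else 0) X = (\<Prod>e\<in>UNIV. if e = (p, q) then X $ p $ q else 1)"
      unfolding monomial_def by (intro prod.cong) auto
    then show ?thesis by (simp add: prod.delta)
  qed
qed auto

lemma forms_const: "(\<lambda>X. c) \<in> forms 0"
  by (rule formsI[of "{()}" "\<lambda>_ _. 0" _ _ "\<lambda>_. c"]) (auto simp: monomial_def)

lemma forms_sum:
  fixes f :: "'s \<Rightarrow> complex^'b::finite^'a::finite \<Rightarrow> complex"
  assumes "finite S" "\<And>s. s \<in> S \<Longrightarrow> f s \<in> forms d"
  shows "(\<lambda>X. \<Sum>s\<in>S. f s X) \<in> forms d"
proof -
  have "\<forall>s\<in>S. \<exists>c. \<forall>X. f s X = (\<Sum>\<alpha> | sum \<alpha> UNIV = d. c \<alpha> * monomial \<alpha> X)"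
    using assms(2) by (simp add: forms_def)
  from bchoice[OF this] obtain c where
    c: "\<forall>s\<in>S. \<forall>X. f s X = (\<Sum>\<alpha> | sum \<alpha> UNIV = d. c s \<alpha> * monomial \<alpha> X)" by blast
  have "(\<Sum>s\<in>S. f s X) = (\<Sum>\<alpha> | sum \<alpha> UNIV = d. (\<Sum>s\<in>S. c s \<alpha>) * monomial \<alpha> X)" for X
  proof -
    have "(\<Sum>s\<in>S. f s X) = (\<Sum>s\<in>S. \<Sum>\<alpha> | sum \<alpha> UNIV = d. c s \<alpha> * monomial \<alpha> X)"
      using c by (intro sum.cong) auto
    then show ?thesis unfolding sum_distrib_right by (subst (asm) sum.swap)
  qed
  then show ?thesis by (rule forms_coeffsI)
qed

lemma forms_mult:
  fixes f g :: "complex^'b::finite^'a::finite \<Rightarrow> complex"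
  assumes "f \<in> forms d" "g \<in> forms e"
  shows "(\<lambda>X. f X * g X) \<in> forms (d + e)"
proof -
  obtain c where c: "\<And>X. f X = (\<Sum>\<alpha> | sum \<alpha> UNIV = d. c \<alpha> * monomial \<alpha> X)" using assms(1) by (auto simp: forms_def)
  obtain c' where c': "\<And>X. g X = (\<Sum>\<alpha> | sum \<alpha> UNIV = e. c' \<alpha> * monomial \<alpha> X)" using assms(2) by (auto simp: forms_def)
  let ?S = "{\<alpha>. sum \<alpha> UNIV = d} \<times> {\<alpha>. sum \<alpha> UNIV = e} :: (('a \<times> 'b \<Rightarrow> nat) \<times> ('a \<times> 'b \<Rightarrow> nat)) set"
  show ?thesis
  proof (rule formsI[of ?S "\<lambda>(\<alpha>, \<beta>) x. \<alpha> x + \<beta> x" _ _ "\<lambda>(\<alpha>, \<beta>). c \<alpha> * c' \<beta>"])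
    show "f X * g X = (\<Sum>s\<in>?S. (case s of (\<alpha>, \<beta>) \<Rightarrow> c \<alpha> * c' \<beta>) * monomial (case s of (\<alpha>, \<beta>) \<Rightarrow> \<lambda>x. \<alpha> x + \<beta> x) X)" for X
      unfolding c c' sum_product sum.cartesian_product
      by (intro sum.cong) (auto simp: monomial_def power_add prod.distrib)
  qed (auto simp: finite_degree_functions sum.distrib)
qed

lemma forms_prod:
  assumes "finite S" "\<And>s. s \<in> S \<Longrightarrow> f s \<in> forms 1"
  shows "(\<lambda>X. \<Prod>s\<in>S. f s X) \<in> forms (card S)"
  using assms
proof (induction S rule: finite_induct)
  case empty show ?case using forms_const[of 1] by simp
next
  case (insert s S)
  then have "(\<lambda>X. f s X * (\<Prod>s\<in>S. f s X)) \<in> forms (1 + card S)" by (intro forms_mult) auto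
  then show ?case using insert.hyps by simp
qed

lemma forms_power: "f \<in> forms d \<Longrightarrow> (\<lambda>X. f X ^ r) \<in> forms (r * d)"
  by (induction r) (auto simp: forms_const intro: forms_mult)

lemma forms_det:
  fixes M :: "complex^'b::finite^'a::finite \<Rightarrow> complex^'r^'r"
  assumes "\<And>p q. (\<lambda>X. M X $ p $ q) \<in> forms 1"
  shows "(\<lambda>X. det (M X)) \<in> forms CARD('r)"
  unfolding det_def
proof (rule forms_sum)
  fix p :: "'r \<Rightarrow> 'r"
  have "(\<lambda>X. of_int (sign p) * (\<Prod>i\<in>UNIV. M X $ i $ p i)) \<in> forms (0 + CARD('r))"
    by (intro forms_mult forms_const forms_prod assms) auto
  then show "(\<lambda>X. of_int (sign p) * (\<Prod>i\<in>UNIV. M X $ i $ p i)) \<in> forms CARD('r)" by simp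
qed simp

section \<open>Linear substitutions\<close>

definition subst_mon :: "('v \<Rightarrow> 'v mpoly) \<Rightarrow> ('v::finite \<Rightarrow>\<^sub>0 nat) \<Rightarrow> 'v mpoly" where
  "subst_mon \<sigma> \<alpha> = (\<Prod>y\<in>UNIV. \<sigma> y ^ Poly_Mapping.lookup \<alpha> y)"

definition subst :: "('v \<Rightarrow> 'v mpoly) \<Rightarrow> 'v::finite mpoly \<Rightarrow> 'v mpoly" where
  "subst \<sigma> p = (\<Sum>\<alpha>\<in>Poly_Mapping.keys p. const (Poly_Mapping.lookup p \<alpha>) * subst_mon \<sigma> \<alpha>)"

lemma subst_superset:
  assumes "finite S" "Poly_Mapping.keys p \<subseteq> S"
  shows "subst \<sigma> p = (\<Sum>\<alpha>\<in>S. const (Poly_Mapping.lookup p \<alpha>) * subst_mon \<sigma> \<alpha>)"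
  unfolding subst_def using assms by (intro sum.mono_neutral_left) (auto simp: in_keys_iff)

lemma subst_add: "subst \<sigma> (p + q) = subst \<sigma> p + subst \<sigma> q"
proof -
  let ?S = "Poly_Mapping.keys p \<union> Poly_Mapping.keys q"
  have "subst \<sigma> (p + q) = (\<Sum>\<alpha>\<in>?S. const (Poly_Mapping.lookup (p + q) \<alpha>) * subst_mon \<sigma> \<alpha>)"
    using keys_add[of p q] by (intro subst_superset) auto
  also have "\<dots> = subst \<sigma> p + subst \<sigma> q"
    by (subst (1 2) subst_superset[of ?S]) (auto simp: lookup_add single_add distrib_right sum.distrib)
  finally show ?thesis .
qed

lemma subst_0 [simp]: "subst \<sigma> 0 = 0"
  by (simp add: subst_def)

lemma subst_sum: "subst \<sigma> (\<Sum>s\<in>S. p s) = (\<Sum>s\<in>S. subst \<sigma> (p s))"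
  by (induction S rule: infinite_finite_induct) (auto simp: subst_add)

lemma subst_single: "subst \<sigma> (Poly_Mapping.single \<alpha> c) = const c * subst_mon \<sigma> \<alpha>"
  by (simp add: subst_def)

lemma subst_mon_add: "subst_mon \<sigma> (\<alpha> + \<beta>) = subst_mon \<sigma> \<alpha> * subst_mon \<sigma> \<beta>"
  by (simp add: subst_mon_def lookup_add power_add prod.distrib)

lemma subst_mult: "subst \<sigma> (p * q) = subst \<sigma> p * subst \<sigma> q"
proof -
  have "p * q = (\<Sum>\<alpha>\<in>Poly_Mapping.keys p. \<Sum>\<beta>\<in>Poly_Mapping.keys q.
      Poly_Mapping.single (\<alpha> + \<beta>) (Poly_Mapping.lookup p \<alpha> * Poly_Mapping.lookup q \<beta>))"
    by (subst mpoly_expand[of p], subst mpoly_expand[of q]) (simp add: sum_product mult_single)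
  then have "subst \<sigma> (p * q) = (\<Sum>\<alpha>\<in>Poly_Mapping.keys p. \<Sum>\<beta>\<in>Poly_Mapping.keys q.
      const (Poly_Mapping.lookup p \<alpha> * Poly_Mapping.lookup q \<beta>) * subst_mon \<sigma> (\<alpha> + \<beta>))"
    by (simp only: subst_sum subst_single)
  also have "\<dots> = subst \<sigma> p * subst \<sigma> q"
    unfolding subst_def sum_product
    by (intro sum.cong refl) (simp add: subst_mon_add mult_single[of 0 _ 0, simplified, symmetric] mult_ac)
  finally show ?thesis .
qed

lemma subst_1 [simp]: "subst \<sigma> 1 = 1"
  using subst_single[of \<sigma> 0 1] by (simp add: subst_mon_def)

lemma subst_power: "subst \<sigma> (p ^ n) = subst \<sigma> p ^ n"
  by (induction n) (auto simp: subst_mult)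

lemma subst_prod: "subst \<sigma> (\<Prod>s\<in>S. p s) = (\<Prod>s\<in>S. subst \<sigma> (p s))"
  by (induction S rule: infinite_finite_induct) (auto simp: subst_mult)

lemma subst_const [simp]: "subst \<sigma> (const c) = const c"
  by (simp add: subst_single subst_mon_def)

lemma subst_var: "subst \<sigma> (var x) = \<sigma> x"
proof -
  have "subst_mon \<sigma> (unit_exp x) = (\<Prod>y\<in>UNIV. if y = x then \<sigma> x else 1)"
    unfolding subst_mon_def by (intro prod.cong) (auto simp: lookup_single)
  then show ?thesis by (simp add: subst_single)
qed

lemma subst_subst_mon: "subst \<sigma> (subst_mon \<tau> \<alpha>) = subst_mon (\<lambda>y. subst \<sigma> (\<tau> y)) \<alpha>"
  by (simp add: subst_mon_def subst_prod subst_power)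

lemma subst_mon_var: "subst_mon var \<alpha> = mon \<alpha>"
proof -
  have pow: "var y ^ n = mon (Poly_Mapping.single y n)" for y :: 'a and n
    by (induction n) (auto simp: mult_single single_add[symmetric])
  have prod: "(\<Prod>y\<in>S. mon (f y)) = mon (\<Sum>y\<in>S. f y)" for S :: "'a set" and f
    by (induction S rule: infinite_finite_induct) (auto simp: mult_single)
  have "(\<Sum>y\<in>UNIV. Poly_Mapping.single y (Poly_Mapping.lookup \<alpha> y)) = \<alpha>"
    by (rule poly_mapping_eqI) (simp add: lookup_sum lookup_single when_def)
  then show ?thesis by (simp add: subst_mon_def pow prod)
qed

text \<open>
  The substitution by which \<open>A \<in> GL(V)\<close> acts on the symmetric algebra of \<open>V\<close>.
\<close>

definition lin_subst :: "complex^'v^'v \<Rightarrow> 'v::finite \<Rightarrow> 'v mpoly" where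
  "lin_subst A y = (\<Sum>x\<in>UNIV. const (A $ x $ y) * var x)"

lemma lin_subst_1: "lin_subst (mat 1) = var"
proof
  fix y
  have "lin_subst (mat 1) y = (\<Sum>x\<in>UNIV. if x = y then var x else 0)"
    unfolding lin_subst_def by (intro sum.cong) (auto simp: mat_def)
  then show "lin_subst (mat 1) y = var y" by simp
qed

lemma lin_subst_mult: "subst (lin_subst A) (lin_subst B y) = lin_subst (A ** B) y"
proof -
  have const_sum: "const (\<Sum>x\<in>S. f x) = (\<Sum>x\<in>S. const (f x))" for S :: "'a set" and f
    by (induction S rule: infinite_finite_induct) (auto simp: single_add)
  have "subst (lin_subst A) (lin_subst B y) = (\<Sum>x\<in>UNIV. \<Sum>z\<in>UNIV. const (A $ z $ x * B $ x $ y) * var z)"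
    unfolding lin_subst_def[of B] subst_sum subst_mult subst_const subst_var unfolding lin_subst_def sum_distrib_left
    by (intro sum.cong refl) (simp add: mult_single mult.commute)
  also have "\<dots> = (\<Sum>z\<in>UNIV. const (\<Sum>x\<in>UNIV. A $ z $ x * B $ x $ y) * var z)"
    by (subst sum.swap) (simp add: const_sum sum_distrib_right)
  finally show ?thesis by (simp add: lin_subst_def matrix_matrix_mult_def)
qed

lemma homogeneous_subst_mon: "homogeneous (total_degree \<alpha>) (subst_mon (lin_subst A) \<alpha>)"
proof -
  have lin: "homogeneous 1 (lin_subst A y)" for y
    unfolding lin_subst_def by (intro homogeneous_sum) (simp add: mult_single homogeneous_single)
  have pow: "homogeneous n (lin_subst A y ^ n)" for n y
    by (induction n) (auto simp: homogeneous_1 intro: homogeneous_mult[OF lin, simplified])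
  show ?thesis unfolding subst_mon_def total_degree_def by (intro homogeneous_prod pow) simp
qed

lemma subst_homogeneous:
  assumes "homogeneous d p"
  shows "subst \<sigma> p = (\<Sum>\<alpha>\<in>exponents UNIV d. const (Poly_Mapping.lookup p \<alpha>) * subst_mon \<sigma> \<alpha>)"
  using assms by (intro subst_superset) (auto simp: homogeneous_def)

text \<open>
  The matrices of the symmetric powers are multiplicative.
\<close>

lemma subst_mon_mult:
  "Poly_Mapping.lookup (subst_mon (lin_subst (A ** B)) \<alpha>) \<beta> = (\<Sum>\<gamma>\<in>exponents UNIV (total_degree \<alpha>).
     Poly_Mapping.lookup (subst_mon (lin_subst A) \<gamma>) \<beta> * Poly_Mapping.lookup (subst_mon (lin_subst B) \<alpha>) \<gamma>)"
proof -
  have "subst_mon (lin_subst (A ** B)) \<alpha> = subst (lin_subst A) (subst_mon (lin_subst B) \<alpha>)"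
    by (simp add: subst_subst_mon lin_subst_mult)
  also have "\<dots> = (\<Sum>\<gamma>\<in>exponents UNIV (total_degree \<alpha>).
      const (Poly_Mapping.lookup (subst_mon (lin_subst B) \<alpha>) \<gamma>) * subst_mon (lin_subst A) \<gamma>)"
    by (rule subst_homogeneous[OF homogeneous_subst_mon])
  finally show ?thesis by (simp add: lookup_sum lookup_const_mult mult.commute[of "Poly_Mapping.lookup (subst_mon (lin_subst A) _) \<beta>"])
qed

section \<open>The hyperdeterminant of boundary format\<close>

text \<open>
  A basis of \<open>S\<^bsup>k\<^esup>V\<close> as a type, with \<open>k\<close> the dimension of \<open>I\<close>, to index the rows of a determinant.
\<close>

typedef (overloaded) ('v, 'i) top_exponents = "{\<alpha> :: 'v::finite \<Rightarrow>\<^sub>0 nat. \<alpha> \<in> exponents UNIV CARD('i)}"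
proof
  show "Poly_Mapping.single undefined CARD('i) \<in> {\<alpha> :: 'v \<Rightarrow>\<^sub>0 nat. \<alpha> \<in> exponents UNIV CARD('i)}"
    by (simp add: exponents_def)
qed

lemma bij_Rep_top_exponents:
  "bij_betw (Rep_top_exponents :: ('v::finite, 'i) top_exponents \<Rightarrow> _) UNIV (exponents UNIV CARD('i))"
proof (rule bij_betw_imageI)
  show "range (Rep_top_exponents :: ('v, 'i) top_exponents \<Rightarrow> _) = exponents UNIV CARD('i)"
  proof safe
    fix \<alpha> :: "'v \<Rightarrow>\<^sub>0 nat" assume "\<alpha> \<in> exponents UNIV CARD('i)"
    then have "\<alpha> = Rep_top_exponents (Abs_top_exponents \<alpha> :: ('v, 'i) top_exponents)"
      by (simp add: Abs_top_exponents_inverse)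
    then show "\<alpha> \<in> range (Rep_top_exponents :: ('v, 'i) top_exponents \<Rightarrow> _)" by (rule range_eqI)
  qed (use Rep_top_exponents in blast)
qed (simp add: inj_def Rep_top_exponents_inject)

instance top_exponents :: (finite, type) finite
proof
  show "finite (UNIV :: ('a, 'b) top_exponents set)"
    using bij_betw_finite[OF bij_Rep_top_exponents] by simp
qed

lemma card_top_exponents: "CARD(('v::finite, 'i) top_exponents) = card (exponents (UNIV::'v set) CARD('i))"
  using bij_betw_same_card[OF bij_Rep_top_exponents] .

definition map_col :: "complex^'w::finite^('v::finite \<times> 'i::finite) \<Rightarrow> 'w \<Rightarrow> 'v \<Rightarrow> complex^'i" where
  "map_col \<phi> q x = (\<chi> i. \<phi> $ (x, i) $ q)"

text \<open>
  The matrix of \<open>W \<otimes> S\<^bsup>k-1\<^esup>V \<rightarrow> I \<otimes> S\<^bsup>k\<^esup>V\<close>. Rows and columns of a determinant have the same index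
  type, so the columns are numbered through \<open>\<theta>\<close> by the basis of the target.
\<close>

definition sylvester ::
  "(('v, 'i) top_exponents \<times> 'i \<Rightarrow> ('v \<Rightarrow>\<^sub>0 nat) \<times> 'w) \<Rightarrow> complex^'w::finite^('v::finite \<times> 'i::finite)
    \<Rightarrow> complex^(('v, 'i) top_exponents \<times> 'i)^(('v, 'i) top_exponents \<times> 'i)" where
  "sylvester \<theta> \<phi> = (\<chi> r c. Poly_Mapping.lookup (mon (fst (\<theta> c)) * lin_col (map_col \<phi> (snd (\<theta> c))) $ snd r) (Rep_top_exponents (fst r)))"

lemma lookup_mon_lin_col:
  "Poly_Mapping.lookup (mon \<beta> * lin_col b $ i) \<alpha> = (\<Sum>x\<in>UNIV. b x $ i * (if \<beta> + unit_exp x = \<alpha> then 1 else 0))"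
  by (simp add: lin_col_def sum_distrib_left mult_single lookup_sum lookup_single when_def if_distrib cong: if_cong)

lemma det_sylvester_form:
  fixes \<theta> :: "('v::finite, 'i::finite) top_exponents \<times> 'i \<Rightarrow> ('v \<Rightarrow>\<^sub>0 nat) \<times> 'w::finite"
  shows "(\<lambda>\<phi>. det (sylvester \<theta> \<phi>)) \<in> forms CARD(('v, 'i) top_exponents \<times> 'i)"
proof (rule forms_det)
  fix r c :: "('v, 'i) top_exponents \<times> 'i"
  have "(\<lambda>\<phi> :: complex^'w^('v \<times> 'i). \<Sum>x\<in>UNIV. \<phi> $ (x, snd r) $ snd (\<theta> c) *
      (if fst (\<theta> c) + unit_exp x = Rep_top_exponents (fst r) then 1 else 0)) \<in> forms (1 + 0)"
    by (intro forms_sum forms_mult forms_coord forms_const) auto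
  then show "(\<lambda>\<phi>. sylvester \<theta> \<phi> $ r $ c) \<in> forms 1"
    by (simp add: sylvester_def lookup_mon_lin_col map_col_def)
qed

lemma matrix_mult_entry: "(A ** B) $ i $ j = (\<Sum>k\<in>UNIV. A $ i $ k * B $ k $ j)"
  by (simp add: matrix_matrix_mult_def)

lemma sum_rows:
  fixes f :: "('v::finite \<Rightarrow>\<^sub>0 nat) \<Rightarrow> 'i::finite \<Rightarrow> complex"
  shows "(\<Sum>r\<in>(UNIV :: (('v, 'i) top_exponents \<times> 'i) set). f (Rep_top_exponents (fst r)) (snd r)) =
    (\<Sum>\<alpha>\<in>exponents UNIV CARD('i). \<Sum>i\<in>UNIV. f \<alpha> i)"
proof -
  have "(\<Sum>r\<in>(UNIV :: (('v, 'i) top_exponents \<times> 'i) set). f (Rep_top_exponents (fst r)) (snd r)) =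
    (\<Sum>a\<in>UNIV. \<Sum>i\<in>UNIV. f (Rep_top_exponents (a :: ('v,'i) top_exponents)) i)"
    by (simp add: sum.cartesian_product split_def)
  also have "\<dots> = (\<Sum>\<alpha>\<in>exponents UNIV CARD('i). \<Sum>i\<in>UNIV. f \<alpha> i)"
    by (rule sum.reindex_bij_betw[OF bij_Rep_top_exponents, of "\<lambda>\<alpha>. \<Sum>i\<in>UNIV. f \<alpha> i"])
  finally show ?thesis .
qed

locale sylvester_index =
  fixes \<theta> :: "('v::finite, 'i::finite) top_exponents \<times> 'i \<Rightarrow> ('v \<Rightarrow>\<^sub>0 nat) \<times> 'w::finite" and d :: nat
  assumes d: "CARD('i) = Suc d" and \<theta>: "bij_betw \<theta> UNIV (exponents UNIV d \<times> UNIV)"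
begin

lemma sum_cols:
  "(\<Sum>c\<in>UNIV. f (fst (\<theta> c)) (snd (\<theta> c))) = (\<Sum>\<beta>\<in>exponents UNIV d. \<Sum>q\<in>UNIV. f \<beta> q :: complex)"
proof -
  have "(\<Sum>c\<in>UNIV. f (fst (\<theta> c)) (snd (\<theta> c))) = (\<Sum>p\<in>exponents UNIV d \<times> UNIV. f (fst p) (snd p))"
    by (rule sum.reindex_bij_betw[OF \<theta>, of "\<lambda>p. f (fst p) (snd p)"])
  then show ?thesis by (simp add: sum.cartesian_product split_def)
qed

lemma \<theta>_deg: "fst (\<theta> c) \<in> exponents UNIV d" "total_degree (fst (\<theta> c)) = d"
proof -
  have "\<theta> c \<in> exponents UNIV d \<times> UNIV" using bij_betwE[OF \<theta>] by blast
  then show "fst (\<theta> c) \<in> exponents UNIV d" by (simp only: mem_Times_iff)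
  then show "total_degree (fst (\<theta> c)) = d" by (simp add: exponents_def)
qed

lemma Rep_deg: "total_degree (Rep_top_exponents (a :: ('v, 'i) top_exponents)) = Suc d"
  using Rep_top_exponents[of a] by (simp add: exponents_def d)

lemma \<theta>_inj: "\<theta> c = \<theta> c' \<longleftrightarrow> c = c'"
  using bij_betw_imp_inj_on[OF \<theta>] by (rule inj_eq)

lemma eq_iff_\<theta>: "r = c \<longleftrightarrow> fst (\<theta> r) = fst (\<theta> c) \<and> snd (\<theta> r) = snd (\<theta> c)"
  by (metis \<theta>_inj prod_eq_iff)

text \<open>
  The group acts on the target by a representation.
\<close>

lemma det_sylvester_SL_I:
  assumes B: "det B = 1"
  shows "det (sylvester \<theta> (kron (mat 1) B ** \<phi>)) = det (sylvester \<theta> \<phi>)"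
proof -
  define K :: "complex^'i^'i \<Rightarrow> complex^(('v, 'i) top_exponents \<times> 'i)^(('v, 'i) top_exponents \<times> 'i)" where
    "K B = (\<chi> r s. if fst r = fst s then B $ snd r $ snd s else 0)" for B
  have sum_fst: "(\<Sum>s\<in>UNIV. if a = fst s then f (snd s) else 0) = (\<Sum>i\<in>UNIV. f i)"
    for a :: "('v, 'i) top_exponents" and f :: "'i \<Rightarrow> complex"
  proof -
    have "(\<Sum>s\<in>UNIV. if a = fst s then f (snd s) else 0) = (\<Sum>a'\<in>UNIV. \<Sum>i\<in>UNIV. if a = a' then f i else 0)"
      by (simp add: sum.cartesian_product split_def)
    also have "\<dots> = (\<Sum>a'\<in>UNIV. if a = a' then (\<Sum>i\<in>UNIV. f i) else 0)" by (intro sum.cong) auto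
    finally show ?thesis by simp
  qed
  have K_mult: "(K B ** M) $ r $ c = (\<Sum>i\<in>UNIV. B $ snd r $ i * M $ (fst r, i) $ c)" for B M r c
    by (subst sum_fst[of "fst r", symmetric], unfold matrix_matrix_mult_def vec_lambda_beta)
       (auto simp: K_def intro!: sum.cong)
  have "det (K B) = 1"
  proof (rule det_representation_SL[OF _ _ B])
    show "K (A ** B) = K A ** K B" for A B
    proof -
      have "(K A ** K B) $ r $ c = K (A ** B) $ r $ c" for r c
        unfolding K_mult by (simp add: K_def matrix_matrix_mult_def)
      then show ?thesis by (simp add: vec_eq_iff)
    qed
    show "K (mat 1) = mat 1" by (auto simp: K_def mat_def vec_eq_iff prod_eq_iff)
  qed
  moreover have "sylvester \<theta> (kron (mat 1) B ** \<phi>) = K B ** sylvester \<theta> \<phi>"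
  proof -
    have act: "(kron (mat 1) B ** \<phi>) $ (x, i) $ q = (\<Sum>j\<in>UNIV. B $ i $ j * \<phi> $ (x, j) $ q)" for x i q
    proof -
      have "(kron (mat 1) B ** \<phi>) $ (x, i) $ q = (\<Sum>y\<in>UNIV. \<Sum>j\<in>UNIV. (if x = y then 1 else 0) * (B $ i $ j * \<phi> $ (y, j) $ q))"
        by (simp add: matrix_matrix_mult_def kron_def mat_def sum.cartesian_product split_def mult.assoc)
      also have "\<dots> = (\<Sum>y\<in>UNIV. if x = y then (\<Sum>j\<in>UNIV. B $ i $ j * \<phi> $ (x, j) $ q) else 0)"
        by (intro sum.cong) auto
      finally show ?thesis by simp
    qed
    have "sylvester \<theta> (kron (mat 1) B ** \<phi>) $ r $ c = (K B ** sylvester \<theta> \<phi>) $ r $ c" for r c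
      unfolding K_mult sylvester_def vec_lambda_beta lookup_mon_lin_col map_col_def act fst_conv snd_conv
      unfolding sum_distrib_right sum_distrib_left by (subst sum.swap) (simp add: mult.assoc)
    then show ?thesis by (simp add: vec_eq_iff)
  qed
  ultimately show ?thesis by (simp add: det_mul)
qed

text \<open>
  The group acts on the source by a representation.
\<close>

lemma det_sylvester_SL_W:
  assumes C: "det C = 1"
  shows "det (sylvester \<theta> (\<phi> ** C)) = det (sylvester \<theta> \<phi>)"
proof -
  define K :: "complex^'w^'w \<Rightarrow> complex^(('v, 'i) top_exponents \<times> 'i)^(('v, 'i) top_exponents \<times> 'i)" where
    "K C = (\<chi> r c. if fst (\<theta> r) = fst (\<theta> c) then C $ snd (\<theta> r) $ snd (\<theta> c) else 0)" for C
  have mult_K: "(\<Sum>s\<in>UNIV. g (fst (\<theta> s)) (snd (\<theta> s)) * K C $ s $ c) = (\<Sum>q\<in>UNIV. g (fst (\<theta> c)) q * C $ q $ snd (\<theta> c))" for g C c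
  proof -
    have "(\<Sum>s\<in>UNIV. g (fst (\<theta> s)) (snd (\<theta> s)) * K C $ s $ c) =
      (\<Sum>\<beta>\<in>exponents UNIV d. \<Sum>q\<in>UNIV. g \<beta> q * (if \<beta> = fst (\<theta> c) then C $ q $ snd (\<theta> c) else 0))"
      unfolding K_def vec_lambda_beta
      by (rule sum_cols[of "\<lambda>\<beta> q. g \<beta> q * (if \<beta> = fst (\<theta> c) then C $ q $ snd (\<theta> c) else 0)"])
    also have "\<dots> = (\<Sum>\<beta>\<in>exponents UNIV d. if \<beta> = fst (\<theta> c) then (\<Sum>q\<in>UNIV. g (fst (\<theta> c)) q * C $ q $ snd (\<theta> c)) else 0)"
      by (intro sum.cong) auto
    finally show ?thesis using \<theta>_deg(1)[of c] by simp
  qed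
  have "det (K C) = 1"
  proof (rule det_representation_SL[OF _ _ C])
    show "K (A ** B) = K A ** K B" for A B
    proof -
      have "(K A ** K B) $ r $ c = K (A ** B) $ r $ c" for r c
      proof -
        have "(K A ** K B) $ r $ c = (\<Sum>q\<in>UNIV. (if fst (\<theta> r) = fst (\<theta> c) then A $ snd (\<theta> r) $ q else 0) * B $ q $ snd (\<theta> c))"
          unfolding matrix_matrix_mult_def vec_lambda_beta
          by (subst mult_K[symmetric]) (simp add: K_def)
        then show ?thesis by (simp add: K_def matrix_matrix_mult_def)
      qed
      then show ?thesis by (simp add: vec_eq_iff)
    qed
    have "K (mat 1) $ r $ c = mat 1 $ r $ c" for r c
      by (simp add: K_def mat_def eq_iff_\<theta>[of r c])
    then show "K (mat 1) = mat 1" by (simp add: vec_eq_iff)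
  qed
  moreover have "sylvester \<theta> (\<phi> ** C) = sylvester \<theta> \<phi> ** K C"
  proof -
    have "sylvester \<theta> (\<phi> ** C) $ r $ c = (sylvester \<theta> \<phi> ** K C) $ r $ c" for r c
    proof -
      have "(sylvester \<theta> \<phi> ** K C) $ r $ c = (\<Sum>q\<in>UNIV.
          Poly_Mapping.lookup (mon (fst (\<theta> c)) * lin_col (map_col \<phi> q) $ snd r) (Rep_top_exponents (fst r)) * C $ q $ snd (\<theta> c))"
        unfolding matrix_matrix_mult_def vec_lambda_beta
        by (subst mult_K[symmetric]) (simp add: sylvester_def)
      also have "\<dots> = sylvester \<theta> (\<phi> ** C) $ r $ c"
        unfolding sylvester_def vec_lambda_beta lookup_mon_lin_col map_col_def matrix_matrix_mult_def
        unfolding sum_distrib_right by (subst sum.swap) (simp add: mult_ac)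
      finally show ?thesis by simp
    qed
    then show ?thesis by (simp add: vec_eq_iff)
  qed
  ultimately show ?thesis by (simp add: det_mul)
qed

text \<open>
  The map is equivariant for the symmetric powers of \<open>A\<close>, of degree \<open>k - 1\<close> on the source and \<open>k\<close> on
  the target, and the determinants of both are one.
\<close>

lemma det_sylvester_SL_V:
  assumes A: "det A = 1"
  shows "det (sylvester \<theta> (kron A (mat 1) ** \<phi>)) = det (sylvester \<theta> \<phi>)"
proof -
  define P :: "complex^'v^'v \<Rightarrow> complex^(('v, 'i) top_exponents \<times> 'i)^(('v, 'i) top_exponents \<times> 'i)" where
    "P A = (\<chi> r s. if snd r = snd s
       then Poly_Mapping.lookup (subst_mon (lin_subst A) (Rep_top_exponents (fst s))) (Rep_top_exponents (fst r)) else 0)" for A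
  define Q :: "complex^'v^'v \<Rightarrow> complex^(('v, 'i) top_exponents \<times> 'i)^(('v, 'i) top_exponents \<times> 'i)" where
    "Q A = (\<chi> r c. if snd (\<theta> r) = snd (\<theta> c)
       then Poly_Mapping.lookup (subst_mon (lin_subst A) (fst (\<theta> c))) (fst (\<theta> r)) else 0)" for A
  have mult_Q: "(\<Sum>s\<in>UNIV. g (fst (\<theta> s)) (snd (\<theta> s)) * Q A $ s $ c) =
      (\<Sum>\<beta>\<in>exponents UNIV d. g \<beta> (snd (\<theta> c)) * Poly_Mapping.lookup (subst_mon (lin_subst A) (fst (\<theta> c))) \<beta>)" for g A c
  proof -
    have "(\<Sum>s\<in>UNIV. g (fst (\<theta> s)) (snd (\<theta> s)) * Q A $ s $ c) =
      (\<Sum>\<beta>\<in>exponents UNIV d. \<Sum>q\<in>UNIV. g \<beta> q * (if q = snd (\<theta> c) then Poly_Mapping.lookup (subst_mon (lin_subst A) (fst (\<theta> c))) \<beta> else 0))"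
      unfolding Q_def vec_lambda_beta
      by (rule sum_cols[of "\<lambda>\<beta> q. g \<beta> q * (if q = snd (\<theta> c) then Poly_Mapping.lookup (subst_mon (lin_subst A) (fst (\<theta> c))) \<beta> else 0)"])
    then show ?thesis by (simp add: if_distrib cong: if_cong)
  qed
  have P_mult: "(\<Sum>s\<in>UNIV. P A $ r $ s * g (Rep_top_exponents (fst s)) (snd s)) =
      (\<Sum>\<alpha>\<in>exponents UNIV CARD('i). Poly_Mapping.lookup (subst_mon (lin_subst A) \<alpha>) (Rep_top_exponents (fst r)) * g \<alpha> (snd r))" for g A r
  proof -
    have "(\<Sum>s\<in>UNIV. P A $ r $ s * g (Rep_top_exponents (fst s)) (snd s)) =
      (\<Sum>\<alpha>\<in>exponents UNIV CARD('i). \<Sum>i\<in>UNIV. (if snd r = i then Poly_Mapping.lookup (subst_mon (lin_subst A) \<alpha>) (Rep_top_exponents (fst r)) else 0) * g \<alpha> i)"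
      unfolding P_def vec_lambda_beta
      by (rule sum_rows[of "\<lambda>\<alpha> i. (if snd r = i then Poly_Mapping.lookup (subst_mon (lin_subst A) \<alpha>) (Rep_top_exponents (fst r)) else 0) * g \<alpha> i"])
    then show ?thesis by (simp add: if_distrib if_distribR cong: if_cong)
  qed
  have "det (P A) = 1"
  proof (rule det_representation_SL[OF _ _ A])
    show "P (A ** B) = P A ** P B" for A B
    proof -
      have "(P A ** P B) $ r $ c = P (A ** B) $ r $ c" for r c
      proof -
        have "(P A ** P B) $ r $ c = (\<Sum>\<alpha>\<in>exponents UNIV CARD('i). Poly_Mapping.lookup (subst_mon (lin_subst A) \<alpha>) (Rep_top_exponents (fst r)) *
           (if snd r = snd c then Poly_Mapping.lookup (subst_mon (lin_subst B) (Rep_top_exponents (fst c))) \<alpha> else 0))"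
          unfolding matrix_matrix_mult_def vec_lambda_beta by (subst P_mult[symmetric]) (simp add: P_def)
        then show ?thesis by (simp add: P_def subst_mon_mult Rep_deg d)
      qed
      then show ?thesis by (simp add: vec_eq_iff)
    qed
    have "P (mat 1) $ r $ c = mat 1 $ r $ c" for r c
      unfolding P_def lin_subst_1 subst_mon_var
      by (auto simp: mat_def prod_eq_iff lookup_single when_def Rep_top_exponents_inject)
    then show "P (mat 1) = mat 1" by (simp add: vec_eq_iff)
  qed
  moreover have "det (Q A) = 1"
  proof (rule det_representation_SL[OF _ _ A])
    show "Q (A ** B) = Q A ** Q B" for A B
    proof -
      have "(Q A ** Q B) $ r $ c = Q (A ** B) $ r $ c" for r c
      proof -
        have "(Q A ** Q B) $ r $ c = (\<Sum>\<beta>\<in>exponents UNIV d.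
           (if snd (\<theta> r) = snd (\<theta> c) then Poly_Mapping.lookup (subst_mon (lin_subst A) \<beta>) (fst (\<theta> r)) else 0) *
           Poly_Mapping.lookup (subst_mon (lin_subst B) (fst (\<theta> c))) \<beta>)"
          unfolding matrix_matrix_mult_def vec_lambda_beta by (subst mult_Q[symmetric]) (simp add: Q_def)
        then show ?thesis by (simp add: Q_def subst_mon_mult \<theta>_deg)
      qed
      then show ?thesis by (simp add: vec_eq_iff)
    qed
    have "Q (mat 1) $ r $ c = mat 1 $ r $ c" for r c
      unfolding Q_def lin_subst_1 subst_mon_var
      by (auto simp: mat_def eq_iff_\<theta>[of r c] lookup_single when_def)
    then show "Q (mat 1) = mat 1" by (simp add: vec_eq_iff)
  qed
  moreover have "sylvester \<theta> (kron A (mat 1) ** \<phi>) ** Q A = P A ** sylvester \<theta> \<phi>"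
  proof -
    have act: "(kron A (mat 1) ** \<phi>) $ (x, i) $ q = (\<Sum>y\<in>UNIV. A $ x $ y * \<phi> $ (y, i) $ q)" for x i q
    proof -
      have "(kron A (mat 1) ** \<phi>) $ (x, i) $ q = (\<Sum>y\<in>UNIV. \<Sum>j\<in>UNIV. (if i = j then A $ x $ y * \<phi> $ (y, j) $ q else 0))"
        unfolding matrix_matrix_mult_def kron_def mat_def vec_lambda_beta sum.cartesian_product
        by (rule sum.cong) auto
      then show ?thesis by simp
    qed
    have subst_col: "lin_col (map_col (kron A (mat 1) ** \<phi>) q) $ i = subst (lin_subst A) (lin_col (map_col \<phi> q) $ i)" for q i
    proof -
      have const_sum: "const (\<Sum>x\<in>S. f x) = (\<Sum>x\<in>S. const (f x))" for S :: "'v set" and f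
        by (induction S rule: infinite_finite_induct) (auto simp: single_add)
      show ?thesis
        unfolding lin_col_def map_col_def vec_lambda_beta act subst_sum subst_mult subst_const subst_var lin_subst_def
        unfolding const_sum sum_distrib_left sum_distrib_right
        by (subst sum.swap) (simp add: mult_single mult_ac)
    qed
    have "(sylvester \<theta> (kron A (mat 1) ** \<phi>) ** Q A) $ r $ c = (P A ** sylvester \<theta> \<phi>) $ r $ c" for r c
    proof -
      let ?\<sigma> = "subst_mon (lin_subst A)" and ?\<beta> = "fst (\<theta> c)" and ?\<alpha> = "Rep_top_exponents (fst r)"
      let ?p = "lin_col (map_col \<phi> (snd (\<theta> c))) $ snd r"
      have \<alpha>: "?\<alpha> \<in> exponents UNIV (d + 1)" using Rep_deg by (simp add: exponents_def)
      have "(sylvester \<theta> (kron A (mat 1) ** \<phi>) ** Q A) $ r $ c = (\<Sum>\<beta>\<in>exponents UNIV d.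
          Poly_Mapping.lookup (mon \<beta> * subst (lin_subst A) ?p) ?\<alpha> * Poly_Mapping.lookup (?\<sigma> ?\<beta>) \<beta>)"
        by (subst matrix_mult_entry, subst mult_Q[symmetric]) (simp add: sylvester_def subst_col)
      also have "\<dots> = Poly_Mapping.lookup (?\<sigma> ?\<beta> * subst (lin_subst A) ?p) ?\<alpha>"
        by (subst lookup_mult_restrict[OF _ \<alpha>]) (simp_all add: mult.commute homogeneous_lin_col[simplified] subst_col[symmetric])
      also have "?\<sigma> ?\<beta> * subst (lin_subst A) ?p = subst (lin_subst A) (mon ?\<beta> * ?p)"
        by (simp add: subst_mult subst_single)
      also have "\<dots> = (\<Sum>\<alpha>\<in>exponents UNIV CARD('i). const (Poly_Mapping.lookup (mon ?\<beta> * ?p) \<alpha>) * ?\<sigma> \<alpha>)"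
      proof (rule subst_homogeneous)
        have "homogeneous (d + 1) (mon ?\<beta> * ?p)"
          by (intro homogeneous_mult homogeneous_lin_col) (simp add: homogeneous_single \<theta>_deg)
        then show "homogeneous CARD('i) (mon ?\<beta> * ?p)" by (simp add: d)
      qed
      also have "Poly_Mapping.lookup \<dots> ?\<alpha> = (P A ** sylvester \<theta> \<phi>) $ r $ c"
        unfolding matrix_matrix_mult_def vec_lambda_beta sylvester_def
        by (subst P_mult[of A r "\<lambda>\<alpha> i. Poly_Mapping.lookup (mon ?\<beta> * lin_col (map_col \<phi> (snd (\<theta> c))) $ i) \<alpha>"],
            simp add: lookup_sum lookup_const_mult) (rule sum.cong[OF refl mult.commute])
      finally show ?thesis .
    qed
    then show ?thesis by (simp add: vec_eq_iff)
  qed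
  ultimately show ?thesis by (metis det_mul mult_1 mult.right_neutral)
qed

end

lemma full_row_rank_kernel:
  fixes A :: "complex^'n^'m"
  assumes "rank A = CARD('m)" and 0: "\<And>q. (\<Sum>i\<in>UNIV. \<eta> $ i * A $ i $ q) = 0"
  shows "\<eta> = 0"
proof (rule ccontr)
  assume "\<eta> \<noteq> 0"
  then obtain m where m: "\<eta> $ m \<noteq> 0" by (auto simp: vec_eq_iff)
  let ?B = "(\<lambda>i. row i A) ` (UNIV - {m})"
  have "row m A = (\<Sum>i\<in>UNIV-{m}. (- \<eta> $ i / \<eta> $ m) *s row i A)"
  proof -
    have "\<eta> $ m * A $ m $ q + (\<Sum>i\<in>UNIV-{m}. \<eta> $ i * A $ i $ q) = 0" for q
      using 0[of q] by (simp add: sum.remove[of UNIV m])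
    then have "A $ m $ q = (\<Sum>i\<in>UNIV-{m}. - \<eta> $ i / \<eta> $ m * A $ i $ q)" for q
      using m by (simp add: sum_negf sum_divide_distrib[symmetric] field_simps eq_neg_iff_add_eq_0)
    then show ?thesis by (simp add: vec_eq_iff row_def)
  qed
  then have "row m A \<in> vec.span ?B" by (metis (no_types, lifting) imageI vec.span_base vec.span_scale vec.span_sum)
  then have "rows A \<subseteq> vec.span ?B" by (auto simp: rows_def intro: vec.span_base)
  then have "vec.dim (rows A) \<le> card ?B" by (intro vec.dim_le_card) auto
  also have "\<dots> \<le> card (UNIV - {m})" by (rule card_image_le) simp
  also have "\<dots> < CARD('m)" by (simp add: card_gt_0_iff)
  finally show False using assms(1) by (simp add: row_rank_def_gen)
qed

text \<open>
  A vector in the kernel of the transposed matrix consists of the coefficients of a functional on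
  \<open>I \<otimes> S\<^bsup>k\<^esup>V\<close> that kills the image.
\<close>

lemma det_sylvester_nonzero:
  fixes \<phi> :: "complex^'w::finite^('v::finite \<times> 'i::finite)"
  assumes "sylvester_index \<theta> d" and card: "CARD('w) = CARD('v) + CARD('i) - 1" and \<phi>: "\<phi> \<in> steiner_maps"
  shows "det (sylvester \<theta> \<phi>) \<noteq> 0"
proof -
  interpret sylvester_index \<theta> d by fact
  obtain e :: "nat \<Rightarrow> 'w" where e: "bij_betw e {..<CARD('w)} UNIV"
    using ex_bij_betw_nat_finite[of "UNIV :: 'w set"] by (auto simp: atLeast0LessThan)
  define b where "b j = map_col \<phi> (e j)" for j
  have nd: "nondegenerate UNIV CARD('w) b"
    unfolding nondegenerate_def
  proof (intro allI impI)
    fix x :: "'v \<Rightarrow> complex" and \<eta> :: "complex^'i"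
    assume x: "\<exists>v\<in>UNIV. x v \<noteq> 0" and 0: "\<forall>j<CARD('w). (\<Sum>v\<in>UNIV. \<Sum>i\<in>UNIV. x v * \<eta> $ i * b j v $ i) = 0"
    let ?x = "\<chi> v. x v"
    have "?x \<noteq> 0" using x by (auto simp: vec_eq_iff)
    then have "rank (contract ?x \<phi>) = min CARD('w) CARD('i)" using \<phi> by (simp add: steiner_maps_def)
    moreover have "CARD('i) \<le> CARD('w)" using card zero_less_card_finite[where 'a = 'v] by linarith
    ultimately have "rank (contract ?x \<phi>) = CARD('i)" by simp
    then show "\<eta> = 0"
    proof (rule full_row_rank_kernel)
      fix q
      obtain j where j: "j < CARD('w)" "q = e j" using e by (auto simp: bij_betw_def)
      have "(\<Sum>i\<in>UNIV. \<eta> $ i * contract ?x \<phi> $ i $ q) = (\<Sum>v\<in>UNIV. \<Sum>i\<in>UNIV. x v * \<eta> $ i * b j v $ i)"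
        unfolding contract_def vec_lambda_beta sum_distrib_left
        by (subst sum.swap) (simp add: b_def map_col_def j(2) mult_ac)
      then show "(\<Sum>i\<in>UNIV. \<eta> $ i * contract ?x \<phi> $ i $ q) = 0" using 0 j by simp
    qed
  qed
  have dual: "cokernel_dual UNIV CARD('i) b CARD('w) \<subseteq> {\<lambda>_. 0}"
    by (rule cokernel_dual_eq_zero[OF _ nd]) (simp_all add: card)
  have "g = 0" if g: "transpose (sylvester \<theta> \<phi>) *v g = 0" for g
  proof -
    let ?g = "\<lambda>\<alpha> i. if \<alpha> \<in> exponents UNIV CARD('i) then g $ (Abs_top_exponents \<alpha>, i) else 0"
    have funG: "functional (from_coeffs ?g)" by (rule functional_from_coeffs)
    have "from_coeffs ?g \<in> cokernel_dual UNIV (Suc d) b CARD('w)"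
    proof (rule cokernel_dualI[OF funG])
      fix j and \<beta> :: "'v \<Rightarrow>\<^sub>0 nat" assume j: "j < CARD('w)" and \<beta>: "\<beta> \<in> exponents UNIV d"
      have "(\<beta>, e j) \<in> range \<theta>" using bij_betw_imp_surj_on[OF \<theta>] \<beta> by simp
      then obtain c where c: "\<theta> c = (\<beta>, e j)" by (metis imageE)
      have "0 = (\<Sum>r\<in>UNIV. sylvester \<theta> \<phi> $ r $ c * g $ r)"
        using arg_cong[OF g, of "\<lambda>v. v $ c"] by (simp add: matrix_vector_mult_def transpose_def)
      also have "\<dots> = (\<Sum>r\<in>(UNIV :: (('v, 'i) top_exponents \<times> 'i) set). (\<lambda>\<alpha> i. Poly_Mapping.lookup (mon \<beta> * lin_col (b j) $ i) \<alpha> * ?g \<alpha> i) (Rep_top_exponents (fst r)) (snd r))"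
        by (intro sum.cong refl) (simp add: sylvester_def c b_def Rep_top_exponents_inverse Rep_top_exponents[simplified])
      also have "\<dots> = (\<Sum>\<alpha>\<in>exponents UNIV CARD('i). \<Sum>i\<in>UNIV. Poly_Mapping.lookup (mon \<beta> * lin_col (b j) $ i) \<alpha> * ?g \<alpha> i)"
        by (rule sum_rows)
      also have "\<dots> = (\<Sum>i\<in>UNIV. \<Sum>\<alpha>\<in>exponents UNIV CARD('i).
          Poly_Mapping.lookup ((mon \<beta> *s lin_col (b j)) $ i) \<alpha> * from_coeffs ?g (monvec \<alpha> i))"
        by (subst sum.swap) simp
      also have "\<dots> = from_coeffs ?g (mon \<beta> *s lin_col (b j))"
        by (rule functional_supported[OF funG, symmetric]) simp
      finally show "from_coeffs ?g (mon \<beta> *s lin_col (b j)) = 0" by simp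
    qed (simp add: d)
    then have zero: "from_coeffs ?g = (\<lambda>_. 0)" using dual unfolding d by blast
    have "g $ (a, i) = 0" for a i
    proof -
      have "from_coeffs ?g (monvec (Rep_top_exponents a) i) = 0" by (simp only: zero)
      then show ?thesis using Rep_top_exponents[of a] by (simp add: Rep_top_exponents_inverse)
    qed
    then show "g = 0" by (auto simp: vec_eq_iff)
  qed
  then have "invertible (transpose (sylvester \<theta> \<phi>))"
    unfolding invertible_left_inverse matrix_left_invertible_ker by blast
  then show ?thesis by (simp add: invertible_det_nz det_transpose)
qed

theorem corollary6p3:
  fixes n k r :: nat
    and p :: "(complex^'w::finite^('v::finite \<times> 'i::finite)) set"
  assumes "CARD('v) = n + 1" and "CARD('w) = n + k" and "CARD('i) = k"
    and "r > 0"
    and "p \<in> steiner_moduli"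
  shows "git_semistable SL_W_I_action r SL_V_action p"
proof -
  obtain \<phi> where \<phi>: "\<phi> \<in> steiner_maps" "p = git_rel SL_W_I_action `` {\<phi>}"
    using assms(5) by (auto simp: steiner_moduli_def)
  obtain d where d: "CARD('i) = Suc d" using not0_implies_Suc[of "CARD('i)"] by auto
  have card: "CARD('w) = CARD('v) + CARD('i) - 1" using assms(1-3) by simp
  let ?R = "UNIV :: (('v, 'i) top_exponents \<times> 'i) set"
  have "card ?R = card (exponents (UNIV :: 'v set) d \<times> (UNIV :: 'w set))"
  proof -
    have "CARD('i) * (CARD('w) choose CARD('i)) = CARD('w) * (CARD('w) - 1 choose (CARD('i) - 1))"
      by (rule times_binomial_minus1_eq) (simp add: d)
    moreover have "CARD('w) = n + CARD('i)" "CARD('w) - 1 = n + d" "CARD('v) = Suc n" using assms(1-3) d by auto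
    ultimately show ?thesis
      by (simp add: card_cartesian_product card_top_exponents card_exponents card_prod mult.commute d)
  qed
  then have "\<exists>\<theta> :: _ \<Rightarrow> ('v \<Rightarrow>\<^sub>0 nat) \<times> 'w. bij_betw \<theta> ?R (exponents UNIV d \<times> UNIV)"
    by (intro finite_same_card_bij) simp_all
  then obtain \<theta> :: "('v, 'i) top_exponents \<times> 'i \<Rightarrow> ('v \<Rightarrow>\<^sub>0 nat) \<times> 'w"
    where \<theta>: "bij_betw \<theta> ?R (exponents UNIV d \<times> UNIV)" by blast
  interpret sylvester_index \<theta> d using d \<theta> by unfold_locales
  let ?D = "CARD(('v, 'i) top_exponents \<times> 'i)" and ?G = "SL_W_I_action :: (complex^'w^('v \<times> 'i) \<Rightarrow> _) set"
  define f where "f \<psi> = det (sylvester \<theta> \<psi>)" for \<psi> :: "complex^'w^('v \<times> 'i)"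
  have f_form: "f \<in> forms ?D" using det_sylvester_form[of \<theta>] by (simp add: f_def[abs_def])
  have f_G: "f (g \<psi>) = f \<psi>" if g: "g \<in> ?G" for g \<psi>
  proof -
    obtain A :: "complex^'w^'w" and B :: "complex^'i^'i" where AB: "det A = 1" "det B = 1"
      "g = (\<lambda>\<phi>. kron (mat 1) B ** \<phi> ** matrix_inv A)"
      using g by (auto simp: SL_W_I_action_def SL_def)
    have "invertible A" using AB(1) by (simp add: invertible_det_nz)
    then have "A ** matrix_inv A = mat 1" unfolding invertible_def matrix_inv_def by (rule someI2_ex) simp
    then have "det A * det (matrix_inv A) = 1" by (metis det_I det_mul)
    then have "det (matrix_inv A) = 1" using AB(1) by simp
    then show ?thesis by (simp add: f_def AB(3) det_sylvester_SL_W det_sylvester_SL_I AB(2))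
  qed
  have f_H: "f (h \<psi>) = f \<psi>" if "h \<in> SL_V_action" for h \<psi>
    using that by (auto simp: SL_V_action_def SL_def f_def det_sylvester_SL_V)
  have f\<phi>: "f \<phi> \<noteq> 0" unfolding f_def by (rule det_sylvester_nonzero[OF _ card \<phi>(1)]) unfold_locales
  have f_inv: "f \<in> invariant_forms ?G ?D" using f_form f_G by (simp add: invariant_forms_def)
  have Dpos: "?D > 0" by (simp only: zero_less_card_finite)
  have ss: "\<phi> \<in> semistable_locus ?G" unfolding semistable_locus_def using f_inv f\<phi> Dpos by blast
  have sect: "(\<lambda>\<psi>. f \<psi> ^ r) \<in> git_sections ?G (r * ?D)"
  proof -
    have "(\<lambda>\<psi>. f \<psi> ^ r) \<in> invariant_forms ?G (r * ?D + 0)"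
      using forms_power[OF f_form] f_G by (simp add: invariant_forms_def)
    moreover have "(\<lambda>\<psi>. 1) \<in> invariant_forms ?G 0"
      using forms_const[of 1] by (simp add: invariant_forms_def)
    ultimately show ?thesis unfolding git_sections_def
      by (intro CollectI ballI exI[of _ 0] bexI[of _ "\<lambda>\<psi>. f \<psi> ^ r"] bexI[of _ "\<lambda>\<psi>. 1"]) auto
  qed
  have nonzero: "f \<psi> ^ r \<noteq> 0" if "\<psi> \<in> p" for \<psi>
    using git_sections_nonzero_cong[OF sect, of \<phi> \<psi>] that f\<phi> by (simp add: \<phi>(2))
  have "p \<in> git_quotient ?G" unfolding git_quotient_def \<phi>(2) using ss by (rule quotientI)
  then show ?thesis
    unfolding git_semistable_def
    using Dpos sect nonzero f_H by (intro conjI exI[of _ ?D] bexI[of _ "\<lambda>\<psi>. f \<psi> ^ r"]) auto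
qed

end
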